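(* (1) The indecomposable graded Cohen–Macaulay $\Lambda$-modules are, up to isomorphism, exactly the pairwise non-isomorphic modules $(i,j)$ with $i,j\in\mathbb Z$, $0<j-i<n$; the projective-injective ones are those of the form $(i,i+1)$ and $(i,i+n-1)$, $i\in\mathbb Z$. (2) The non-split extensions of indecomposable graded Cohen–Macaulay $\Lambda$-modules are of the form $0\to(s,t)\to(s,t')\oplus(s',t)\to(s',t')\to0$ with $s<s'<t<t'<s+n$. (3) For every non-projective indecomposable $(i,j)$, the Auslander–Reiten sequence ending at $(i,j)$ in $\mathrm{CM}^{\mathbb Z}(\Lambda)$ is $0\to(i-1,j-1)\to(i-1,j)\oplus(i,j-1)\to(i,j)\to0$. (4) The Auslander–Reiten quiver of $\mathrm{CM}^{\mathbb Z}(\Lambda)$ has vertices $(i,j)$, $0<j-i<n$, and arrows $(i,j)\to(i+1,j)$ and $(i,j)\to(i,j+1)$ whenever the target lies in this range.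
   Context: $K$ a field, $R=K[x]$, $n\ge3$. $\Lambda\subset M_n(K[x,x^{-1}])$ is the $R$-order with $(i,j)$ entry $x^{c_{ij}}R$, $c_{ij}=0$ for $i\le j$ except $c_{1n}=-1$, $c_{ij}=1$ for $i=j+1$, $c_{ij}=2$ for $i\ge j+2$, graded by $\Lambda_m=\Lambda\cap M_n(Kx^m)$. $\mathrm{CM}^{\mathbb Z}(\Lambda)$: graded left $\Lambda$-modules, finitely generated and free over $R$, with degree-preserving morphisms. Grade shift: $X(m)_k=X_{m+k}$. For $1\le i<j\le n$, $(i,j)$ is the graded module $[R^{i}\,(x)^{j-i}\,(x^2)^{n-j}]^t\subset K[x,x^{-1}]^n$ (column vectors, $\deg x=1$); for $k\in\mathbb Z$ put $(i+kn,j+kn):=(i,j)(2k)$ and $(j+kn,i+(k+1)n):=(i,j)(2k+1)$, which defines $(a,b)$ for all integers with $0<b-a<n$. *)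

theory Defs
  imports "Jordan_Normal_Form.Matrix" "Jordan_Normal_Form.DL_Submatrix"
begin

text \<open>Matrix indices are 0-based: index p corresponds to the paper's index p+1.
  cexp n p q is the exponent c_{p+1,q+1}.\<close>

definition cexp :: "nat \<Rightarrow> nat \<Rightarrow> nat \<Rightarrow> int" where
  "cexp n p q = (if p \<le> q then (if p = 0 \<and> q = n - 1 then -1 else 0)
                 else if p = q + 1 then 1 else 2)"

text \<open>Lam n m is the homogeneous component Lambda_m = Lambda \<inter> M_n(K x^m);
  an element A x^m is recorded by its coefficient matrix A \<in> M_n(K).\<close>

definition Lam :: "nat \<Rightarrow> int \<Rightarrow> 'k::field mat set" where
  "Lam n m = {A \<in> carrier_mat n n. \<forall>p<n. \<forall>q<n. A $$ (p,q) \<noteq> 0 \<longrightarrow> cexp n p q \<le> m}"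

text \<open>A graded module X is given by its homogeneous components X_k = K^(gdim X k)
  and, for a \<in> Lambda_m, the matrix gact X m k A of the K-linear map
  X_k \<rightarrow> X_(m+k), v \<mapsto> (A x^m) v.\<close>

record 'k gmod =
  gdim :: "int \<Rightarrow> nat"
  gact :: "int \<Rightarrow> int \<Rightarrow> 'k mat \<Rightarrow> 'k mat"

definition is_gmod :: "nat \<Rightarrow> 'k::field gmod \<Rightarrow> bool" where
  "is_gmod n X \<longleftrightarrow>
     (\<forall>m k A. A \<in> Lam n m \<longrightarrow> gact X m k A \<in> carrier_mat (gdim X (m+k)) (gdim X k)) \<and>
     (\<forall>m k A B. A \<in> Lam n m \<longrightarrow> B \<in> Lam n m \<longrightarrow>
        gact X m k (A + B) = gact X m k A + gact X m k B) \<and>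
     (\<forall>m k A c. A \<in> Lam n m \<longrightarrow> gact X m k (c \<cdot>\<^sub>m A) = c \<cdot>\<^sub>m gact X m k A) \<and>
     (\<forall>m m' k A B. A \<in> Lam n m \<longrightarrow> B \<in> Lam n m' \<longrightarrow>
        gact X (m+m') k (A * B) = gact X m (m'+k) A * gact X m' k B) \<and>
     (\<forall>k. gact X 0 k (1\<^sub>m n) = 1\<^sub>m (gdim X k))"

text \<open>Action of x^p (p \<ge> 0) on X_k: x^p is the element 1_n x^p of Lambda_p.\<close>

definition xpow :: "nat \<Rightarrow> 'k::field gmod \<Rightarrow> int \<Rightarrow> int \<Rightarrow> 'k mat" where
  "xpow n X p k = gact X p k (1\<^sub>m n)"

text \<open>Finitely generated and free over R = K[x] (graded): there is a finite
  homogeneous R-basis b_0,...,b_(r-1), b_l of degree e l, i.e. for every k the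
  elements x^(k - e l) b_l with e l \<le> k form a K-basis of X_k.\<close>

definition is_CM :: "nat \<Rightarrow> 'k::field gmod \<Rightarrow> bool" where
  "is_CM n X \<longleftrightarrow> is_gmod n X \<and>
     (\<exists>(r::nat) (e::nat \<Rightarrow> int) (b::nat \<Rightarrow> 'k vec).
        (\<forall>l<r. b l \<in> carrier_vec (gdim X (e l))) \<and>
        (\<forall>k. let vs = [xpow n X (k - e l) (e l) *\<^sub>v b l. l \<leftarrow> filter (\<lambda>l. e l \<le> k) [0..<r]]
             in length vs = gdim X k \<and> invertible_mat (mat_of_cols (gdim X k) vs)))"

definition is_hom :: "nat \<Rightarrow> 'k::field gmod \<Rightarrow> 'k gmod \<Rightarrow> (int \<Rightarrow> 'k mat) \<Rightarrow> bool" where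
  "is_hom n X Y f \<longleftrightarrow>
     (\<forall>k. f k \<in> carrier_mat (gdim Y k) (gdim X k)) \<and>
     (\<forall>m k A. A \<in> Lam n m \<longrightarrow> f (m+k) * gact X m k A = gact Y m k A * f k)"

definition idm :: "'k::field gmod \<Rightarrow> int \<Rightarrow> 'k mat" where
  "idm X = (\<lambda>k. 1\<^sub>m (gdim X k))"

definition comp :: "(int \<Rightarrow> 'k::field mat) \<Rightarrow> (int \<Rightarrow> 'k mat) \<Rightarrow> int \<Rightarrow> 'k mat" where
  "comp g f = (\<lambda>k. g k * f k)"

definition is_iso :: "nat \<Rightarrow> 'k::field gmod \<Rightarrow> 'k gmod \<Rightarrow> bool" where
  "is_iso n X Y \<longleftrightarrow> (\<exists>f g. is_hom n X Y f \<and> is_hom n Y X g \<and>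
       comp g f = idm X \<and> comp f g = idm Y)"

definition dsum :: "'k::field gmod \<Rightarrow> 'k gmod \<Rightarrow> 'k gmod" where
  "dsum X Y = \<lparr> gdim = (\<lambda>k. gdim X k + gdim Y k),
     gact = (\<lambda>m k A. four_block_mat (gact X m k A) (0\<^sub>m (gdim X (m+k)) (gdim Y k))
                                    (0\<^sub>m (gdim Y (m+k)) (gdim X k)) (gact Y m k A)) \<rparr>"

definition is_zero :: "'k::field gmod \<Rightarrow> bool" where
  "is_zero X \<longleftrightarrow> (\<forall>k. gdim X k = 0)"

definition indec :: "nat \<Rightarrow> 'k::field gmod \<Rightarrow> bool" where
  "indec n X \<longleftrightarrow> is_CM n X \<and> \<not> is_zero X \<and>
     (\<forall>Y Z. is_CM n Y \<longrightarrow> is_CM n Z \<longrightarrow> is_iso n X (dsum Y Z) \<longrightarrow> is_zero Y \<or> is_zero Z)"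

definition shift :: "int \<Rightarrow> 'k::field gmod \<Rightarrow> 'k gmod" where
  "shift m X = \<lparr> gdim = (\<lambda>k. gdim X (m+k)), gact = (\<lambda>p k A. gact X p (m+k) A) \<rparr>"

definition ses :: "nat \<Rightarrow> 'k::field gmod \<Rightarrow> 'k gmod \<Rightarrow> 'k gmod \<Rightarrow>
                   (int \<Rightarrow> 'k mat) \<Rightarrow> (int \<Rightarrow> 'k mat) \<Rightarrow> bool" where
  "ses n X Y Z f g \<longleftrightarrow> is_CM n X \<and> is_CM n Y \<and> is_CM n Z \<and>
     is_hom n X Y f \<and> is_hom n Y Z g \<and>
     (\<forall>k. (\<forall>u \<in> carrier_vec (gdim X k). f k *\<^sub>v u = 0\<^sub>v (gdim Y k) \<longrightarrow> u = 0\<^sub>v (gdim X k)) \<and>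
          (\<forall>w \<in> carrier_vec (gdim Z k). \<exists>v \<in> carrier_vec (gdim Y k). g k *\<^sub>v v = w) \<and>
          (\<forall>v \<in> carrier_vec (gdim Y k). g k *\<^sub>v v = 0\<^sub>v (gdim Z k) \<longleftrightarrow>
               (\<exists>u \<in> carrier_vec (gdim X k). f k *\<^sub>v u = v)))"

definition split_mono :: "nat \<Rightarrow> 'k::field gmod \<Rightarrow> 'k gmod \<Rightarrow> (int \<Rightarrow> 'k mat) \<Rightarrow> bool" where
  "split_mono n X Y f \<longleftrightarrow> (\<exists>r. is_hom n Y X r \<and> comp r f = idm X)"

definition split_epi :: "nat \<Rightarrow> 'k::field gmod \<Rightarrow> 'k gmod \<Rightarrow> (int \<Rightarrow> 'k mat) \<Rightarrow> bool" where
  "split_epi n Y Z g \<longleftrightarrow> (\<exists>s. is_hom n Z Y s \<and> comp g s = idm Z)"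

definition proj :: "nat \<Rightarrow> 'k::field gmod \<Rightarrow> bool" where
  "proj n P \<longleftrightarrow> is_CM n P \<and> (\<forall>X Y f g. ses n X Y P f g \<longrightarrow> split_epi n Y P g)"

definition inj_obj :: "nat \<Rightarrow> 'k::field gmod \<Rightarrow> bool" where
  "inj_obj n I \<longleftrightarrow> is_CM n I \<and> (\<forall>Y Z f g. ses n I Y Z f g \<longrightarrow> split_mono n I Y f)"

definition proj_inj :: "nat \<Rightarrow> 'k::field gmod \<Rightarrow> bool" where
  "proj_inj n X \<longleftrightarrow> proj n X \<and> inj_obj n X"

definition right_almost_split :: "nat \<Rightarrow> 'k::field gmod \<Rightarrow> 'k gmod \<Rightarrow> (int \<Rightarrow> 'k mat) \<Rightarrow> bool" where
  "right_almost_split n Y Z g \<longleftrightarrow> \<not> split_epi n Y Z g \<and>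
     (\<forall>W h. is_CM n W \<longrightarrow> is_hom n W Z h \<longrightarrow> \<not> split_epi n W Z h \<longrightarrow>
        (\<exists>t. is_hom n W Y t \<and> comp g t = h))"

definition left_almost_split :: "nat \<Rightarrow> 'k::field gmod \<Rightarrow> 'k gmod \<Rightarrow> (int \<Rightarrow> 'k mat) \<Rightarrow> bool" where
  "left_almost_split n X Y f \<longleftrightarrow> \<not> split_mono n X Y f \<and>
     (\<forall>W h. is_CM n W \<longrightarrow> is_hom n X W h \<longrightarrow> \<not> split_mono n X W h \<longrightarrow>
        (\<exists>t. is_hom n Y W t \<and> comp t f = h))"

definition almost_split :: "nat \<Rightarrow> 'k::field gmod \<Rightarrow> 'k gmod \<Rightarrow> 'k gmod \<Rightarrow>
                            (int \<Rightarrow> 'k mat) \<Rightarrow> (int \<Rightarrow> 'k mat) \<Rightarrow> bool" where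
  "almost_split n X Y Z f g \<longleftrightarrow> ses n X Y Z f g \<and>
     left_almost_split n X Y f \<and> right_almost_split n Y Z g"

definition msum :: "nat \<Rightarrow> nat \<Rightarrow> 'k::field mat list \<Rightarrow> 'k mat" where
  "msum r c xs = foldr (+) xs (0\<^sub>m r c)"

definition rad :: "nat \<Rightarrow> 'k::field gmod \<Rightarrow> 'k gmod \<Rightarrow> (int \<Rightarrow> 'k mat) set" where
  "rad n X Y = {f. is_hom n X Y f \<and>
     (\<forall>g. is_hom n Y X g \<longrightarrow>
        (\<exists>h. is_hom n X X h \<and>
             comp h (\<lambda>k. 1\<^sub>m (gdim X k) - g k * f k) = idm X \<and>
             comp (\<lambda>k. 1\<^sub>m (gdim X k) - g k * f k) h = idm X))}"

definition rad2 :: "nat \<Rightarrow> 'k::field gmod \<Rightarrow> 'k gmod \<Rightarrow> (int \<Rightarrow> 'k mat) set" where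
  "rad2 n X Y = {f. is_hom n X Y f \<and>
     (\<exists>(r::nat) (W::nat \<Rightarrow> 'k gmod) gs hs.
        (\<forall>l<r. is_CM n (W l) \<and> gs l \<in> rad n X (W l) \<and> hs l \<in> rad n (W l) Y) \<and>
        (\<forall>k. f k = msum (gdim Y k) (gdim X k) [hs l k * gs l k. l \<leftarrow> [0..<r]]))}"

text \<open>The number of arrows X \<rightarrow> Y in the AR quiver is dim_K rad(X,Y)/rad^2(X,Y).\<close>

definition lincomb :: "'k::field gmod \<Rightarrow> 'k gmod \<Rightarrow> nat \<Rightarrow> (nat \<Rightarrow> 'k) \<Rightarrow>
                       (nat \<Rightarrow> int \<Rightarrow> 'k mat) \<Rightarrow> int \<Rightarrow> 'k mat" where
  "lincomb X Y r c fs = (\<lambda>k. msum (gdim Y k) (gdim X k) [c l \<cdot>\<^sub>m fs l k. l \<leftarrow> [0..<r]])"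

definition num_arrows :: "nat \<Rightarrow> 'k::field gmod \<Rightarrow> 'k gmod \<Rightarrow> nat \<Rightarrow> bool" where
  "num_arrows n X Y r \<longleftrightarrow>
     (\<exists>fs. (\<forall>l<r. fs l \<in> rad n X Y) \<and>
        (\<forall>c. lincomb X Y r c fs \<in> rad2 n X Y \<longrightarrow> (\<forall>l<r. c l = 0)) \<and>
        (\<forall>f \<in> rad n X Y. \<exists>c. (\<lambda>k. f k - lincomb X Y r c fs k) \<in> rad2 n X Y))"

text \<open>For 1 \<le> i < j \<le> n: (i,j) = [R^i (x)^(j-i) (x^2)^(n-j)]^t \<subseteq> K[x,x^-1]^n.
  Coordinate q (0-based) lies in x^(lev q) R; the degree-k component is the
  coordinate subspace spanned by the q with lev q \<le> k, and A x^m acts by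
  the corresponding submatrix of A.\<close>

definition lev :: "int \<Rightarrow> int \<Rightarrow> nat \<Rightarrow> int" where
  "lev i j q = (if int q + 1 \<le> i then 0 else if int q + 1 \<le> j then 1 else 2)"

definition basemod :: "nat \<Rightarrow> int \<Rightarrow> int \<Rightarrow> 'k::field gmod" where
  "basemod n i j = \<lparr> gdim = (\<lambda>k. card {q. q < n \<and> lev i j q \<le> k}),
     gact = (\<lambda>m k A. submatrix A {q. q < n \<and> lev i j q \<le> m + k} {q. q < n \<and> lev i j q \<le> k}) \<rparr>"

text \<open>(a,b) for all integers with 0 < b - a < n:
  (i+kn, j+kn) = (i,j)(2k) and (j+kn, i+(k+1)n) = (i,j)(2k+1), 1 \<le> i < j \<le> n.\<close>

definition pmod :: "nat \<Rightarrow> int \<Rightarrow> int \<Rightarrow> 'k::field gmod" where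
  "pmod n a b = (let k = (a - 1) div int n; a0 = a - k * int n in
     if b - k * int n \<le> int n then shift (2 * k) (basemod n a0 (b - k * int n))
     else shift (2 * k + 1) (basemod n (b - (k + 1) * int n) a0))"

end

(* Multiplication by x is injective on a graded Cohen-Macaulay module X, so X is a family of subspaces
   e_q X_k of one finite-dimensional space V, the colimit along x.  Putting (q, 2m) and (q, 2m+1) in
   position q - mn turns it into two decreasing filtrations A (even degrees) and B (odd degrees) of V,
   and the remaining generators of Lambda say A_u <= B_(u+1) and B_u <= A_(u+1-n).  Any two filtrations
   have a common adapted basis, so X is a direct sum of rank-one modules; such a module is given by
   the last positions a, b where A, B are nonzero, and the two inclusions become 0 < b - a < n.
   Since Hom((a,b),(a',b')) is K if a <= a' and b <= b', and 0 otherwise, graded Cohen-Macaulay modules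
   form a category of matrices graded by pairs, exactness is tested position by position, and
   projectivity, extensions, almost split sequences and the radical are read off from matrices. *)

theory Submission
  imports Defs "HOL-Library.Function_Algebras"
begin

subsection \<open>Positions and supports\<close>

text \<open>Two kinds of generator preserve the parity of the degree: E_pq with p \<le> q puts e_q
  X_k inside e_p X_k, and x^2 E_n1 puts e_1 X_k inside e_n X_(k+2). They glue the coordinates into
  one chain per parity, in which two degrees amount to a shift by n; this is the origin of the
  position q - mn. The generators that change parity, x E_(p+1,p) within a block of n positions and
  x^-1 E_1n at its end, give the same two inclusions. So the corner exponent c_1n = -1 makes the
  pattern uniform in u. The number two is essential: three filtrations need not have a common
  adapted basis. The inclusions between A and B are read off afterwards: a basis vector with last
  positions a and b lies in A_a, hence in B_(a+1), so a + 1 \<le> b; in the same way b + 1 - n \<le>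
  a. The obstacle is that the components are separate spaces K^d given by matrices. They are first
  moved into one space, using that every E_1q lies in \<Lambda> in degree 0. The resulting
  coordinates are not canonical, so morphisms are turned into matrices relative to a fixed choice,
  and isomorphism is decided by the list of pairs.\<close>

text \<open>The pair \<^term>\<open>P\<close> stands for the rank-one module \<open>P = (a, b)\<close>; its component at the (0-based)
  coordinate \<^term>\<open>q\<close> and degree \<^term>\<open>k\<close> is nonzero iff the position \<open>q + 1 - n (k div 2)\<close> has not passed
  \<open>a\<close> (\<^term>\<open>k\<close> even) or \<open>b\<close> (\<^term>\<open>k\<close> odd).\<close>

definition in_supp :: "nat \<Rightarrow> int \<times> int \<Rightarrow> nat \<Rightarrow> int \<Rightarrow> bool" where
  "in_supp n P q k \<longleftrightarrow> q < n \<and> int q + 1 - (k div 2) * int n \<le> (if even k then fst P else snd P)"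

definition valid :: "nat \<Rightarrow> int \<times> int \<Rightarrow> bool" where
  "valid n P \<longleftrightarrow> fst P < snd P \<and> snd P - fst P < int n"

definition ple :: "int \<times> int \<Rightarrow> int \<times> int \<Rightarrow> bool" where
  "ple P Q \<longleftrightarrow> fst P \<le> fst Q \<and> snd P \<le> snd Q"

lemma ple_refl [simp]: "ple P P"
  by (simp add: ple_def)

lemma ple_trans: "ple P Q \<Longrightarrow> ple Q R \<Longrightarrow> ple P R"
  by (auto simp: ple_def)

lemma ple_antisym: "ple P Q \<Longrightarrow> ple Q P \<Longrightarrow> P = Q"
  by (auto simp: ple_def prod_eq_iff)

lemma in_supp_mono: "ple P Q \<Longrightarrow> in_supp n P q k \<Longrightarrow> in_supp n Q q k"
  by (auto simp: in_supp_def ple_def)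

lemma cexp_ge: "cexp n p q \<le> m \<Longrightarrow> m \<ge> -1"
  by (auto simp: cexp_def split: if_splits)

lemma cexp_0 [simp]: "cexp n 0 q \<le> 0"
  by (simp add: cexp_def)

lemma cexp_diag: "n \<ge> 2 \<Longrightarrow> cexp n q q = 0"
  by (auto simp: cexp_def)

text \<open>Since E_pq x^c times E_qr x^d is E_pr x^(c+d), this inequality is the closure of
  \<Lambda> under multiplication.\<close>

lemma cexp_tri:
  assumes "n \<ge> 3" "p < n" "q < n" "r < n"
  shows "cexp n p r \<le> cexp n p q + cexp n q r"
  using assms by (auto simp: cexp_def)

text \<open>The action moves positions by a controlled amount. In degree 0 a position does not rise.
  In degrees 1 and -1 the parity changes: from even to odd a position rises by at most one, which a
  + 1 \<le> b absorbs; from odd to even it falls by at least n - 1, and b + 1 \<le> a + n suffices.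
  From degree 2 on, whole blocks are gained.\<close>

lemma in_supp_act:
  assumes "valid n P" "in_supp n P q k" "p < n" "cexp n p q \<le> m"
  shows "in_supp n P p (m + k)"
proof -
  obtain a b where P: "P = (a, b)" by (cases P)
  define t where "t = k div 2"
  define s where "s = (m + k) div 2"
  have q: "q < n" using assms by (simp add: in_supp_def)
  have ab: "a + 1 \<le> b" "b + 1 \<le> a + int n" using assms(1) by (auto simp: valid_def P)
  have m1: "m \<ge> -1" using assms(4) by (rule cexp_ge)
  have sn: "s * int n \<ge> (t + d) * int n" if "s \<ge> t + d" for d
    using that by (intro mult_right_mono) auto
  have e1: "(t + 1) * int n = t * int n + int n"
    and e2: "(t + 2) * int n = t * int n + 2 * int n" and e3: "(t + -1) * int n = t * int n - int n"
    by (auto simp: algebra_simps)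
  have lo: "int q + 1 - t * int n \<le> (if even k then a else b)"
    using assms(2) by (simp add: in_supp_def P t_def split: if_splits)
  have c: "(m = -1 \<and> p = 0 \<and> q = n - 1) \<or> (m = 0 \<and> p \<le> q) \<or> (m = 1 \<and> p \<le> q + 1) \<or> m \<ge> 2"
    using assms(4) m1 by (auto simp: cexp_def split: if_splits)
  have "int p + 1 - s * int n \<le> (if even (m + k) then a else b)"
  proof (cases "even k")
    case True
    then have k: "k = 2 * t" by (simp add: t_def)
    have lo: "int q + 1 - t * int n \<le> a" using lo True by simp
    from c consider (1) "m = -1" "p = 0" "q = n - 1" | (2) "m = 0" "p \<le> q" | (3) "m = 1" "p \<le> q + 1" | (4) "m \<ge> 2" by auto
    then show ?thesis
    proof cases
      case 1
      then have "s = t + -1" "odd (m + k)" using k by (auto simp: s_def)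
      then show ?thesis using 1 lo ab e3 q by simp
    next
      case 2
      then have "s = t" "even (m + k)" using k by (auto simp: s_def)
      then show ?thesis using 2 lo ab q by simp
    next
      case 3
      then have "s = t" "odd (m + k)" using k by (auto simp: s_def)
      then show ?thesis using 3 lo ab q by simp
    next
      case 4
      then have "s \<ge> t + 1" unfolding s_def k by simp
      from sn[OF this] show ?thesis using lo ab e1 assms(3) by auto
    qed
  next
    case False
    then have k: "k = 2 * t + 1" by (simp add: t_def)
    have lo: "int q + 1 - t * int n \<le> b" using lo False by simp
    \<comment> \<open>For odd \<open>k\<close>, m = 2 leads to an odd degree, where a fall by one
      block is enough. From m = 3 on the target may be even, with the smaller bound
      \<open>a\<close>, and a second block is used.\<close>
    from c consider (1) "m = -1" "p = 0" "q = n - 1" | (2) "m = 0" "p \<le> q" | (3) "m = 1" "p \<le> q + 1" | (4) "m = 2" | (5) "m \<ge> 3" by fastforce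
    then show ?thesis
    proof cases
      case 1
      then have "s = t" "even (m + k)" using k by (auto simp: s_def)
      then show ?thesis using 1 lo ab q by simp
    next
      case 2
      then have "s = t" "odd (m + k)" using k by (auto simp: s_def)
      then show ?thesis using 2 lo ab q by simp
    next
      case 3
      then have "s = t + 1" "even (m + k)" using k by (auto simp: s_def)
      then show ?thesis using 3 lo ab e1 q by simp
    next
      case 4
      then have "s = t + 1" "odd (m + k)" using k by (auto simp: s_def)
      then show ?thesis using 4 lo ab e1 assms(3) by simp
    next
      case 5
      then have "s \<ge> t + 2" unfolding s_def k by simp
      from sn[OF this] show ?thesis using lo ab e2 assms(3) by auto
    qed
  qed
  then show ?thesis using assms(3) by (auto simp: in_supp_def P s_def split: if_splits)
qed

lemma position_ex:
  assumes "n > 0"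
  obtains q t where "q < n" "int q + 1 - t * int n = u"
proof
  show "nat ((u - 1) mod int n) < n" using assms by (simp add: nat_less_iff)
  show "int (nat ((u - 1) mod int n)) + 1 - (- ((u - 1) div int n)) * int n = u"
    using assms mult_div_mod_eq[of "int n" "u - 1"] by (simp add: algebra_simps)
qed

text \<open>A single even position tests \<open>fst P\<close> against one integer, a single odd
  position tests \<open>snd P\<close>. Inequalities between pairs are recovered from supports in
  this way throughout.\<close>

lemma even_position:
  assumes "n > 0"
  obtains q k where "q < n" "\<And>P. in_supp n P q k \<longleftrightarrow> u \<le> fst P"
proof -
  obtain q t where "q < n" "int q + 1 - t * int n = u" using position_ex[OF assms] by blast
  then show thesis by (intro that[of q "2 * t"]) (auto simp: in_supp_def)
qed

lemma odd_position:
  assumes "n > 0"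
  obtains q k where "q < n" "\<And>P. in_supp n P q k \<longleftrightarrow> u \<le> snd P"
proof -
  obtain q t where "q < n" "int q + 1 - t * int n = u" using position_ex[OF assms] by blast
  then show thesis by (intro that[of q "2 * t + 1"]) (auto simp: in_supp_def)
qed

lemma ple_iff_in_supp:
  assumes "n > 0"
  shows "ple P Q \<longleftrightarrow> (\<forall>q k. in_supp n P q k \<longrightarrow> in_supp n Q q k)"
proof
  assume r: "\<forall>q k. in_supp n P q k \<longrightarrow> in_supp n Q q k"
  obtain q k where "\<And>Q. in_supp n Q q k \<longleftrightarrow> fst P \<le> fst Q" using even_position[OF assms] by metis
  then have "fst P \<le> fst Q" using r by blast
  moreover
  obtain q k where "\<And>Q. in_supp n Q q k \<longleftrightarrow> snd P \<le> snd Q" using odd_position[OF assms] by metis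
  then have "snd P \<le> snd Q" using r by blast
  ultimately show "ple P Q" by (simp add: ple_def)
qed (blast intro: in_supp_mono)

text \<open>A block consists of two degrees and \<open>n\<close> positions: hence the factor 2, and
  \<open>t\<close> blocks lower a position by at least \<open>t\<close>.\<close>

lemma in_supp_high: "q < n \<Longrightarrow> k \<ge> 2 * (\<bar>fst P\<bar> + \<bar>snd P\<bar> + 1) \<Longrightarrow> in_supp n P q k"
proof -
  assume q: "q < n" and k: "k \<ge> 2 * (\<bar>fst P\<bar> + \<bar>snd P\<bar> + 1)"
  define t where "t = k div 2"
  have t: "t \<ge> \<bar>fst P\<bar> + \<bar>snd P\<bar> + 1" using zdiv_mono1[of "2 * (\<bar>fst P\<bar> + \<bar>snd P\<bar> + 1)" k 2] k unfolding t_def by simp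
  have "t * int n = (t - 1) * int n + int n" by (simp add: algebra_simps)
  moreover have "(t - 1) * int n \<ge> (t - 1) * 1" using q t by (intro mult_left_mono) auto
  ultimately have "int q + 1 - t * int n \<le> - (\<bar>fst P\<bar> + \<bar>snd P\<bar>)" using q t by simp
  then show ?thesis using q by (auto simp: in_supp_def t_def[symmetric])
qed

lemma in_supp_low: "n > 0 \<Longrightarrow> k \<le> - 2 * (\<bar>fst P\<bar> + \<bar>snd P\<bar> + 1) \<Longrightarrow> \<not> in_supp n P q k"
proof -
  assume n: "n > 0" and k: "k \<le> - 2 * (\<bar>fst P\<bar> + \<bar>snd P\<bar> + 1)"
  define t where "t = - (k div 2)"
  have t: "t \<ge> \<bar>fst P\<bar> + \<bar>snd P\<bar> + 1" using zdiv_mono1[of k "2 * - (\<bar>fst P\<bar> + \<bar>snd P\<bar> + 1)" 2] k unfolding t_def by simp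
  have "t * int n \<ge> t * 1" using n t by (intro mult_left_mono) auto
  then have "int q + 1 + t * int n > (\<bar>fst P\<bar> + \<bar>snd P\<bar>)" using t by linarith
  then show ?thesis by (auto simp: in_supp_def t_def)
qed

lemma in_supp_high_list:
  obtains N where "\<And>q k P. P \<in> set L \<Longrightarrow> q < n \<Longrightarrow> k \<ge> N \<Longrightarrow> in_supp n P q k"
proof -
  define F where "F P = 2 * (\<bar>fst P\<bar> + \<bar>snd P\<bar> + 1)" for P :: "int \<times> int"
  have "F P \<le> (\<Sum>P\<in>set L. F P)" if "P \<in> set L" for P
    using that by (intro member_le_sum) (auto simp: F_def)
  then show thesis using in_supp_high that[of "\<Sum>P\<in>set L. F P"] unfolding F_def by (meson order_trans)
qed


abbreviation hcomp :: "'k::field gmod \<Rightarrow> int \<Rightarrow> 'k vec set" where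
  "hcomp X k \<equiv> carrier_vec (gdim X k)"

subsection \<open>Coordinates of a module\<close>

text \<open>\<open>H\<close> is known to be linear only on functions supported below
  \<open>r\<close>; the induction adds one index at a time to a truncation of
  \<open>w\<close>.\<close>

lemma lin_expand:
  fixes H :: "(nat \<Rightarrow> 'k::field) \<Rightarrow> 'k"
  assumes add: "\<And>u v. (\<forall>l. u l \<noteq> 0 \<longrightarrow> l < r) \<Longrightarrow> (\<forall>l. v l \<noteq> 0 \<longrightarrow> l < r) \<Longrightarrow> H (\<lambda>l. u l + v l) = H u + H v"
    and sc: "\<And>c u. (\<forall>l. u l \<noteq> 0 \<longrightarrow> l < r) \<Longrightarrow> H (\<lambda>l. c * u l) = c * H u"
    and w: "\<forall>l. w l \<noteq> 0 \<longrightarrow> l < r"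
  shows "H w = (\<Sum>l<r. w l * H (\<lambda>l'. if l' = l then 1 else 0))"
proof -
  have "H (\<lambda>l. if l < s then w l else 0) = (\<Sum>l<s. w l * H (\<lambda>l'. if l' = l then 1 else 0))" if "s \<le> r" for s
    using that
  proof (induction s)
    case 0
    show ?case using sc[of "\<lambda>_. 0" 0] by simp
  next
    case (Suc s)
    have e: "(\<lambda>l. if l < Suc s then w l else 0) =
        (\<lambda>l. (if l < s then w l else 0) + (\<lambda>l. w s * (if l = s then 1 else 0)) l)"
      by (auto simp: fun_eq_iff less_Suc_eq)
    have "H (\<lambda>l. if l < Suc s then w l else 0) = H (\<lambda>l. if l < s then w l else 0) + w s * H (\<lambda>l. if l = s then 1 else 0)"
      using Suc.prems unfolding e by (subst add, simp, simp, subst sc, auto)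
    then show ?case using Suc by simp
  qed
  from this[of r] have "H (\<lambda>l. if l < r then w l else 0) = (\<Sum>l<r. w l * H (\<lambda>l'. if l' = l then 1 else 0))" by simp
  moreover have "(\<lambda>l. if l < r then w l else 0) = w" using w by (auto simp: fun_eq_iff)
  ultimately show ?thesis by simp
qed

lemma mat_of_linear:
  fixes h :: "'k::field vec \<Rightarrow> 'k vec"
  assumes h: "\<And>v. v \<in> carrier_vec a \<Longrightarrow> h v \<in> carrier_vec b"
    and add: "\<And>u v. u \<in> carrier_vec a \<Longrightarrow> v \<in> carrier_vec a \<Longrightarrow> h (u + v) = h u + h v"
    and sc: "\<And>c u. u \<in> carrier_vec a \<Longrightarrow> h (c \<cdot>\<^sub>v u) = c \<cdot>\<^sub>v h u"
    and v: "v \<in> carrier_vec a"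
  shows "mat b a (\<lambda>(i,j). h (unit_vec a j) $ i) *\<^sub>v v = h v"
proof (rule eq_vecI)
  fix i assume i: "i < dim_vec (h v)"
  have ib: "i < b" using i h[OF v] by simp
  define w where "w = (\<lambda>l. if l < a then v $ l else 0)"
  have vw: "vec a w = v" using v by (auto simp: w_def)
  have u: "vec a (\<lambda>l'. if l' = l then 1 else 0) = (unit_vec a l :: 'k vec)" if "l < a" for l
    using that by (auto simp: unit_vec_def)
  have hi: "dim_vec (h (vec a u)) = b" for u using h[of "vec a u"] by simp
  have "h (vec a w) $ i = (\<Sum>l<a. w l * (h (vec a (\<lambda>l'. if l' = l then 1 else 0)) $ i))"
  proof (rule lin_expand[where r=a and H="\<lambda>w. h (vec a w) $ i"])
    fix u v :: "nat \<Rightarrow> 'k"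
    have "vec a (\<lambda>l. u l + v l) = vec a u + vec a v" by auto
    then show "h (vec a (\<lambda>l. u l + v l)) $ i = h (vec a u) $ i + h (vec a v) $ i"
      using add[of "vec a u" "vec a v"] hi ib by simp
  next
    fix c and u :: "nat \<Rightarrow> 'k"
    have "vec a (\<lambda>l. c * u l) = c \<cdot>\<^sub>v vec a u" by auto
    then show "h (vec a (\<lambda>l. c * u l)) $ i = c * h (vec a u) $ i"
      using sc[of "vec a u" c] hi ib by simp
  qed (simp add: w_def)
  also have "\<dots> = (\<Sum>l<a. h (unit_vec a l) $ i * v $ l)"
    by (rule sum.cong) (auto simp: u w_def)
  also have "\<dots> = (mat b a (\<lambda>(i,j). h (unit_vec a j) $ i) *\<^sub>v v) $ i"
    using ib v by (auto simp: scalar_prod_def atLeast0LessThan intro!: sum.cong)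
  finally show "(mat b a (\<lambda>(i,j). h (unit_vec a j) $ i) *\<^sub>v v) $ i = h v $ i" by (simp add: vw)
next
  show "dim_vec (mat b a (\<lambda>(i,j). h (unit_vec a j) $ i) *\<^sub>v v) = dim_vec (h v)" using h[OF v] by simp
qed

lemma mat_eq_on_vec:
  fixes A B :: "'k::field mat"
  assumes A: "A \<in> carrier_mat b a" and B: "B \<in> carrier_mat b a"
    and eq: "\<And>v. v \<in> carrier_vec a \<Longrightarrow> A *\<^sub>v v = B *\<^sub>v v"
  shows "A = B"
proof (rule eq_matI)
  fix i j assume "i < dim_row B" "j < dim_col B"
  then have ij: "i < b" "j < a" using B by auto
  have "(A *\<^sub>v unit_vec a j) $ i = (B *\<^sub>v unit_vec a j) $ i" using eq[of "unit_vec a j"] by simp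
  then show "A $$ (i,j) = B $$ (i,j)" using A B ij by simp
qed (use A B in auto)

lemma mult_mat_vec_diff:
  fixes A B :: "'k::field mat"
  assumes "A \<in> carrier_mat b a" "B \<in> carrier_mat b a" "v \<in> carrier_vec a"
  shows "(A - B) *\<^sub>v v + B *\<^sub>v v = A *\<^sub>v v"
  using assms by (simp add: minus_mult_distrib_mat_vec) (intro eq_vecI, auto)

section \<open>Matrix units and products in \<Lambda>\<close>

definition Emat :: "nat \<Rightarrow> nat \<Rightarrow> nat \<Rightarrow> 'k::field mat" where
  "Emat n p q = mat n n (\<lambda>(i,j). if i = p \<and> j = q then 1 else 0)"

lemma Emat_Lam: "cexp n p q \<le> m \<Longrightarrow> Emat n p q \<in> Lam n m"
  by (auto simp: Lam_def Emat_def)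

lemma Lam_carrier: "A \<in> Lam n m \<Longrightarrow> A \<in> carrier_mat n n"
  by (simp add: Lam_def)

lemma Lam_one: "n \<ge> 3 \<Longrightarrow> m \<ge> 0 \<Longrightarrow> 1\<^sub>m n \<in> Lam n m"
  by (auto simp: Lam_def cexp_def)

lemma Lam_add: "A \<in> Lam n m \<Longrightarrow> B \<in> Lam n m \<Longrightarrow> A + B \<in> Lam n m"
  by (auto simp: Lam_def) (metis add_0)

lemma Lam_smult: "A \<in> Lam n m \<Longrightarrow> c \<cdot>\<^sub>m A \<in> Lam n m"
  by (auto simp: Lam_def)

lemma Lam_mult:
  assumes "n \<ge> 3" "A \<in> Lam n m" "B \<in> Lam n m'"
  shows "A * B \<in> Lam n (m + m')"
proof -
  have "cexp n p q \<le> m + m'" if pq: "p < n" "q < n" and ne: "(A * B) $$ (p,q) \<noteq> 0" for p q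
  proof -
    have "(A * B) $$ (p,q) = (\<Sum>r<n. A $$ (p,r) * B $$ (r,q))"
      using Lam_carrier[OF assms(2)] Lam_carrier[OF assms(3)] pq
      by (auto simp: scalar_prod_def atLeast0LessThan intro!: sum.cong)
    then obtain r where "r < n" "A $$ (p,r) * B $$ (r,q) \<noteq> 0"
      using ne by (metis (no_types, lifting) lessThan_iff sum.neutral)
    then have "cexp n p r \<le> m" "cexp n r q \<le> m'"
      using assms that by (auto simp: Lam_def)
    then show ?thesis using assms(1) that \<open>r < n\<close> cexp_tri[of n p r q] by linarith
  qed
  then show ?thesis using assms by (auto simp: Lam_def)
qed

text \<open>A module of type \<^term>\<open>L\<close> is identified degreewise with the functions \<^term>\<open>w q l\<close>
  (\<^term>\<open>q\<close> a coordinate of \<open>K[x,x\<^sup>-\<^sup>1]\<^sup>n\<close>, \<^term>\<open>l\<close> a summand) supported on the rank-one modules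
  listed in \<^term>\<open>L\<close>.\<close>

definition Vq :: "nat \<Rightarrow> (int \<times> int) list \<Rightarrow> nat \<Rightarrow> int \<Rightarrow> (nat \<Rightarrow> 'k::field) set" where
  "Vq n L q k = {w. \<forall>l. w l \<noteq> 0 \<longrightarrow> l < length L \<and> in_supp n (L ! l) q k}"

definition Cs :: "nat \<Rightarrow> (int \<times> int) list \<Rightarrow> int \<Rightarrow> (nat \<Rightarrow> nat \<Rightarrow> 'k::field) set" where
  "Cs n L k = {w. \<forall>q. w q \<in> Vq n L q k}"

definition act :: "nat \<Rightarrow> 'k::field mat \<Rightarrow> (nat \<Rightarrow> nat \<Rightarrow> 'k) \<Rightarrow> nat \<Rightarrow> nat \<Rightarrow> 'k" where
  "act n A w = (\<lambda>p l. if p < n then \<Sum>q<n. A $$ (p,q) * w q l else 0)"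

text \<open>\<open>\<Phi>\<close> is an isomorphism of \<open>X\<close> with the direct sum of the
  rank-one modules listed in \<open>L\<close>. Module laws for \<open>gact\<close> are not among the
  conditions: they follow from those of \<open>act\<close>, so constructing \<open>\<Phi>\<close>
  also shows that \<open>X\<close> is a module.\<close>

definition coord :: "nat \<Rightarrow> 'k::field gmod \<Rightarrow> (int \<times> int) list \<Rightarrow> (int \<Rightarrow> 'k vec \<Rightarrow> nat \<Rightarrow> nat \<Rightarrow> 'k) \<Rightarrow> bool" where
  "coord n X L \<Phi> \<longleftrightarrow> (\<forall>P\<in>set L. valid n P) \<and>
    (\<forall>k. bij_betw (\<Phi> k) (hcomp X k) (Cs n L k)) \<and>
    (\<forall>k. \<forall>u\<in>hcomp X k. \<forall>v\<in>hcomp X k. \<forall>q l. \<Phi> k (u + v) q l = \<Phi> k u q l + \<Phi> k v q l) \<and>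
    (\<forall>k. \<forall>u\<in>hcomp X k. \<forall>c q l. \<Phi> k (c \<cdot>\<^sub>v u) q l = c * \<Phi> k u q l) \<and>
    (\<forall>m k. \<forall>A\<in>Lam n m. gact X m k A \<in> carrier_mat (gdim X (m + k)) (gdim X k)) \<and>
    (\<forall>m k. \<forall>A\<in>Lam n m. \<forall>u\<in>hcomp X k. \<Phi> (m + k) (gact X m k A *\<^sub>v u) = act n A (\<Phi> k u))"

lemma coordD:
  assumes "coord n X L \<Phi>"
  shows coord_valid: "P \<in> set L \<Longrightarrow> valid n P"
    and coord_add: "u \<in> hcomp X k \<Longrightarrow> v \<in> hcomp X k \<Longrightarrow> \<Phi> k (u + v) q l = \<Phi> k u q l + \<Phi> k v q l"
    and coord_smult: "u \<in> hcomp X k \<Longrightarrow> \<Phi> k (c \<cdot>\<^sub>v u) q l = c * \<Phi> k u q l"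
    and coord_gact: "A \<in> Lam n m \<Longrightarrow> gact X m k A \<in> carrier_mat (gdim X (m + k)) (gdim X k)"
    and coord_act: "A \<in> Lam n m \<Longrightarrow> u \<in> hcomp X k \<Longrightarrow> \<Phi> (m + k) (gact X m k A *\<^sub>v u) = act n A (\<Phi> k u)"
    and coord_in: "u \<in> hcomp X k \<Longrightarrow> \<Phi> k u \<in> Cs n L k"
    and coord_inj: "u \<in> hcomp X k \<Longrightarrow> v \<in> hcomp X k \<Longrightarrow> \<Phi> k u = \<Phi> k v \<longleftrightarrow> u = v"
    and coord_surj: "w \<in> Cs n L k \<Longrightarrow> \<exists>u\<in>hcomp X k. \<Phi> k u = w"
proof -
  have b: "bij_betw (\<Phi> k) (hcomp X k) (Cs n L k)" for k using assms by (simp add: coord_def)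
  show "u \<in> hcomp X k \<Longrightarrow> \<Phi> k u \<in> Cs n L k"
    "u \<in> hcomp X k \<Longrightarrow> v \<in> hcomp X k \<Longrightarrow> \<Phi> k u = \<Phi> k v \<longleftrightarrow> u = v"
    using b[of k] by (auto simp: bij_betw_def inj_on_def)
  show "w \<in> Cs n L k \<Longrightarrow> \<exists>u\<in>hcomp X k. \<Phi> k u = w"
    using bij_betw_imp_surj_on[OF b[of k]] by (metis imageE)
qed (use assms in \<open>auto simp: coord_def\<close>)

lemma coord_zero:
  assumes "coord n X L \<Phi>" shows "\<Phi> k (0\<^sub>v (gdim X k)) = (\<lambda>_ _. 0)"
proof -
  have "\<Phi> k (0 \<cdot>\<^sub>v 0\<^sub>v (gdim X k)) q l = 0" for q l using coord_smult[OF assms, of "0\<^sub>v (gdim X k)" k 0 q l] by simp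
  moreover have "0 \<cdot>\<^sub>v 0\<^sub>v (gdim X k) = (0\<^sub>v (gdim X k) :: 'a vec)" by auto
  ultimately show ?thesis by (auto simp: fun_eq_iff)
qed

lemma coord_eq0:
  assumes "coord n X L \<Phi>" "u \<in> hcomp X k"
  shows "\<Phi> k u = (\<lambda>_ _. 0) \<longleftrightarrow> u = 0\<^sub>v (gdim X k)"
  using coord_inj[OF assms, of "0\<^sub>v (gdim X k)"] coord_zero[OF assms(1)] by simp

lemma act_add: "A \<in> carrier_mat n n \<Longrightarrow> B \<in> carrier_mat n n \<Longrightarrow> act n (A + B) w = (\<lambda>p l. act n A w p l + act n B w p l)"
  by (intro ext) (auto simp: act_def algebra_simps sum.distrib intro!: sum.cong)

lemma act_smult: "A \<in> carrier_mat n n \<Longrightarrow> act n (c \<cdot>\<^sub>m A) w = (\<lambda>p l. c * act n A w p l)"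
  by (intro ext) (auto simp: act_def algebra_simps sum_distrib_left intro!: sum.cong)

lemma act_mult: "A \<in> carrier_mat n n \<Longrightarrow> B \<in> carrier_mat n n \<Longrightarrow> act n (A * B) w = act n A (act n B w)"
proof (intro ext)
  fix p l assume A: "A \<in> carrier_mat n n" and B: "B \<in> carrier_mat n n"
  have "(\<Sum>q<n. (A * B) $$ (p, q) * w q l) = (\<Sum>q<n. A $$ (p, q) * (\<Sum>r<n. B $$ (q, r) * w r l))" if "p < n"
  proof -
    have "(\<Sum>q<n. (A * B) $$ (p, q) * w q l) = (\<Sum>q<n. \<Sum>r<n. A $$ (p, r) * B $$ (r, q) * w q l)"
      using A B that by (auto simp: scalar_prod_def atLeast0LessThan sum_distrib_right intro!: sum.cong)
    also have "\<dots> = (\<Sum>r<n. \<Sum>q<n. A $$ (p, r) * B $$ (r, q) * w q l)" by (rule sum.swap)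
    finally show ?thesis by (simp add: sum_distrib_left mult.assoc)
  qed
  then show "act n (A * B) w p l = act n A (act n B w) p l" by (auto simp: act_def intro!: sum.cong)
qed

lemma act_one: "\<forall>q\<ge>n. \<forall>l. w q l = 0 \<Longrightarrow> act n (1\<^sub>m n) w = w"
  by (intro ext) (auto simp: act_def if_distrib[of "\<lambda>x. x * _"] cong: if_cong)

lemma act_Emat: "p < n \<Longrightarrow> q < n \<Longrightarrow> act n (Emat n p q) w = (\<lambda>i l. if i = p then w q l else 0)"
  by (intro ext) (auto simp: act_def Emat_def if_distrib[of "\<lambda>x. x * _"] cong: if_cong)

lemma Cs_outside: "w \<in> Cs n L k \<Longrightarrow> q \<ge> n \<Longrightarrow> w q l = 0"
  by (auto simp: Cs_def Vq_def in_supp_def) (metis linorder_not_less)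

lemma Cs_outside2: "w \<in> Cs n L k \<Longrightarrow> l \<ge> length L \<Longrightarrow> w q l = 0"
  by (auto simp: Cs_def Vq_def in_supp_def) (metis linorder_not_less)

lemma Cs_single: "w \<in> Vq n L q k \<Longrightarrow> (\<lambda>q'. if q' = q then w else (\<lambda>_. 0)) \<in> Cs n L k"
  by (auto simp: Cs_def Vq_def)

lemma coord_add_fun:
  assumes "coord n X L \<Phi>" "u \<in> hcomp X k" "v \<in> hcomp X k"
  shows "\<Phi> k (u + v) = (\<lambda>q l. \<Phi> k u q l + \<Phi> k v q l)"
  using coord_add[OF assms] by (intro ext)

lemma coord_smult_fun:
  assumes "coord n X L \<Phi>" "u \<in> hcomp X k"
  shows "\<Phi> k (c \<cdot>\<^sub>v u) = (\<lambda>q l. c * \<Phi> k u q l)"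
  using coord_smult[OF assms] by (intro ext)

text \<open>Transport of structure: \<open>\<Phi>\<close> is injective, so each law for
  \<open>gact\<close> follows from the same law for \<open>act\<close>.\<close>

lemma coord_is_gmod:
  fixes X :: "'k::field gmod"
  assumes n: "n \<ge> 3" and c: "coord n X L \<Phi>"
  shows "is_gmod n X"
proof -
  note gact_carrier = coord_gact[OF c] and inj = coord_inj[OF c] and ac = coord_act[OF c]
  have 1: "gact X m k (A + B) = gact X m k A + gact X m k B" if A: "A \<in> Lam n m" and B: "B \<in> Lam n m" for m k A B
  proof (rule mat_eq_on_vec)
    note gA = gact_carrier[OF A, of k] and gB = gact_carrier[OF B, of k] and gAB = gact_carrier[OF Lam_add[OF A B], of k]
    show "gact X m k (A + B) \<in> carrier_mat (gdim X (m + k)) (gdim X k)"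
      "gact X m k A + gact X m k B \<in> carrier_mat (gdim X (m + k)) (gdim X k)" using gA gB gAB by auto
    fix v :: "'k vec" assume v: "v \<in> hcomp X k"
    have "\<Phi> (m + k) (gact X m k (A + B) *\<^sub>v v) = \<Phi> (m + k) (gact X m k A *\<^sub>v v + gact X m k B *\<^sub>v v)"
      using gA gB v by (subst coord_add_fun[OF c]) (auto simp: ac[OF A v] ac[OF B v] ac[OF Lam_add[OF A B] v] act_add Lam_carrier[OF A] Lam_carrier[OF B])
    then show "gact X m k (A + B) *\<^sub>v v = (gact X m k A + gact X m k B) *\<^sub>v v"
      using gA gB gAB v by (subst (asm) inj) (auto simp: add_mult_distrib_mat_vec)
  qed
  have 2: "gact X m k (a \<cdot>\<^sub>m A) = a \<cdot>\<^sub>m gact X m k A" if A: "A \<in> Lam n m" for m k A a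
  proof (rule mat_eq_on_vec)
    note gA = gact_carrier[OF A, of k] and gAB = gact_carrier[OF Lam_smult[OF A, of a], of k]
    show "gact X m k (a \<cdot>\<^sub>m A) \<in> carrier_mat (gdim X (m + k)) (gdim X k)"
      "a \<cdot>\<^sub>m gact X m k A \<in> carrier_mat (gdim X (m + k)) (gdim X k)" using gA gAB by auto
    fix v :: "'k vec" assume v: "v \<in> hcomp X k"
    have "\<Phi> (m + k) (gact X m k (a \<cdot>\<^sub>m A) *\<^sub>v v) = \<Phi> (m + k) (a \<cdot>\<^sub>v (gact X m k A *\<^sub>v v))"
      using gA v by (subst coord_smult_fun[OF c]) (auto simp: ac[OF A v] ac[OF Lam_smult[OF A] v] act_smult Lam_carrier[OF A])
    then have "gact X m k (a \<cdot>\<^sub>m A) *\<^sub>v v = a \<cdot>\<^sub>v (gact X m k A *\<^sub>v v)"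
      using gA gAB v by (subst (asm) inj) auto
    also have "\<dots> = (a \<cdot>\<^sub>m gact X m k A) *\<^sub>v v" using gA v by (intro eq_vecI) auto
    finally show "gact X m k (a \<cdot>\<^sub>m A) *\<^sub>v v = (a \<cdot>\<^sub>m gact X m k A) *\<^sub>v v" .
  qed
  have 3: "gact X (m + m') k (A * B) = gact X m (m' + k) A * gact X m' k B" if A: "A \<in> Lam n m" and B: "B \<in> Lam n m'" for m m' k A B
  proof (rule mat_eq_on_vec)
    note gA = gact_carrier[OF A, of "m' + k"] and gB = gact_carrier[OF B, of k] and gAB = gact_carrier[OF Lam_mult[OF n A B], of k]
    show "gact X (m + m') k (A * B) \<in> carrier_mat (gdim X (m + (m' + k))) (gdim X k)"
      "gact X m (m' + k) A * gact X m' k B \<in> carrier_mat (gdim X (m + (m' + k))) (gdim X k)" using gA gB gAB by (auto simp: add.assoc)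
    fix v :: "'k vec" assume v: "v \<in> hcomp X k"
    have Bv: "gact X m' k B *\<^sub>v v \<in> hcomp X (m' + k)" using gB v by auto
    have "\<Phi> (m + (m' + k)) (gact X (m + m') k (A * B) *\<^sub>v v) = \<Phi> (m + (m' + k)) (gact X m (m' + k) A *\<^sub>v (gact X m' k B *\<^sub>v v))"
      using ac[OF Lam_mult[OF n A B] v] by (simp add: ac[OF A Bv] ac[OF B v] act_mult[OF Lam_carrier[OF A] Lam_carrier[OF B]] add.assoc)
    then have "gact X (m + m') k (A * B) *\<^sub>v v = gact X m (m' + k) A *\<^sub>v (gact X m' k B *\<^sub>v v)"
      using gA gAB Bv v by (subst (asm) inj) (auto simp: add.assoc)
    then show "gact X (m + m') k (A * B) *\<^sub>v v = (gact X m (m' + k) A * gact X m' k B) *\<^sub>v v"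
      using gA gB v by (simp add: assoc_mult_mat_vec)
  qed
  have 4: "gact X 0 k (1\<^sub>m n) = 1\<^sub>m (gdim X k)" for k
  proof (rule mat_eq_on_vec)
    have o: "(1\<^sub>m n :: 'k mat) \<in> Lam n 0" using Lam_one n by blast
    show "gact X 0 k (1\<^sub>m n) \<in> carrier_mat (gdim X k) (gdim X k)" using gact_carrier[OF o, of k] by simp
    fix v :: "'k vec" assume v: "v \<in> hcomp X k"
    have "\<Phi> k (gact X 0 k (1\<^sub>m n) *\<^sub>v v) = \<Phi> k v"
      using ac[OF o v] Cs_outside[OF coord_in[OF c v]] by (simp add: act_one)
    then show "gact X 0 k (1\<^sub>m n) *\<^sub>v v = 1\<^sub>m (gdim X k) *\<^sub>v v"
      using gact_carrier[OF o, of k] v by (subst (asm) inj) auto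
  qed auto
  show ?thesis unfolding is_gmod_def using gact_carrier 1 2 3 4 by blast
qed


subsection \<open>Homomorphisms as graded matrices\<close>

definition types :: "nat \<Rightarrow> 'k::field gmod \<Rightarrow> (int \<times> int) list \<Rightarrow> bool" where
  "types n X L \<longleftrightarrow> (\<exists>\<Phi>. coord n X L \<Phi>)"

text \<open>One coordinate system is fixed for every module and list, so that the matrices of
  composable morphisms refer to the same coordinates on the middle module.\<close>

definition coords :: "nat \<Rightarrow> 'k::field gmod \<Rightarrow> (int \<times> int) list \<Rightarrow> int \<Rightarrow> 'k vec \<Rightarrow> nat \<Rightarrow> nat \<Rightarrow> 'k" where
  "coords n X L = (SOME \<Phi>. coord n X L \<Phi>)"

lemma types_coord: "types n X L \<Longrightarrow> coord n X L (coords n X L)"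
  unfolding types_def coords_def by (metis someI_ex)

definition mapp :: "nat \<Rightarrow> nat \<Rightarrow> (nat \<Rightarrow> nat \<Rightarrow> 'k::field) \<Rightarrow> (nat \<Rightarrow> 'k) \<Rightarrow> nat \<Rightarrow> 'k" where
  "mapp r' r C w = (\<lambda>i. if i < r' then \<Sum>l<r. C i l * w l else 0)"

text \<open>Matrices are total functions whose entries outside the index ranges are arbitrary;
  equality of matrices is therefore always asserted entry by entry within range.\<close>

definition mprod :: "nat \<Rightarrow> (nat \<Rightarrow> nat \<Rightarrow> 'k::field) \<Rightarrow> (nat \<Rightarrow> nat \<Rightarrow> 'k) \<Rightarrow> nat \<Rightarrow> nat \<Rightarrow> 'k" where
  "mprod r D C = (\<lambda>i j. \<Sum>l<r. D i l * C l j)"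

definition idc :: "nat \<Rightarrow> nat \<Rightarrow> 'k::field" where
  "idc i j = (if i = j then 1 else 0)"

definition graded :: "(int \<times> int) list \<Rightarrow> (int \<times> int) list \<Rightarrow> (nat \<Rightarrow> nat \<Rightarrow> 'k::field) \<Rightarrow> bool" where
  "graded L L' C \<longleftrightarrow> (\<forall>i<length L'. \<forall>j<length L. C i j \<noteq> 0 \<longrightarrow> ple (L ! j) (L' ! i))"

definition hrep :: "nat \<Rightarrow> 'k::field gmod \<Rightarrow> (int \<times> int) list \<Rightarrow> 'k gmod \<Rightarrow> (int \<times> int) list \<Rightarrow>
    (int \<Rightarrow> 'k mat) \<Rightarrow> (nat \<Rightarrow> nat \<Rightarrow> 'k) \<Rightarrow> bool" where
  "hrep n X L Y L' f C \<longleftrightarrow> types n X L \<and> types n Y L' \<and> is_hom n X Y f \<and> graded L L' C \<and>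
    (\<forall>k. \<forall>v\<in>hcomp X k. \<forall>q. coords n Y L' k (f k *\<^sub>v v) q = mapp (length L') (length L) C (coords n X L k v q))"

lemma mapp_cong: "(\<And>i j. i < r' \<Longrightarrow> j < r \<Longrightarrow> C i j = C' i j) \<Longrightarrow> mapp r' r C w = mapp r' r C' w"
  by (intro ext) (auto simp: mapp_def intro!: sum.cong)

lemma mapp_mm: "mapp r'' r' D (mapp r' r C w) = mapp r'' r (mprod r' D C) w"
proof (intro ext)
  fix i
  have "(\<Sum>l<r'. D i l * (\<Sum>j<r. C l j * w j)) = (\<Sum>l<r'. \<Sum>j<r. D i l * C l j * w j)"
    by (simp add: sum_distrib_left mult.assoc)
  also have "\<dots> = (\<Sum>j<r. \<Sum>l<r'. D i l * C l j * w j)" by (rule sum.swap)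
  finally show "mapp r'' r' D (mapp r' r C w) i = mapp r'' r (mprod r' D C) w i"
    by (simp add: mapp_def mprod_def sum_distrib_right)
qed

lemma mapp_idc: "(\<forall>l. w l \<noteq> 0 \<longrightarrow> l < r) \<Longrightarrow> mapp r r idc w = w"
  by (intro ext) (auto simp: mapp_def idc_def if_distrib[of "\<lambda>x. x * _"] cong: if_cong)

lemma mapp_unit: "j < r \<Longrightarrow> mapp r' r C (\<lambda>l. if l = j then 1 else 0) = (\<lambda>i. if i < r' then C i j else 0)"
  by (intro ext) (auto simp: mapp_def if_distrib[of "\<lambda>x. _ * x"] cong: if_cong)

lemma mapp_add: "mapp r' r C (\<lambda>l. u l + v l) = (\<lambda>i. mapp r' r C u i + mapp r' r C v i)"
  by (intro ext) (auto simp: mapp_def algebra_simps sum.distrib)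

lemma mapp_smult: "mapp r' r C (\<lambda>l. c * u l) = (\<lambda>i. c * mapp r' r C u i)"
  by (intro ext) (auto simp: mapp_def algebra_simps sum_distrib_left)

lemma mapp_0 [simp]: "mapp r' r C (\<lambda>l. 0) = (\<lambda>i. 0)"
  by (intro ext) (auto simp: mapp_def)

lemma graded_mapp:
  assumes "graded L L' C" "w \<in> Vq n L q k"
  shows "mapp (length L') (length L) C w \<in> Vq n L' q k"
  unfolding Vq_def
proof (safe)
  fix i assume nz: "mapp (length L') (length L) C w i \<noteq> 0"
  then show i: "i < length L'" by (auto simp: mapp_def split: if_splits)
  from nz i have "(\<Sum>l<length L. C i l * w l) \<noteq> 0" by (simp add: mapp_def)
  then obtain j where j: "j \<in> {..<length L}" "C i j * w j \<noteq> 0"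
    by (rule sum.not_neutral_contains_not_neutral)
  then have "ple (L ! j) (L' ! i)" "in_supp n (L ! j) q k" using assms i by (auto simp: graded_def Vq_def)
  then show "in_supp n (L' ! i) q k" by (rule in_supp_mono)
qed

lemma graded_mm:
  assumes "graded L L' C" "graded L' L'' D" shows "graded L L'' (mprod (length L') D C)"
  unfolding graded_def
proof (intro allI impI)
  fix i j assume ij: "i < length L''" "j < length L" "mprod (length L') D C i j \<noteq> 0"
  from ij(3) have "(\<Sum>l<length L'. D i l * C l j) \<noteq> 0" by (simp add: mprod_def)
  then obtain l where "l \<in> {..<length L'}" "D i l * C l j \<noteq> 0"
    by (rule sum.not_neutral_contains_not_neutral)
  then have "ple (L ! j) (L' ! l)" "ple (L' ! l) (L'' ! i)" using assms ij by (auto simp: graded_def)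
  then show "ple (L ! j) (L'' ! i)" by (rule ple_trans)
qed

lemma graded_idc: "graded L L idc"
  by (auto simp: graded_def idc_def)

text \<open>The matrix entries do not depend on the position because \<open>E\<^sub>0\<^sub>q x\<^sup>M\<close> moves every
  position to coordinate 0 in a high degree, where all summands are supported.\<close>

lemma hom_matrix:
  fixes X Y :: "'k::field gmod"
  assumes n: "n \<ge> 3" and c: "types n X L" and d: "types n Y L'" and f: "is_hom n X Y f"
  shows "\<exists>C. hrep n X L Y L' f C"
proof -
  define \<Phi> where "\<Phi> = coords n X L"
  define \<Psi> where "\<Psi> = coords n Y L'"
  have c': "coord n X L \<Phi>" and d': "coord n Y L' \<Psi>" using c d types_coord by (auto simp: \<Phi>_def \<Psi>_def)
  have fc: "f k \<in> carrier_mat (gdim Y k) (gdim X k)" for k using f by (simp add: is_hom_def)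
  have fv: "f k *\<^sub>v v \<in> hcomp Y k" if "v \<in> hcomp X k" for k v using fc[of k] that by simp
  define ci where "ci k w = (SOME u. u \<in> hcomp X k \<and> \<Phi> k u = w)" for k w
  have ci: "ci k w \<in> hcomp X k \<and> \<Phi> k (ci k w) = w" if "w \<in> Cs n L k" for k w
    unfolding ci_def by (rule someI_ex) (use coord_surj[OF c' that] in blast)
  have ci_eq: "ci k (\<Phi> k v) = v" if "v \<in> hcomp X k" for k v
    using ci[OF coord_in[OF c' that]] coord_inj[OF c'] that by blast
  have gv: "gact X m k A *\<^sub>v v \<in> hcomp X (m + k)" if "A \<in> Lam n m" "v \<in> hcomp X k" for m k A v
    using coord_gact[OF c' that(1), of k] that by simp
  have equi: "\<Psi> (m + k) (f (m + k) *\<^sub>v (gact X m k A *\<^sub>v v)) = act n A (\<Psi> k (f k *\<^sub>v v))"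
    if A: "A \<in> Lam n m" and v: "v \<in> hcomp X k" for m k A v
  proof -
    have "f (m + k) *\<^sub>v (gact X m k A *\<^sub>v v) = (f (m + k) * gact X m k A) *\<^sub>v v"
      using assoc_mult_mat_vec[OF fc coord_gact[OF c' A] v] by simp
    also have "\<dots> = gact Y m k A *\<^sub>v (f k *\<^sub>v v)"
      using assoc_mult_mat_vec[OF coord_gact[OF d' A] fc v] f A by (simp add: is_hom_def)
    finally show ?thesis using coord_act[OF d' A fv[OF v]] by simp
  qed
  obtain N where N: "\<And>q k P. P \<in> set L \<Longrightarrow> q < n \<Longrightarrow> k \<ge> N \<Longrightarrow> in_supp n P q k" using in_supp_high_list by blast
  \<comment> \<open>From degree \<open>N\<close> on every summand is supported at coordinate 0, so
    there all functions on the index set of \<open>L\<close> occur and \<open>lin_expand\<close>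
    applies.\<close>
  define em where "em w = (\<lambda>(q::nat) l::nat. if q = 0 then w l else (0::'k))" for w
  have em_in: "em w \<in> Cs n L k" if "\<forall>l. w l \<noteq> 0 \<longrightarrow> l < length L" "k \<ge> N" for w k
    using that N n by (auto simp: em_def Cs_def Vq_def)
  define un where "un l = (\<lambda>l'. if l' = l then (1::'k) else 0)" for l :: nat
  define D where "D k i l = \<Psi> k (f k *\<^sub>v ci k (em (un l))) 0 i" for k i l
  have claim1: "\<Psi> k (f k *\<^sub>v ci k (em w)) 0 i = (\<Sum>l<length L. w l * D k i l)"
    if k: "k \<ge> N" and w: "\<forall>l. w l \<noteq> 0 \<longrightarrow> l < length L" for k w i
    unfolding D_def un_def
  proof (rule lin_expand[OF _ _ w])
    fix u v :: "nat \<Rightarrow> 'k" assume u: "\<forall>l. u l \<noteq> 0 \<longrightarrow> l < length L" and v: "\<forall>l. v l \<noteq> 0 \<longrightarrow> l < length L"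
    note iu = ci[OF em_in[OF u k]] and iv = ci[OF em_in[OF v k]]
    have "\<Phi> k (ci k (em u) + ci k (em v)) = em (\<lambda>l. u l + v l)"
      using iu iv by (subst coord_add_fun[OF c']) (auto simp: em_def fun_eq_iff)
    then have "ci k (em (\<lambda>l. u l + v l)) = ci k (em u) + ci k (em v)"
      using ci_eq[of "ci k (em u) + ci k (em v)" k] iu iv by simp
    then have "f k *\<^sub>v ci k (em (\<lambda>l. u l + v l)) = f k *\<^sub>v ci k (em u) + f k *\<^sub>v ci k (em v)"
      using mult_add_distrib_mat_vec[OF fc, of "ci k (em u)" k "ci k (em v)"] iu iv by simp
    then show "\<Psi> k (f k *\<^sub>v ci k (em (\<lambda>l. u l + v l))) 0 i = \<Psi> k (f k *\<^sub>v ci k (em u)) 0 i + \<Psi> k (f k *\<^sub>v ci k (em v)) 0 i"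
      using coord_add[OF d' fv fv] iu iv by simp
  next
    fix a and u :: "nat \<Rightarrow> 'k" assume u: "\<forall>l. u l \<noteq> 0 \<longrightarrow> l < length L"
    note iu = ci[OF em_in[OF u k]]
    have "\<Phi> k (a \<cdot>\<^sub>v ci k (em u)) = em (\<lambda>l. a * u l)"
      using iu by (subst coord_smult_fun[OF c']) (auto simp: em_def fun_eq_iff)
    then have "ci k (em (\<lambda>l. a * u l)) = a \<cdot>\<^sub>v ci k (em u)"
      using ci_eq[of "a \<cdot>\<^sub>v ci k (em u)" k] iu by simp
    then have "f k *\<^sub>v ci k (em (\<lambda>l. a * u l)) = a \<cdot>\<^sub>v (f k *\<^sub>v ci k (em u))"
      using mult_mat_vec[OF fc, of "ci k (em u)" k a] iu by simp
    then show "\<Psi> k (f k *\<^sub>v ci k (em (\<lambda>l. a * u l))) 0 i = a * \<Psi> k (f k *\<^sub>v ci k (em u)) 0 i"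
      using coord_smult[OF d' fv] iu by simp
  qed
  \<comment> \<open>Multiplication by x does not change coordinates, so the entries read off in
    different high degrees agree.\<close>
  have step: "D (k + 1) i l = D k i l" if "k \<ge> N" "l < length L" for k i l
  proof -
    have w: "\<forall>l'. un l l' \<noteq> 0 \<longrightarrow> l' < length L" using that by (auto simp: un_def)
    note i0 = ci[OF em_in[OF w that(1)]]
    have one: "(1\<^sub>m n :: 'k mat) \<in> Lam n 1" by (rule Lam_one[OF n]) simp
    let ?v = "gact X 1 k (1\<^sub>m n) *\<^sub>v ci k (em (un l))"
    have "\<Phi> (1 + k) ?v = em (un l)"
      using coord_act[OF c' one] i0 n by (simp add: act_one em_def)
    then have "?v = ci (1 + k) (em (un l))" using ci_eq[OF gv[OF one]] i0 by metis
    then have "D (1 + k) i l = act n (1\<^sub>m n) (\<Psi> k (f k *\<^sub>v ci k (em (un l)))) 0 i"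
      unfolding D_def using equi[OF one] i0 by metis
    also have "\<dots> = D k i l"
      using Cs_outside[OF coord_in[OF d' fv]] i0 by (subst act_one) (auto simp: D_def)
    finally show ?thesis by (simp add: add.commute)
  qed
  define C where "C = D N"
  have DC: "D k i l = C i l" if "k \<ge> N" "l < length L" for k i l
    using that(1) by (induction k rule: int_ge_induct) (auto simp: C_def step[OF _ that(2)])
  have main: "\<Psi> k (f k *\<^sub>v v) q = mapp (length L') (length L) C (\<Phi> k v q)" if v: "v \<in> hcomp X k" for k v q
  proof (cases "q < n")
    case False
    have "\<Psi> k (f k *\<^sub>v v) q l = 0" for l using Cs_outside[OF coord_in[OF d' fv[OF v]]] False by simp
    moreover have "\<Phi> k v q = (\<lambda>_. 0)" using Cs_outside[OF coord_in[OF c' v]] False by auto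
    ultimately show ?thesis by auto
  next
    case q: True
    \<comment> \<open>Large enough to reach degree \<open>N\<close>, and nonnegative so that E_0q
      x^M lies in \<Lambda>.\<close>
    define M where "M = max 0 (N - k)"
    have A: "(Emat n 0 q :: 'k mat) \<in> Lam n M" by (rule Emat_Lam) (use cexp_0[of n q] in \<open>simp add: M_def del: cexp_0\<close>)
    have k': "M + k \<ge> N" by (auto simp: M_def)
    let ?w = "\<Phi> k v q"
    have w: "\<forall>l. ?w l \<noteq> 0 \<longrightarrow> l < length L" using coord_in[OF c' v] by (auto simp: Cs_def Vq_def)
    have "\<Phi> (M + k) (gact X M k (Emat n 0 q) *\<^sub>v v) = em ?w"
      using coord_act[OF c' A v] q n by (auto simp: act_Emat em_def fun_eq_iff)
    then have "gact X M k (Emat n 0 q) *\<^sub>v v = ci (M + k) (em ?w)" using ci_eq[OF gv[OF A v]] by metis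
    then have "\<Psi> (M + k) (f (M + k) *\<^sub>v ci (M + k) (em ?w)) = act n (Emat n 0 q) (\<Psi> k (f k *\<^sub>v v))"
      using equi[OF A v] by simp
    then have "\<Psi> k (f k *\<^sub>v v) q i = (\<Sum>l<length L. ?w l * D (M + k) i l)" for i
      using claim1[OF k' w, of i] q n by (simp add: act_Emat)
    then have *: "\<Psi> k (f k *\<^sub>v v) q i = (\<Sum>l<length L. C i l * ?w l)" for i
      using DC[OF k'] by (simp add: mult.commute)
    show ?thesis
    proof
      fix i show "\<Psi> k (f k *\<^sub>v v) q i = mapp (length L') (length L) C ?w i"
        using * Cs_outside2[OF coord_in[OF d' fv[OF v]], of i q] by (auto simp: mapp_def)
    qed
  qed
  have "graded L L' C"
    unfolding graded_def
  proof (intro allI impI)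
    fix i j assume ij: "i < length L'" "j < length L" "C i j \<noteq> 0"
    \<comment> \<open>The \<open>j\<close>-th unit vector at a position in the support of
      \<open>L ! j\<close> has an image with \<open>i\<close>-th entry \<open>C i j\<close>; if this
      is nonzero, \<open>L' ! i\<close> is supported there as well.\<close>
    have "in_supp n (L' ! i) q k" if s: "in_supp n (L ! j) q k" for q k
    proof -
      have "un j \<in> Vq n L q k" using s ij by (auto simp: un_def Vq_def)
      then obtain v where v: "v \<in> hcomp X k" "\<Phi> k v = (\<lambda>q'. if q' = q then un j else (\<lambda>_. 0))"
        using coord_surj[OF c' Cs_single] by blast
      have "\<Psi> k (f k *\<^sub>v v) q i = C i j"
        using main[OF v(1), of q] ij mapp_unit[OF ij(2), of "length L'" C] by (simp add: v(2) un_def)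
      then show ?thesis using coord_in[OF d' fv[OF v(1)]] ij by (auto simp: Cs_def Vq_def)
    qed
    then show "ple (L ! j) (L' ! i)" using n by (subst ple_iff_in_supp[of n]) auto
  qed
  then show ?thesis using main c d f unfolding hrep_def \<Phi>_def \<Psi>_def by blast
qed

text \<open>Gradedness makes \<open>C\<close> respect supports, so it can be applied at every
  coordinate and degree at once. The result is \<Lambda>-linear because \<open>act\<close> mixes
  coordinates only, while \<open>C\<close> mixes summands only.\<close>

lemma matrix_hom:
  fixes X Y :: "'k::field gmod"
  assumes c: "types n X L" and d: "types n Y L'" and g: "graded L L' C"
  shows "\<exists>f. hrep n X L Y L' f C"
proof -
  define \<Phi> where "\<Phi> = coords n X L"
  define \<Psi> where "\<Psi> = coords n Y L'"
  have c': "coord n X L \<Phi>" and d': "coord n Y L' \<Psi>" using c d types_coord by (auto simp: \<Phi>_def \<Psi>_def)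
  define T where "T k v = (\<lambda>q. mapp (length L') (length L) C (\<Phi> k v q))" for k v
  define h where "h k v = (SOME u. u \<in> hcomp Y k \<and> \<Psi> k u = T k v)" for k v
  have Tin: "T k v \<in> Cs n L' k" if "v \<in> hcomp X k" for k v
    using coord_in[OF c' that] graded_mapp[OF g] by (auto simp: T_def Cs_def)
  have h: "h k v \<in> hcomp Y k \<and> \<Psi> k (h k v) = T k v" if "v \<in> hcomp X k" for k v
    unfolding h_def by (rule someI_ex) (use coord_surj[OF d' Tin[OF that]] in blast)
  have heq: "h k v = u" if "v \<in> hcomp X k" "u \<in> hcomp Y k" "\<Psi> k u = T k v" for k v u
    using h[OF that(1)] that coord_inj[OF d'] by metis
  define f where "f k = mat (gdim Y k) (gdim X k) (\<lambda>(i,j). h k (unit_vec (gdim X k) j) $ i)" for k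
  have fh: "f k *\<^sub>v v = h k v" if v: "v \<in> hcomp X k" for k v
    unfolding f_def
  proof (rule mat_of_linear[OF _ _ _ v])
    fix u v :: "'k vec" assume u: "u \<in> hcomp X k" and v: "v \<in> hcomp X k"
    show "h k (u + v) = h k u + h k v"
      using h[OF u] h[OF v] u v
      by (intro heq) (auto simp: coord_add_fun[OF d'] T_def coord_add_fun[OF c'] mapp_add)
  next
    fix a and u :: "'k vec" assume u: "u \<in> hcomp X k"
    show "h k (a \<cdot>\<^sub>v u) = a \<cdot>\<^sub>v h k u"
      using h[OF u] u
      by (intro heq) (auto simp: coord_smult_fun[OF d'] T_def coord_smult_fun[OF c'] mapp_smult)
  qed (use h in blast)
  have fc: "f k \<in> carrier_mat (gdim Y k) (gdim X k)" for k by (simp add: f_def)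
  have "f (m + k) * gact X m k A = gact Y m k A * f k" if A: "A \<in> Lam n m" for m k A
  proof (rule mat_eq_on_vec)
    note gX = coord_gact[OF c' A, of k] and gY = coord_gact[OF d' A, of k]
    show "f (m + k) * gact X m k A \<in> carrier_mat (gdim Y (m + k)) (gdim X k)"
      "gact Y m k A * f k \<in> carrier_mat (gdim Y (m + k)) (gdim X k)" using mult_carrier_mat[OF fc gX] mult_carrier_mat[OF gY fc] by auto
    fix v :: "'k vec" assume v: "v \<in> hcomp X k"
    have 1: "(f (m + k) * gact X m k A) *\<^sub>v v = h (m + k) (gact X m k A *\<^sub>v v)"
      using assoc_mult_mat_vec[OF fc gX v] fh[of "gact X m k A *\<^sub>v v" "m + k"] gX v by simp
    have hv: "h k v \<in> hcomp Y k" using h v by blast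
    have 2: "(gact Y m k A * f k) *\<^sub>v v = gact Y m k A *\<^sub>v h k v"
      using assoc_mult_mat_vec[OF gY fc v] fh[OF v] by simp
    have sw: "act n A (T k v) = (\<lambda>q. mapp (length L') (length L) C (act n A (\<Phi> k v) q))"
    proof (intro ext)
      fix p i
      have "(\<Sum>q<n. A $$ (p, q) * (\<Sum>l<length L. C i l * \<Phi> k v q l)) = (\<Sum>q<n. \<Sum>l<length L. C i l * (A $$ (p,q) * \<Phi> k v q l))"
        by (simp add: sum_distrib_left mult.left_commute)
      also have "\<dots> = (\<Sum>l<length L. C i l * (\<Sum>q<n. A $$ (p,q) * \<Phi> k v q l))"
        by (subst sum.swap) (simp add: sum_distrib_left)
      finally show "act n A (T k v) p i = mapp (length L') (length L) C (act n A (\<Phi> k v) p) i"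
        by (simp add: act_def T_def mapp_def)
    qed
    have "h (m + k) (gact X m k A *\<^sub>v v) = gact Y m k A *\<^sub>v h k v"
    proof (rule heq)
      show "\<Psi> (m + k) (gact Y m k A *\<^sub>v h k v) = T (m + k) (gact X m k A *\<^sub>v v)"
        using coord_act[OF d' A hv] h[OF v] coord_act[OF c' A v] sw by (simp add: T_def)
    qed (use gX gY v hv in auto)
    then show "(f (m + k) * gact X m k A) *\<^sub>v v = (gact Y m k A * f k) *\<^sub>v v" using 1 2 by simp
  qed
  then have "is_hom n X Y f" using fc by (simp add: is_hom_def)
  moreover have "\<Psi> k (f k *\<^sub>v v) q = mapp (length L') (length L) C (\<Phi> k v q)" if "v \<in> hcomp X k" for k v q
    using h[OF that] fh[OF that] by (simp add: T_def)
  ultimately show ?thesis using c d g unfolding hrep_def \<Phi>_def \<Psi>_def by blast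
qed


lemma hrepD:
  assumes "hrep n X L Y L' f C"
  shows hrep_types1: "types n X L" and hrep_types2: "types n Y L'" and hrep_hom: "is_hom n X Y f"
    and hrep_graded: "graded L L' C"
    and hrep_app: "v \<in> hcomp X k \<Longrightarrow> coords n Y L' k (f k *\<^sub>v v) = (\<lambda>q. mapp (length L') (length L) C (coords n X L k v q))"
    and hrep_carrier: "f k \<in> carrier_mat (gdim Y k) (gdim X k)"
    and hrep_vec: "v \<in> hcomp X k \<Longrightarrow> f k *\<^sub>v v \<in> hcomp Y k"
  using assms unfolding hrep_def is_hom_def by (auto simp: fun_eq_iff) (metis mult_mat_vec_carrier)

lemma elem_at_position:
  assumes "types n X L" "w \<in> Vq n L q k"
  obtains v where "v \<in> hcomp X k" "coords n X L k v = (\<lambda>q'. if q' = q then w else (\<lambda>_. 0))"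
  using coord_surj[OF types_coord[OF assms(1)] Cs_single[OF assms(2)]] by blast

lemma coords_Vq: "types n X L \<Longrightarrow> v \<in> hcomp X k \<Longrightarrow> coords n X L k v q \<in> Vq n L q k"
  by (drule (1) coord_in[OF types_coord]) (simp add: Cs_def)

lemma Vq_supp: "w \<in> Vq n L q k \<Longrightarrow> w l \<noteq> 0 \<Longrightarrow> l < length L \<and> in_supp n (L ! l) q k"
  by (auto simp: Vq_def)

lemma hrep_eq:
  fixes X Y :: "'k::field gmod"
  assumes f: "hrep n X L Y L' f C" and g: "hrep n X L Y L' g D"
    and eq: "\<And>i j. i < length L' \<Longrightarrow> j < length L \<Longrightarrow> C i j = D i j"
  shows "f = g"
proof
  fix k show "f k = g k"
  proof (rule mat_eq_on_vec[OF hrep_carrier[OF f] hrep_carrier[OF g]])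
    fix v :: "'k vec" assume v: "v \<in> hcomp X k"
    have "coords n Y L' k (f k *\<^sub>v v) = coords n Y L' k (g k *\<^sub>v v)"
      using mapp_cong[of "length L'" "length L" C D] eq by (simp add: hrep_app[OF f v] hrep_app[OF g v])
    then show "f k *\<^sub>v v = g k *\<^sub>v v"
      using coord_inj[OF types_coord[OF hrep_types2[OF f]]] hrep_vec[OF f v] hrep_vec[OF g v] by blast
  qed
qed

text \<open>The entry is seen by applying the morphism to the \<open>j\<close>-th unit vector at a
  position where summand \<open>j\<close> is supported.\<close>

lemma hrep_unique:
  assumes f: "hrep n X L Y L' f C" and g: "hrep n X L Y L' f D" and n: "n \<ge> 3"
    and ij: "i < length L'" "j < length L"
  shows "C i j = D i j"
proof -
  obtain q k where q: "q < n" "\<And>P. in_supp n P q k \<longleftrightarrow> fst (L ! j) \<le> fst P" using even_position[of n] n by (metis gr_zeroI not_numeral_le_zero)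
  let ?u = "\<lambda>l. if l = j then 1 else 0"
  have u: "?u \<in> Vq n L q k" using q ij by (auto simp: Vq_def)
  obtain v where v: "v \<in> hcomp X k" "coords n X L k v = (\<lambda>q'. if q' = q then ?u else (\<lambda>_. 0))"
    using elem_at_position[OF hrep_types1[OF f] u] by blast
  have "(\<lambda>q. mapp (length L') (length L) C (coords n X L k v q)) q = (\<lambda>q. mapp (length L') (length L) D (coords n X L k v q)) q"
    using hrep_app[OF f v(1)] hrep_app[OF g v(1)] by metis
  then have "mapp (length L') (length L) C ?u = mapp (length L') (length L) D ?u"
    by (simp add: v(2))
  then show ?thesis using ij by (simp add: mapp_unit fun_eq_iff) (metis ij(1))
qed

lemma is_hom_comp:
  assumes f: "is_hom n X Y f" and g: "is_hom n Y Z g" and X: "is_gmod n X" and Y: "is_gmod n Y" and Z: "is_gmod n Z"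
  shows "is_hom n X Z (comp g f)"
proof -
  have fc: "f k \<in> carrier_mat (gdim Y k) (gdim X k)" and gc: "g k \<in> carrier_mat (gdim Z k) (gdim Y k)" for k
    using f g by (auto simp: is_hom_def)
  have "(g (m + k) * f (m + k)) * gact X m k A = gact Z m k A * (g k * f k)" if A: "A \<in> Lam n m" for m k A
  proof -
    have a: "gact X m k A \<in> carrier_mat (gdim X (m+k)) (gdim X k)" "gact Y m k A \<in> carrier_mat (gdim Y (m+k)) (gdim Y k)"
      "gact Z m k A \<in> carrier_mat (gdim Z (m+k)) (gdim Z k)" using X Y Z A by (auto simp: is_gmod_def)
    have "(g (m + k) * f (m + k)) * gact X m k A = g (m + k) * (gact Y m k A * f k)"
      using assoc_mult_mat[OF gc fc a(1)] f A by (simp add: is_hom_def)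
    also have "\<dots> = (gact Z m k A * g k) * f k"
      using assoc_mult_mat[OF gc a(2) fc] g A by (simp add: is_hom_def)
    also have "\<dots> = gact Z m k A * (g k * f k)" by (rule assoc_mult_mat[OF a(3) gc fc])
    finally show ?thesis .
  qed
  then show ?thesis using mult_carrier_mat[OF gc fc] by (simp add: is_hom_def comp_def)
qed

lemma types_gmod: "n \<ge> 3 \<Longrightarrow> types n X L \<Longrightarrow> is_gmod n X"
  using coord_is_gmod types_coord by blast

lemma types_valid: "types n X L \<Longrightarrow> i < length L \<Longrightarrow> valid n (L ! i)"
  using coord_valid[OF types_coord] nth_mem by blast

lemma hrep_comp:
  assumes n: "n \<ge> 3" and f: "hrep n X L Y L' f C" and g: "hrep n Y L' Z L'' g D"
  shows "hrep n X L Z L'' (comp g f) (mprod (length L') D C)"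
proof -
  note tX = hrep_types1[OF f] and tY = hrep_types2[OF f] and tZ = hrep_types2[OF g]
  have h: "is_hom n X Z (comp g f)"
    by (rule is_hom_comp[OF hrep_hom[OF f] hrep_hom[OF g] types_gmod[OF n tX] types_gmod[OF n tY] types_gmod[OF n tZ]])
  have "coords n Z L'' k (comp g f k *\<^sub>v v) q = mapp (length L'') (length L) (mprod (length L') D C) (coords n X L k v q)"
    if v: "v \<in> hcomp X k" for k v q
    using hrep_app[OF g hrep_vec[OF f v]] hrep_app[OF f v]
    by (simp add: comp_def assoc_mult_mat_vec[OF hrep_carrier[OF g] hrep_carrier[OF f] v] mapp_mm)
  then show ?thesis using h tX tZ graded_mm[OF hrep_graded[OF f] hrep_graded[OF g]] by (simp add: hrep_def)
qed

lemma hrep_id: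
  assumes n: "n \<ge> 3" and X: "types n X L"
  shows "hrep n X L X L (idm X) idc"
proof -
  have "is_hom n X X (idm X)"
    using left_mult_one_mat[OF coord_gact[OF types_coord[OF X]]] right_mult_one_mat[OF coord_gact[OF types_coord[OF X]]]
    by (auto simp: is_hom_def idm_def)
  moreover have "coords n X L k (idm X k *\<^sub>v v) q = mapp (length L) (length L) idc (coords n X L k v q)"
    if v: "v \<in> hcomp X k" for k v q
    using v coords_Vq[OF X v, of q] by (subst mapp_idc) (auto simp: idm_def Vq_def)
  ultimately show ?thesis using X graded_idc by (auto simp: hrep_def)
qed

lemma is_hom_0:
  assumes "is_gmod n X" "is_gmod n Y"
  shows "is_hom n X Y (\<lambda>k. 0\<^sub>m (gdim Y k) (gdim X k))"
proof -
  have a: "gact X m k A \<in> carrier_mat (gdim X (m+k)) (gdim X k)" "gact Y m k A \<in> carrier_mat (gdim Y (m+k)) (gdim Y k)"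
    if "A \<in> Lam n m" for m k A using assms that by (auto simp: is_gmod_def)
  show ?thesis using left_mult_zero_mat[OF a(1)] right_mult_zero_mat[OF a(2)] by (simp add: is_hom_def)
qed

lemma hrep_0:
  fixes X Y :: "'k::field gmod"
  assumes n: "n \<ge> 3" and X: "types n X L" and Y: "types n Y L'"
  shows "hrep n X L Y L' (\<lambda>k. 0\<^sub>m (gdim Y k) (gdim X k)) (\<lambda>_ _. 0)"
proof -
  have "coords n Y L' k (0\<^sub>m (gdim Y k) (gdim X k) *\<^sub>v v) q = mapp (length L') (length L) (\<lambda>_ _. 0) (coords n X L k v q)"
    if v: "v \<in> hcomp X k" for k and v :: "'k vec" and q
  proof -
    have "0\<^sub>m (gdim Y k) (gdim X k) *\<^sub>v v = 0\<^sub>v (gdim Y k)" using v by (intro eq_vecI) auto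
    then show ?thesis using coord_zero[OF types_coord[OF Y], of k] by (auto simp: mapp_def)
  qed
  then show ?thesis using X Y is_hom_0[OF types_gmod[OF n X] types_gmod[OF n Y]] by (auto simp: hrep_def graded_def)
qed

lemma hrep_diff:
  assumes n: "n \<ge> 3" and f: "hrep n X L Y L' f C" and g: "hrep n X L Y L' g D"
  shows "hrep n X L Y L' (\<lambda>k. f k - g k) (\<lambda>i j. C i j - D i j)"
proof -
  note tX = hrep_types1[OF f] and tY = hrep_types2[OF f]
  note fc = hrep_carrier[OF f] and gc = hrep_carrier[OF g]
  have "(f (m + k) - g (m + k)) * gact X m k A = gact Y m k A * (f k - g k)" if A: "A \<in> Lam n m" for m k A
    using minus_mult_distrib_mat[OF fc gc coord_gact[OF types_coord[OF tX] A]]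
      mult_minus_distrib_mat[OF coord_gact[OF types_coord[OF tY] A] fc gc] hrep_hom[OF f] hrep_hom[OF g] A
    by (simp add: is_hom_def)
  then have h: "is_hom n X Y (\<lambda>k. f k - g k)" using fc gc by (auto simp: is_hom_def minus_carrier_mat)
  have dc: "f k - g k \<in> carrier_mat (gdim Y k) (gdim X k)" for k using gc by (auto simp: minus_carrier_mat)
  have "coords n Y L' k ((f k - g k) *\<^sub>v v) q = mapp (length L') (length L) (\<lambda>i j. C i j - D i j) (coords n X L k v q)"
    if v: "v \<in> hcomp X k" for k v q
  proof -
    have dv: "(f k - g k) *\<^sub>v v \<in> hcomp Y k" using dc[of k] v by simp
    have "coords n Y L' k (f k *\<^sub>v v) q l = coords n Y L' k ((f k - g k) *\<^sub>v v) q l + coords n Y L' k (g k *\<^sub>v v) q l" for l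
      using coord_add[OF types_coord[OF tY] dv hrep_vec[OF g v]] mult_mat_vec_diff[OF fc gc v] by metis
    then have "coords n Y L' k ((f k - g k) *\<^sub>v v) q l =
        mapp (length L') (length L) C (coords n X L k v q) l - mapp (length L') (length L) D (coords n X L k v q) l" for l
      by (simp add: hrep_app[OF f v] hrep_app[OF g v] eq_diff_eq)
    then show ?thesis
      by (simp add: fun_eq_iff) (simp add: mapp_def left_diff_distrib sum_subtractf)
  qed
  moreover have "graded L L' (\<lambda>i j. C i j - D i j)"
    using hrep_graded[OF f] hrep_graded[OF g] by (auto simp: graded_def) (metis diff_0_right)
  ultimately show ?thesis using h tX tY by (simp add: hrep_def)
qed

lemma split_epi_iff:
  assumes n: "n \<ge> 3" and g: "hrep n Y L' Z L g D"
  shows "split_epi n Y Z g \<longleftrightarrow> (\<exists>S. graded L L' S \<and> (\<forall>i<length L. \<forall>j<length L. mprod (length L') D S i j = idc i j))"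
proof
  assume "split_epi n Y Z g"
  then obtain s where s: "is_hom n Z Y s" "comp g s = idm Z" by (auto simp: split_epi_def)
  obtain S where S: "hrep n Z L Y L' s S" using hom_matrix[OF n hrep_types2[OF g] hrep_types1[OF g] s(1)] by blast
  have "hrep n Z L Z L (idm Z) (mprod (length L') D S)" using hrep_comp[OF n S g] s(2) by simp
  then have "\<forall>i<length L. \<forall>j<length L. mprod (length L') D S i j = idc i j"
    using hrep_unique[OF _ hrep_id[OF n hrep_types2[OF g]] n] by blast
  then show "\<exists>S. graded L L' S \<and> (\<forall>i<length L. \<forall>j<length L. mprod (length L') D S i j = idc i j)"
    using hrep_graded[OF S] by blast
next
  assume "\<exists>S. graded L L' S \<and> (\<forall>i<length L. \<forall>j<length L. mprod (length L') D S i j = idc i j)"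
  then obtain S where S: "graded L L' S" "\<forall>i<length L. \<forall>j<length L. mprod (length L') D S i j = idc i j" by blast
  obtain s where s: "hrep n Z L Y L' s S" using matrix_hom[OF hrep_types2[OF g] hrep_types1[OF g] S(1)] by blast
  have "comp g s = idm Z"
    by (rule hrep_eq[OF hrep_comp[OF n s g] hrep_id[OF n hrep_types2[OF g]]]) (use S(2) in blast)
  then show "split_epi n Y Z g" using hrep_hom[OF s] by (auto simp: split_epi_def)
qed

lemma split_mono_iff:
  assumes n: "n \<ge> 3" and f: "hrep n X L Y L' f C"
  shows "split_mono n X Y f \<longleftrightarrow> (\<exists>S. graded L' L S \<and> (\<forall>i<length L. \<forall>j<length L. mprod (length L') S C i j = idc i j))"
proof
  assume "split_mono n X Y f"
  then obtain s where s: "is_hom n Y X s" "comp s f = idm X" by (auto simp: split_mono_def)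
  obtain S where S: "hrep n Y L' X L s S" using hom_matrix[OF n hrep_types2[OF f] hrep_types1[OF f] s(1)] by blast
  have "hrep n X L X L (idm X) (mprod (length L') S C)" using hrep_comp[OF n f S] s(2) by simp
  then have "\<forall>i<length L. \<forall>j<length L. mprod (length L') S C i j = idc i j"
    using hrep_unique[OF _ hrep_id[OF n hrep_types1[OF f]] n] by blast
  then show "\<exists>S. graded L' L S \<and> (\<forall>i<length L. \<forall>j<length L. mprod (length L') S C i j = idc i j)"
    using hrep_graded[OF S] by blast
next
  assume "\<exists>S. graded L' L S \<and> (\<forall>i<length L. \<forall>j<length L. mprod (length L') S C i j = idc i j)"
  then obtain S where S: "graded L' L S" "\<forall>i<length L. \<forall>j<length L. mprod (length L') S C i j = idc i j" by blast
  obtain s where s: "hrep n Y L' X L s S" using matrix_hom[OF hrep_types2[OF f] hrep_types1[OF f] S(1)] by blast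
  have "comp s f = idm X"
    by (rule hrep_eq[OF hrep_comp[OF n f s] hrep_id[OF n hrep_types1[OF f]]]) (use S(2) in blast)
  then show "split_mono n X Y f" using hrep_hom[OF s] by (auto simp: split_mono_def)
qed

lemma iso_matrix:
  fixes X Y :: "'k::field gmod"
  assumes n: "n \<ge> 3" and X: "types n X L" and Y: "types n Y L'" and iso: "is_iso n X Y"
  shows "\<exists>C D :: nat \<Rightarrow> nat \<Rightarrow> 'k. graded L L' C \<and> graded L' L D \<and>
    (\<forall>i<length L. \<forall>j<length L. mprod (length L') D C i j = idc i j) \<and>
    (\<forall>i<length L'. \<forall>j<length L'. mprod (length L) C D i j = idc i j)"
proof -
  obtain f g where fg: "is_hom n X Y f" "is_hom n Y X g" "comp g f = idm X" "comp f g = idm Y"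
    using iso by (auto simp: is_iso_def)
  obtain C where C: "hrep n X L Y L' f C" using hom_matrix[OF n X Y fg(1)] by blast
  obtain D where D: "hrep n Y L' X L g D" using hom_matrix[OF n Y X fg(2)] by blast
  have "hrep n X L X L (idm X) (mprod (length L') D C)" "hrep n Y L' Y L' (idm Y) (mprod (length L) C D)"
    using hrep_comp[OF n C D] hrep_comp[OF n D C] fg by simp_all
  note u = hrep_unique[OF this(1) hrep_id[OF n X] n] hrep_unique[OF this(2) hrep_id[OF n Y] n]
  show ?thesis using hrep_graded[OF C] hrep_graded[OF D] u by blast
qed

lemma matrix_iso:
  fixes X Y :: "'k::field gmod" and C D :: "nat \<Rightarrow> nat \<Rightarrow> 'k"
  assumes n: "n \<ge> 3" and X: "types n X L" and Y: "types n Y L'"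
    and C: "graded L L' C" and D: "graded L' L D"
    and DC: "\<And>i j. i < length L \<Longrightarrow> j < length L \<Longrightarrow> mprod (length L') D C i j = idc i j"
    and CD: "\<And>i j. i < length L' \<Longrightarrow> j < length L' \<Longrightarrow> mprod (length L) C D i j = idc i j"
  shows "is_iso n X Y"
proof -
  obtain f where f: "hrep n X L Y L' f C" using matrix_hom[OF X Y C] by blast
  obtain g where g: "hrep n Y L' X L g D" using matrix_hom[OF Y X D] by blast
  have "comp g f = idm X" by (rule hrep_eq[OF hrep_comp[OF n f g] hrep_id[OF n X]]) (use DC in blast)
  moreover have "comp f g = idm Y" by (rule hrep_eq[OF hrep_comp[OF n g f] hrep_id[OF n Y]]) (use CD in blast)
  ultimately show ?thesis using hrep_hom[OF f] hrep_hom[OF g] by (auto simp: is_iso_def)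
qed

lemma mm_idc: "i < r \<Longrightarrow> mprod r idc C i j = C i j"
  by (simp add: mprod_def idc_def if_distrib[of "\<lambda>x. x * _"] cong: if_cong)

text \<open>The identity matrix is graded between equal lists: the list of pairs determines the
  module up to isomorphism.\<close>

lemma types_iso:
  assumes n: "n \<ge> 3" and X: "types n X L" and Y: "types n Y L"
  shows "is_iso n X Y"
  by (rule matrix_iso[OF n X Y graded_idc graded_idc]) (simp_all add: mm_idc)

section \<open>Short exact sequences, one position at a time\<close>

definition exact_at :: "nat \<Rightarrow> (int \<times> int) list \<Rightarrow> (int \<times> int) list \<Rightarrow> (int \<times> int) list \<Rightarrow>
   (nat \<Rightarrow> nat \<Rightarrow> 'k::field) \<Rightarrow> (nat \<Rightarrow> nat \<Rightarrow> 'k) \<Rightarrow> nat \<Rightarrow> int \<Rightarrow> bool" where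
  "exact_at n L L' L'' C D q k \<longleftrightarrow>
    (\<forall>u \<in> Vq n L q k. mapp (length L') (length L) C u = (\<lambda>_. 0) \<longrightarrow> u = (\<lambda>_. 0)) \<and>
    (\<forall>w \<in> Vq n L'' q k. \<exists>v \<in> Vq n L' q k. mapp (length L'') (length L') D v = w) \<and>
    (\<forall>v \<in> Vq n L' q k. mapp (length L'') (length L') D v = (\<lambda>_. 0) \<longleftrightarrow> (\<exists>u \<in> Vq n L q k. mapp (length L') (length L) C u = v))"

lemma exact_inj: "exact_at n L L' L'' C D q k \<Longrightarrow> u \<in> Vq n L q k \<Longrightarrow> mapp (length L') (length L) C u = (\<lambda>_. 0) \<Longrightarrow> u = (\<lambda>_. 0)"
  unfolding exact_at_def by (elim conjE) (drule (1) bspec, simp)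

lemma exact_surj: "exact_at n L L' L'' C D q k \<Longrightarrow> w \<in> Vq n L'' q k \<Longrightarrow> \<exists>v\<in>Vq n L' q k. mapp (length L'') (length L') D v = w"
  unfolding exact_at_def by (elim conjE) (drule (1) bspec)

lemma exact_ker: "exact_at n L L' L'' C D q k \<Longrightarrow> v \<in> Vq n L' q k \<Longrightarrow>
    mapp (length L'') (length L') D v = (\<lambda>_. 0) \<longleftrightarrow> (\<exists>u\<in>Vq n L q k. mapp (length L') (length L) C u = v)"
  unfolding exact_at_def by (elim conjE) (drule (1) bspec)

text \<open>In coordinates an element of a component is a family indexed by q, and both morphisms
  act on each member separately. One direction uses elements concentrated at a single q, the other
  assembles solutions found for each q.\<close>

lemma ses_iff:
  fixes X Y Z :: "'k::field gmod"
  assumes n: "n \<ge> 3" and f: "hrep n X L Y L' f C" and g: "hrep n Y L' Z L'' g D"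
    and CM: "is_CM n X" "is_CM n Y" "is_CM n Z"
  shows "ses n X Y Z f g \<longleftrightarrow> (\<forall>q k. exact_at n L L' L'' C D q k)"
proof -
  note tX = hrep_types1[OF f] and tY = hrep_types2[OF f] and tZ = hrep_types2[OF g]
  note cX = types_coord[OF tX] and cY = types_coord[OF tY] and cZ = types_coord[OF tZ]
  let ?X = "coords n X L" and ?Y = "coords n Y L'" and ?Z = "coords n Z L''"
  let ?C = "mapp (length L') (length L) C" and ?D = "mapp (length L'') (length L') D"
  have fz: "f k *\<^sub>v u = 0\<^sub>v (gdim Y k) \<longleftrightarrow> (\<forall>q. ?C (?X k u q) = (\<lambda>_. 0))" if u: "u \<in> hcomp X k" for k u
    using coord_eq0[OF cY hrep_vec[OF f u]] hrep_app[OF f u] by (auto simp: fun_eq_iff)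
  have gz: "g k *\<^sub>v v = 0\<^sub>v (gdim Z k) \<longleftrightarrow> (\<forall>q. ?D (?Y k v q) = (\<lambda>_. 0))" if v: "v \<in> hcomp Y k" for k v
    using coord_eq0[OF cZ hrep_vec[OF g v]] hrep_app[OF g v] by (auto simp: fun_eq_iff)
  have xz: "u = 0\<^sub>v (gdim X k) \<longleftrightarrow> (\<forall>q. ?X k u q = (\<lambda>_. 0))" if u: "u \<in> hcomp X k" for k u
    using coord_eq0[OF cX u] by (auto simp: fun_eq_iff)
  have feq: "f k *\<^sub>v u = v \<longleftrightarrow> (\<forall>q. ?C (?X k u q) = ?Y k v q)" if u: "u \<in> hcomp X k" and v: "v \<in> hcomp Y k" for k u v
    using coord_inj[OF cY hrep_vec[OF f u] v] hrep_app[OF f u] by (auto simp: fun_eq_iff)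
  have geq: "g k *\<^sub>v u = v \<longleftrightarrow> (\<forall>q. ?D (?Y k u q) = ?Z k v q)" if u: "u \<in> hcomp Y k" and v: "v \<in> hcomp Z k" for k u v
    using coord_inj[OF cZ hrep_vec[OF g u] v] hrep_app[OF g u] by (auto simp: fun_eq_iff)
  show ?thesis
  proof
    assume s: "ses n X Y Z f g"
    have s1: "f k *\<^sub>v u = 0\<^sub>v (gdim Y k) \<Longrightarrow> u = 0\<^sub>v (gdim X k)" if "u \<in> hcomp X k" for k u
      using s that by (auto simp: ses_def)
    have s2: "\<exists>v\<in>hcomp Y k. g k *\<^sub>v v = w" if "w \<in> hcomp Z k" for k w
      using s that by (auto simp: ses_def)
    have s3: "g k *\<^sub>v v = 0\<^sub>v (gdim Z k) \<longleftrightarrow> (\<exists>u\<in>hcomp X k. f k *\<^sub>v u = v)" if "v \<in> hcomp Y k" for k v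
      using s that unfolding ses_def by blast
    show "\<forall>q k. exact_at n L L' L'' C D q k"
      unfolding exact_at_def
    proof (intro allI conjI ballI impI)
      fix q k and u :: "nat \<Rightarrow> 'k" assume u: "u \<in> Vq n L q k" "?C u = (\<lambda>_. 0)"
      obtain x where x: "x \<in> hcomp X k" "?X k x = (\<lambda>q'. if q' = q then u else (\<lambda>_. 0))"
        using elem_at_position[OF tX u(1)] by blast
      have "f k *\<^sub>v x = 0\<^sub>v (gdim Y k)" using u(2) by (subst fz[OF x(1)]) (simp add: x(2))
      then have "x = 0\<^sub>v (gdim X k)" using s1[OF x(1)] by blast
      then have "?X k x q = (\<lambda>_. 0)" using xz[OF x(1)] by blast
      then show "u = (\<lambda>_. 0)" by (simp add: x(2))
    next
      fix q k and w :: "nat \<Rightarrow> 'k" assume w: "w \<in> Vq n L'' q k"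
      obtain z where z: "z \<in> hcomp Z k" "?Z k z = (\<lambda>q'. if q' = q then w else (\<lambda>_. 0))"
        using elem_at_position[OF tZ w(1)] by blast
      obtain y where y: "y \<in> hcomp Y k" "g k *\<^sub>v y = z" using s2[OF z(1)] by blast
      have "?D (?Y k y q) = w" using y(2) geq[OF y(1) z(1)] by (simp add: z(2))
      then show "\<exists>v\<in>Vq n L' q k. ?D v = w" using coords_Vq[OF tY y(1)] by blast
    next
      fix q k and v :: "nat \<Rightarrow> 'k" assume v: "v \<in> Vq n L' q k"
      obtain y where y: "y \<in> hcomp Y k" "?Y k y = (\<lambda>q'. if q' = q then v else (\<lambda>_. 0))"
        using elem_at_position[OF tY v(1)] by blast
      have "?D v = (\<lambda>_. 0) \<longleftrightarrow> g k *\<^sub>v y = 0\<^sub>v (gdim Z k)" by (subst gz[OF y(1)]) (auto simp: y(2))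
      also have "\<dots> \<longleftrightarrow> (\<exists>u\<in>hcomp X k. f k *\<^sub>v u = y)" by (rule s3[OF y(1)])
      also have "\<dots> \<longleftrightarrow> (\<exists>u\<in>Vq n L q k. ?C u = v)"
      proof
        assume "\<exists>u\<in>hcomp X k. f k *\<^sub>v u = y"
        then obtain u where u: "u \<in> hcomp X k" "f k *\<^sub>v u = y" by blast
        have "?C (?X k u q) = v" using feq[OF u(1) y(1)] u(2) by (simp add: y(2))
        then show "\<exists>u\<in>Vq n L q k. ?C u = v" using coords_Vq[OF tX u(1)] by blast
      next
        assume "\<exists>u\<in>Vq n L q k. ?C u = v"
        then obtain u where u: "u \<in> Vq n L q k" "?C u = v" by blast
        obtain x where x: "x \<in> hcomp X k" "?X k x = (\<lambda>q'. if q' = q then u else (\<lambda>_. 0))"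
          using elem_at_position[OF tX u(1)] by blast
        have "f k *\<^sub>v x = y" using u(2) by (subst feq[OF x(1) y(1)]) (simp add: x(2) y(2))
        then show "\<exists>u\<in>hcomp X k. f k *\<^sub>v u = y" using x(1) by blast
      qed
      finally show "?D v = (\<lambda>_. 0) \<longleftrightarrow> (\<exists>u\<in>Vq n L q k. ?C u = v)" .
    qed
  next
    assume e: "\<forall>q k. exact_at n L L' L'' C D q k"
    have e1: "u = (\<lambda>_. 0)" if "u \<in> Vq n L q k" "?C u = (\<lambda>_. 0)" for u q k
      using e that unfolding exact_at_def by blast
    have e2: "\<exists>v. v \<in> Vq n L' q k \<and> ?D v = w" if "w \<in> Vq n L'' q k" for w q k
      using e that unfolding exact_at_def by blast
    have e3: "?D v = (\<lambda>_. 0) \<longleftrightarrow> (\<exists>u. u \<in> Vq n L q k \<and> ?C u = v)" if "v \<in> Vq n L' q k" for v q k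
      using e that unfolding exact_at_def by blast
    have "(\<forall>u \<in> hcomp X k. f k *\<^sub>v u = 0\<^sub>v (gdim Y k) \<longrightarrow> u = 0\<^sub>v (gdim X k)) \<and>
          (\<forall>w \<in> hcomp Z k. \<exists>v \<in> hcomp Y k. g k *\<^sub>v v = w) \<and>
          (\<forall>v \<in> hcomp Y k. g k *\<^sub>v v = 0\<^sub>v (gdim Z k) \<longleftrightarrow>
               (\<exists>u \<in> hcomp X k. f k *\<^sub>v u = v))" for k
    proof (intro conjI ballI impI)
      fix u assume u: "u \<in> hcomp X k" "f k *\<^sub>v u = 0\<^sub>v (gdim Y k)"
      then show "u = 0\<^sub>v (gdim X k)" using fz[OF u(1)] xz[OF u(1)] e1[OF coords_Vq[OF tX u(1)]] by blast
    next
      fix w :: "'k vec" assume w: "w \<in> hcomp Z k"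
      \<comment> \<open>Preimages are chosen at every coordinate and glued by surjectivity of the
        coordinates of \<open>Y\<close>.\<close>
      have "\<forall>q. \<exists>v. v \<in> Vq n L' q k \<and> ?D v = ?Z k w q" using e2[OF coords_Vq[OF tZ w]] by blast
      then obtain v where v: "\<And>q. v q \<in> Vq n L' q k \<and> ?D (v q) = ?Z k w q" by metis
      then have "v \<in> Cs n L' k" by (auto simp: Cs_def)
      then obtain y where y: "y \<in> hcomp Y k" "?Y k y = v" using coord_surj[OF cY] by blast
      have "g k *\<^sub>v y = w" using v by (subst geq[OF y(1) w]) (simp add: y(2))
      then show "\<exists>v\<in>hcomp Y k. g k *\<^sub>v v = w" using y(1) by blast
    next
      fix v :: "'k vec" assume v: "v \<in> hcomp Y k"
      show "g k *\<^sub>v v = 0\<^sub>v (gdim Z k) \<longleftrightarrow> (\<exists>u \<in> hcomp X k. f k *\<^sub>v u = v)"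
      proof
        assume "g k *\<^sub>v v = 0\<^sub>v (gdim Z k)"
        then have "\<forall>q. \<exists>u. u \<in> Vq n L q k \<and> ?C u = ?Y k v q" using gz[OF v] e3[OF coords_Vq[OF tY v]] by blast
        then obtain u where u: "\<And>q. u q \<in> Vq n L q k \<and> ?C (u q) = ?Y k v q" by metis
        then have "u \<in> Cs n L k" by (auto simp: Cs_def)
        then obtain x where x: "x \<in> hcomp X k" "?X k x = u" using coord_surj[OF cX] by blast
        have "f k *\<^sub>v x = v" using u by (subst feq[OF x(1) v]) (simp add: x(2))
        then show "\<exists>u \<in> hcomp X k. f k *\<^sub>v u = v" using x(1) by blast
      next
        assume "\<exists>u \<in> hcomp X k. f k *\<^sub>v u = v"
        then obtain u where u: "u \<in> hcomp X k" "f k *\<^sub>v u = v" by blast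
        have "\<forall>q. ?D (?Y k v q) = (\<lambda>_. 0)"
          using e3[OF coords_Vq[OF tY v]] coords_Vq[OF tX u(1)] feq[OF u(1) v] u(2) by blast
        then show "g k *\<^sub>v v = 0\<^sub>v (gdim Z k)" using gz[OF v] by blast
      qed
    qed
    then show "ses n X Y Z f g" using CM hrep_hom[OF f] hrep_hom[OF g] unfolding ses_def by blast
  qed
qed


subsection \<open>Rank-one modules\<close>

text \<open>The inverse of \<open>pick S\<close>, which numbers the rows and columns of a
  \<open>submatrix\<close>.\<close>

definition posn :: "nat set \<Rightarrow> nat \<Rightarrow> nat" where
  "posn S q = card {x \<in> S. x < q}"

lemma bij_posn:
  assumes "finite S"
  shows "bij_betw (posn S) S {..<card S}"
proof (rule bij_betwI[where g="pick S"])
  show "posn S \<in> S \<rightarrow> {..<card S}"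
  proof
    fix q assume "q \<in> S"
    then have "{x \<in> S. x < q} \<subset> S" by auto
    then show "posn S q \<in> {..<card S}" using assms by (simp add: posn_def psubset_card_mono)
  qed
  show "pick S \<in> {..<card S} \<rightarrow> S" using pick_in_set_le by auto
  show "pick S (posn S q) = q" if "q \<in> S" for q using pick_card_in_set[OF that] by (simp add: posn_def)
  show "posn S (pick S i) = i" if "i \<in> {..<card S}" for i using that card_pick[of i S] by (simp add: posn_def)
qed

definition suppset :: "nat \<Rightarrow> int \<times> int \<Rightarrow> int \<Rightarrow> nat set" where
  "suppset n P k = {q. in_supp n P q k}"

text \<open>The module (a, b) described uniformly in a and b, without reducing them to the range
  from 1 to n as \<open>pmod\<close> does.\<close>

definition thin :: "nat \<Rightarrow> int \<times> int \<Rightarrow> 'k::field gmod" where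
  "thin n P = \<lparr> gdim = (\<lambda>k. card (suppset n P k)),
     gact = (\<lambda>m k A. submatrix A (suppset n P (m + k)) (suppset n P k)) \<rparr>"

lemma suppset_fin [simp]: "finite (suppset n P k)"
  by (rule finite_subset[of _ "{..<n}"]) (auto simp: suppset_def in_supp_def)

lemma suppset_lt: "q \<in> suppset n P k \<Longrightarrow> q < n"
  by (simp add: suppset_def in_supp_def)

text \<open>Levels lie between 0 and 2, so for c \<ge> 1 both sides hold for all q < n and for c
  \<le> -1 both fail; only c = 0 depends on \<open>\<alpha>\<close>. The next lemma is the analogue
  for odd degrees, where c = 0 depends on \<open>\<beta>\<close>.\<close>

lemma lev_even:
  assumes "1 \<le> \<alpha>" "\<alpha> < \<beta>" "\<alpha> \<le> int n"
  shows "q < n \<and> lev \<alpha> \<beta> q \<le> 2 * c \<longleftrightarrow> q < n \<and> int q + 1 \<le> \<alpha> + c * int n"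
proof -
  define d where "d = c * int n"
  consider "c = 0" "d = 0" | "c \<ge> 1" "d \<ge> int n" | "c \<le> -1" "d \<le> - int n"
    using mult_right_mono[of 1 c "int n"] mult_right_mono[of c "-1" "int n"] unfolding d_def
    by (cases "c = 0") (simp, linarith)
  then show ?thesis unfolding d_def[symmetric] using assms by cases (auto simp: lev_def)
qed

lemma lev_odd:
  assumes "1 \<le> \<alpha>" "\<alpha> < \<beta>" "\<beta> \<le> int n"
  shows "q < n \<and> lev \<alpha> \<beta> q \<le> 2 * c + 1 \<longleftrightarrow> q < n \<and> int q + 1 \<le> \<beta> + c * int n"
proof -
  define d where "d = c * int n"
  consider "c = 0" "d = 0" | "c \<ge> 1" "d \<ge> int n" | "c \<le> -1" "d \<le> - int n"
    using mult_right_mono[of 1 c "int n"] mult_right_mono[of c "-1" "int n"] unfolding d_def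
    by (cases "c = 0") (simp, linarith)
  then show ?thesis unfolding d_def[symmetric] using assms by cases (auto simp: lev_def)
qed

text \<open>\<open>k\<close> is the number of the block of \<open>n\<close> integers containing
  \<open>a\<close>. If \<open>b\<close> lies in the same block, the shift is even and parities
  agree. Otherwise \<open>b\<close> lies in the next block and the odd shift exchanges even and odd
  degrees, which is why the reduced \<open>b\<close> and the reduced \<open>a\<close> then appear in
  reverse order.\<close>

lemma pmod_thin:
  assumes n: "n > 0" and ab: "valid n (a, b)"
  shows "pmod n a b = thin n (a, b)"
proof -
  define k where "k = (a - 1) div int n"
  have kn: "k * int n + (a - 1) mod int n = a - 1" unfolding k_def by (rule div_mult_mod_eq)
  have r: "0 \<le> (a - 1) mod int n" "(a - 1) mod int n < int n" using n by auto
  have a0: "1 \<le> a - k * int n" "a - k * int n \<le> int n" using kn r by auto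
  have abn: "a < b" "b < a + int n" using ab by (auto simp: valid_def)
  have key: "{q. q < n \<and> lev (a - k * int n) (b - k * int n) q \<le> 2 * k + t} = suppset n (a, b) t" if le: "b - k * int n \<le> int n" for t
  proof (cases "even t")
    case True
    then obtain m where t: "t = 2 * m" by blast
    show ?thesis
      using lev_even[of "a - k * int n" "b - k * int n" n _ "k + m"] a0 abn
      by (auto simp: suppset_def in_supp_def t algebra_simps)
  next
    case False
    then obtain m where t: "t = 2 * m + 1" by (rule oddE)
    show ?thesis
      using lev_odd[of "a - k * int n" "b - k * int n" n _ "k + m"] a0 abn le
      by (auto simp: suppset_def in_supp_def t algebra_simps)
  qed
  \<comment> \<open>The shift is odd: even degrees \<open>t\<close> are governed by
    \<open>lev_odd\<close> and odd ones by \<open>lev_even\<close>, the latter with one more block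
    because 2k + 1 + t has carried over.\<close>
  have key2: "{q. q < n \<and> lev (b - (k + 1) * int n) (a - k * int n) q \<le> 2 * k + 1 + t} = suppset n (a, b) t" if le: "\<not> b - k * int n \<le> int n" for t
  proof (cases "even t")
    case True
    then obtain m where t: "t = 2 * m" by blast
    show ?thesis
      using lev_odd[of "b - (k + 1) * int n" "a - k * int n" n _ "k + m"] a0 abn le
      by (auto simp: suppset_def in_supp_def t algebra_simps)
  next
    case False
    then obtain m where t: "t = 2 * m + 1" by (rule oddE)
    show ?thesis
      using lev_even[of "b - (k + 1) * int n" "a - k * int n" n _ "k + m + 1"] a0 abn le
      by (auto simp: suppset_def in_supp_def t algebra_simps)
  qed
  have key': "{q. q < n \<and> lev (a - k * int n) (b - k * int n) q \<le> m + (2 * k + t)} = suppset n (a, b) (m + t)"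
    if "b - k * int n \<le> int n" for m t
    using key[OF that, of "m + t"] by (simp only: add.left_commute)
  have key2': "{q. q < n \<and> lev (b - (k + 1) * int n) (a - k * int n) q \<le> m + (2 * k + 1 + t)} = suppset n (a, b) (m + t)"
    if "\<not> b - k * int n \<le> int n" for m t
    using key2[OF that, of "m + t"] by (simp only: add.left_commute)
  show ?thesis
    unfolding pmod_def Let_def k_def[symmetric] shift_def basemod_def thin_def
    by (auto simp: fun_eq_iff key key2 key' key2')
qed

text \<open>\<open>\<Phi>\<close> reinserts the deleted coordinates as zeros. Restricting a matrix
  to the supports then agrees with the full action, because \<Lambda> never leads from inside the
  support to outside it.\<close>

lemma types_thin:
  fixes P :: "int \<times> int"
  assumes n: "n \<ge> 3" and P: "valid n P"
  shows "types n (thin n P :: 'k::field gmod) [P]"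
proof -
  let ?X = "thin n P :: 'k gmod"
  let ?S = "suppset n P"
  have gd: "gdim ?X k = card (?S k)" for k by (simp add: thin_def)
  have gact_carrier: "gact ?X m k A = submatrix A (?S (m + k)) (?S k)" for m k A by (simp add: thin_def)
  define \<Phi> where "\<Phi> k v q l = (if l = 0 \<and> in_supp n P q k then v $ posn (?S k) q else (0::'k))" for k v q and l :: nat
  have pos_lt: "posn (?S k) q < card (?S k)" if "in_supp n P q k" for q k
    using bij_betwE[OF bij_posn[OF suppset_fin[of n P k]]] that by (simp add: suppset_def)
  have pick_in: "in_supp n P (pick (?S k) i) k" if "i < card (?S k)" for i k
    using pick_in_set_le[OF that] by (auto simp: suppset_def)
  have pos_pick: "posn (?S k) (pick (?S k) i) = i" if "i < card (?S k)" for i k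
    using that card_pick[of i "?S k"] by (simp add: posn_def)
  have pick_pos: "pick (?S k) (posn (?S k) q) = q" if "in_supp n P q k" for q k
    using pick_card_in_set[of q "?S k"] that by (simp add: posn_def suppset_def)
  have "bij_betw (\<Phi> k) (hcomp ?X k) (Cs n [P] k)" for k
  proof (rule bij_betwI[where g="\<lambda>w. vec (card (?S k)) (\<lambda>i. w (pick (?S k) i) 0)"])
    show "\<Phi> k \<in> hcomp ?X k \<rightarrow> Cs n [P] k" by (auto simp: \<Phi>_def Cs_def Vq_def)
    show "(\<lambda>w. vec (card (?S k)) (\<lambda>i. w (pick (?S k) i) 0)) \<in> Cs n [P] k \<rightarrow> hcomp ?X k" by (simp add: gd)
    fix v :: "'k vec" assume v: "v \<in> hcomp ?X k"
    show "vec (card (?S k)) (\<lambda>i. \<Phi> k v (pick (?S k) i) 0) = v"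
      using v pick_in pos_pick by (intro eq_vecI) (auto simp: gd \<Phi>_def)
  next
    fix w :: "nat \<Rightarrow> nat \<Rightarrow> 'k" assume w: "w \<in> Cs n [P] k"
    show "\<Phi> k (vec (card (?S k)) (\<lambda>i. w (pick (?S k) i) 0)) = w"
    proof (intro ext)
      fix q l show "\<Phi> k (vec (card (?S k)) (\<lambda>i. w (pick (?S k) i) 0)) q l = w q l"
        using w pos_lt[of q k] pick_pos[of q k] by (auto simp: \<Phi>_def Cs_def Vq_def) force+
    qed
  qed
  moreover have "gact ?X m k A \<in> carrier_mat (gdim ?X (m + k)) (gdim ?X k)" if A: "A \<in> Lam n m" for m k A
  proof -
    have "{i. i < n \<and> i \<in> ?S k} = ?S k" for k by (auto dest: suppset_lt)
    then show ?thesis using Lam_carrier[OF A] by (auto simp: gact_carrier gd dim_submatrix)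
  qed
  moreover have "\<Phi> (m + k) (gact ?X m k A *\<^sub>v u) = act n A (\<Phi> k u)"
    if A: "A \<in> Lam n m" and u: "u \<in> hcomp ?X k" for m k A u
  proof (intro ext)
    fix p l
    have S: "{i. i < n \<and> i \<in> ?S k} = ?S k" for k by (auto dest: suppset_lt)
    show "\<Phi> (m + k) (gact ?X m k A *\<^sub>v u) p l = act n A (\<Phi> k u) p l"
    proof (cases "l = 0 \<and> in_supp n P p (m + k)")
      case True
      then have p: "p < n" and sp: "in_supp n P p (m + k)" by (auto simp: in_supp_def)
      have "\<Phi> (m + k) (gact ?X m k A *\<^sub>v u) p l = (\<Sum>j<card (?S k). A $$ (p, pick (?S k) j) * u $ j)"
        using True pos_lt[OF sp] Lam_carrier[OF A] u pick_pos[OF sp]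
        by (simp add: \<Phi>_def gact_carrier submatrix_def S scalar_prod_def gd atLeast0LessThan)
      also have "\<dots> = (\<Sum>q\<in>?S k. A $$ (p, pick (?S k) (posn (?S k) q)) * u $ posn (?S k) q)"
        by (rule sum.reindex_bij_betw[OF bij_posn[OF suppset_fin], symmetric])
      also have "\<dots> = (\<Sum>q\<in>?S k. A $$ (p, q) * \<Phi> k u q l)"
      proof (intro sum.cong refl)
        fix q assume "q \<in> ?S k"
        then have s: "in_supp n P q k" by (simp add: suppset_def)
        show "A $$ (p, pick (?S k) (posn (?S k) q)) * u $ posn (?S k) q = A $$ (p, q) * \<Phi> k u q l"
          using True s by (simp add: pick_pos[OF s] \<Phi>_def)
      qed
      also have "\<dots> = (\<Sum>q<n. A $$ (p, q) * \<Phi> k u q l)"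
        by (rule sum.mono_neutral_left) (auto simp: suppset_lt suppset_def \<Phi>_def)
      finally show ?thesis using p by (simp add: act_def)
    next
      case False
      \<comment> \<open>Outside the target support no term survives: by \<open>in_supp_act\<close>,
        either \<open>q\<close> is not in the source support or the entry of \<open>A\<close>
        vanishes.\<close>
      have "A $$ (p, q) * \<Phi> k u q l = 0" if "p < n" "q < n" for q
        using False that A in_supp_act[OF P, of q k p m] by (auto simp: \<Phi>_def Lam_def)
      then have "p < n \<Longrightarrow> (\<Sum>q<n. A $$ (p, q) * \<Phi> k u q l) = 0" by (intro sum.neutral) blast
      moreover have "\<Phi> (m + k) (gact ?X m k A *\<^sub>v u) p l = 0" using False by (auto simp: \<Phi>_def)
      ultimately show ?thesis by (simp add: act_def)
    qed
  qed
  ultimately have "coord n ?X [P] \<Phi>"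
    unfolding coord_def using P pos_lt by (auto simp: \<Phi>_def gd)
  then show ?thesis by (auto simp: types_def)
qed

text \<open>E_qq times a power of x keeps the support at \<open>q\<close> closed upwards in k, and
  it is bounded below and nonempty. Its least degree is the degree of a homogeneous basis
  element.\<close>

lemma in_supp_threshold:
  assumes n: "n \<ge> 3" and P: "valid n P" and q: "q < n"
  obtains e where "\<And>k. in_supp n P q k \<longleftrightarrow> e \<le> k"
proof -
  define N where "N = 2 * (\<bar>fst P\<bar> + \<bar>snd P\<bar> + 1)"
  have hi: "in_supp n P q k" if "k \<ge> N" for k using in_supp_high[OF q] that by (simp add: N_def)
  have lo: "\<not> in_supp n P q k" if "k \<le> - N" for k using in_supp_low[of n k P q] n that by (simp add: N_def)
  have up: "in_supp n P q k'" if "in_supp n P q k" "k \<le> k'" for k k'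
    using in_supp_act[OF P that(1) q, of "k' - k"] that(2) cexp_diag[of n q] n by simp
  define j where "j = (LEAST j::nat. in_supp n P q (int j - N))"
  have ex: "in_supp n P q (int (nat (2 * N)) - N)" using hi lo by (cases "N \<ge> 0") auto
  have j1: "in_supp n P q (int j - N)" unfolding j_def by (rule LeastI[of "\<lambda>j. in_supp n P q (int j - N)", OF ex])
  have j2: "\<not> in_supp n P q (int i - N)" if "i < j" for i using not_less_Least[of i "\<lambda>j. in_supp n P q (int j - N)"] that by (simp add: j_def)
  have "in_supp n P q k \<longleftrightarrow> int j - N \<le> k" for k
  proof
    assume s: "in_supp n P q k"
    then have "k + N \<ge> 0" using lo[of k] by linarith
    then obtain i where "k = int i - N" by (metis add_diff_cancel_right' nonneg_int_cases)
    then show "int j - N \<le> k" using j2[of i] s by force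
  qed (use up[OF j1] in auto)
  then show thesis by (rule that)
qed

text \<open>The filtered list enumerates \<open>S\<close> in increasing order, so its entry
  \<open>i\<close> has exactly \<open>i\<close> predecessors in \<open>S\<close>. This puts the
  columns in \<open>thin_CM\<close> in the order of an identity matrix.\<close>

lemma posn_filter:
  assumes "i < length (filter (\<lambda>q. q \<in> S) [0..<n])" and S: "S \<subseteq> {..<n}"
  shows "posn S (filter (\<lambda>q. q \<in> S) [0..<n] ! i) = i"
proof -
  let ?xs = "filter (\<lambda>q. q \<in> S) [0..<n]"
  have st: "sorted_wrt (<) ?xs" by (rule sorted_wrt_filter) (rule sorted_wrt_upt)
  have set: "set ?xs = S" using S by auto
  have "{x \<in> S. x < ?xs ! i} = (!) ?xs ` {..<i}"
  proof (intro equalityI subsetI)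
    fix x assume "x \<in> {x \<in> S. x < ?xs ! i}"
    then have "x \<in> set ?xs" "x < ?xs ! i" using set by auto
    then obtain j where j: "j < length ?xs" "x = ?xs ! j" "?xs ! j < ?xs ! i" by (metis in_set_conv_nth)
    then have "j < i" using sorted_wrt_nth_less[OF st, of i j] assms(1) by (metis linorder_neqE_nat order_less_asym)
    then show "x \<in> (!) ?xs ` {..<i}" using j by auto
  next
    fix x assume "x \<in> (!) ?xs ` {..<i}"
    then obtain j where j: "j < i" "x = ?xs ! j" by auto
    then have "x < ?xs ! i" using sorted_wrt_nth_less[OF st j(1) assms(1)] by simp
    moreover have "x \<in> set ?xs" using j assms(1) by (metis nth_mem order_less_trans)
    ultimately show "x \<in> {x \<in> S. x < ?xs ! i}" using set by auto
  qed
  moreover have "inj_on ((!) ?xs) {..<i}"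
    using assms(1) by (intro inj_onI) (auto simp: nth_eq_iff_index_eq[OF distinct_filter[OF distinct_upt]] simp del: distinct_upt)
  ultimately show ?thesis by (simp add: posn_def card_image)
qed

lemma invertible_one: "invertible_mat (1\<^sub>m d :: 'k::field mat)"
  unfolding invertible_mat_def inverts_mat_def by (auto intro!: exI[of _ "1\<^sub>m d"])

text \<open>The basis has one vector for each coordinate \<open>q\<close>, in the first degree
  \<open>e q\<close> where \<open>q\<close> is supported. Powers of x carry it to the unit vector at
  \<open>q\<close>, so in each degree the matrix of columns is the identity.\<close>

lemma thin_CM:
  assumes n: "n \<ge> 3" and P: "valid n P"
  shows "is_CM n (thin n P :: 'k::field gmod)"
proof -
  let ?X = "thin n P :: 'k gmod"
  let ?S = "suppset n P"
  note t = types_thin[OF n P, where 'k='k]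
  have gd: "gdim ?X k = card (?S k)" for k by (simp add: thin_def)
  have "\<forall>q. \<exists>e. q < n \<longrightarrow> (\<forall>k. in_supp n P q k \<longleftrightarrow> e \<le> k)" using in_supp_threshold[OF n P] by metis
  then obtain e where e: "\<And>q k. q < n \<Longrightarrow> in_supp n P q k \<longleftrightarrow> e q \<le> k" by metis
  define b where "b q = (unit_vec (card (?S (e q))) (posn (?S (e q)) q) :: 'k vec)" for q
  have x: "xpow n ?X (k - e q) (e q) *\<^sub>v b q = unit_vec (card (?S k)) (posn (?S k) q)" if q: "q < n" "e q \<le> k" for q k
  proof -
    have S: "{i. i < n \<and> i \<in> ?S k} = ?S k" for k by (auto dest: suppset_lt)
    have qe: "q \<in> ?S (e q)" and qk: "q \<in> ?S k" using e q by (auto simp: suppset_def)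
    have p1: "posn (?S (e q)) q < card (?S (e q))" "posn (?S k) q < card (?S k)"
      using bij_betwE[OF bij_posn[OF suppset_fin[of n P "e q"]]] bij_betwE[OF bij_posn[OF suppset_fin[of n P k]]] qe qk by auto
    have pk: "pick (?S (e q)) (posn (?S (e q)) q) = q"
      using pick_card_in_set[OF qe] by (simp add: posn_def)
    show ?thesis
    proof (rule eq_vecI)
      fix i assume "i < dim_vec (unit_vec (card (?S k)) (posn (?S k) q) :: 'k vec)"
      then have i: "i < card (?S k)" by simp
      have pi: "pick (?S k) i \<in> ?S k" using pick_in_set_le[OF i] .
      have "(xpow n ?X (k - e q) (e q) *\<^sub>v b q) $ i = 1\<^sub>m n $$ (pick (?S k) i, q)"
        using i p1 pk by (simp add: xpow_def thin_def b_def submatrix_def S)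
      also have "\<dots> = (if pick (?S k) i = q then 1 else 0)" using suppset_lt[OF pi] q by simp
      also have "\<dots> = unit_vec (card (?S k)) (posn (?S k) q) $ i"
        using i p1 pick_card_in_set[OF qk] card_pick[of i "?S k"] by (auto simp: posn_def)
      finally show "(xpow n ?X (k - e q) (e q) *\<^sub>v b q) $ i = (unit_vec (card (?S k)) (posn (?S k) q) :: 'k vec) $ i" .
    qed (simp add: xpow_def thin_def dim_submatrix S)
  qed
  have "let vs = [xpow n ?X (k - e l) (e l) *\<^sub>v b l. l \<leftarrow> filter (\<lambda>l. e l \<le> k) [0..<n]]
             in length vs = gdim ?X k \<and> invertible_mat (mat_of_cols (gdim ?X k) vs)" for k
  proof -
    have S: "?S k \<subseteq> {..<n}" by (auto intro: suppset_lt)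
    have fe: "filter (\<lambda>l. e l \<le> k) [0..<n] = filter (\<lambda>q. q \<in> ?S k) [0..<n]"
      by (rule filter_cong) (auto simp: e suppset_def)
    let ?xs = "filter (\<lambda>q. q \<in> ?S k) [0..<n]"
    have vs: "[xpow n ?X (k - e l) (e l) *\<^sub>v b l. l \<leftarrow> filter (\<lambda>l. e l \<le> k) [0..<n]] =
        [unit_vec (card (?S k)) (posn (?S k) q). q \<leftarrow> ?xs]"
      unfolding fe by (intro map_cong refl x) (auto simp: suppset_def e)
    have "set ?xs = ?S k" using S by auto
    then have len: "length ?xs = card (?S k)" by (metis distinct_card distinct_filter distinct_upt)
    have "mat_of_cols (card (?S k)) [unit_vec (card (?S k)) (posn (?S k) q). q \<leftarrow> ?xs] = (1\<^sub>m (card (?S k)) :: 'k mat)"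
    proof (rule eq_matI)
      fix i j assume "i < dim_row (1\<^sub>m (card (?S k)) :: 'k mat)" "j < dim_col (1\<^sub>m (card (?S k)) :: 'k mat)"
      then have ij: "i < card (?S k)" "j < card (?S k)" by auto
      show "mat_of_cols (card (?S k)) [unit_vec (card (?S k)) (posn (?S k) q). q \<leftarrow> ?xs] $$ (i, j) = (1\<^sub>m (card (?S k)) :: 'k mat) $$ (i, j)"
        using ij len posn_filter[OF _ S, of j] by (auto simp: mat_of_cols_index)
    qed (auto simp: len)
    then show ?thesis unfolding vs using len invertible_one by (simp add: Let_def gd)
  qed
  moreover have "\<forall>l<n. b l \<in> hcomp ?X (e l)" by (simp add: b_def gd)
  ultimately show ?thesis unfolding is_CM_def using types_gmod[OF n t] by blast
qed

lemma types_pmod: "n \<ge> 3 \<Longrightarrow> valid n (a, b) \<Longrightarrow> types n (pmod n a b) [(a, b)]"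
  by (simp add: pmod_thin types_thin)

lemma pmod_CM: "n \<ge> 3 \<Longrightarrow> valid n (a, b) \<Longrightarrow> is_CM n (pmod n a b)"
  by (simp add: pmod_thin thin_CM)


subsection \<open>Direct sums\<close>

lemma vec_first_append: "u \<in> carrier_vec d \<Longrightarrow> vec_first (u @\<^sub>v v) d = u"
  by (auto simp: vec_first_def)

lemma vec_last_append: "v \<in> carrier_vec d \<Longrightarrow> vec_last (u @\<^sub>v v) d = v"
  by (auto simp: vec_last_def)

lemma types_dsum:
  fixes X Y :: "'k::field gmod"
  assumes X: "types n X L1" and Y: "types n Y L2"
  shows "types n (dsum X Y) (L1 @ L2)"
proof -
  note cX = types_coord[OF X] and cY = types_coord[OF Y]
  let ?F = "coords n X L1" and ?G = "coords n Y L2"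
  let ?D = "dsum X Y"
  have gd: "gdim ?D k = gdim X k + gdim Y k" for k by (simp add: dsum_def)
  define join where "join f g q l = (if l < length L1 then f q l else g q (l - length L1))" for f g :: "nat \<Rightarrow> nat \<Rightarrow> 'k" and q l
  define \<Phi> where "\<Phi> k v = join (?F k (vec_first v (gdim X k))) (?G k (vec_last v (gdim Y k)))" for k v
  have ap: "\<Phi> k (u @\<^sub>v v) = join (?F k u) (?G k v)" if "u \<in> hcomp X k" "v \<in> hcomp Y k" for k u v
    using that by (simp add: \<Phi>_def vec_first_append vec_last_append)
  have spl: "\<exists>a\<in>hcomp X k. \<exists>b\<in>hcomp Y k. v = a @\<^sub>v b" if "v \<in> hcomp ?D k" for k v
    using that vec_first_last_append[of v "gdim X k" "gdim Y k"] unfolding gd by (metis vec_first_carrier vec_last_carrier)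
  have join_Cs: "join f g \<in> Cs n (L1 @ L2) k" if "f \<in> Cs n L1 k" "g \<in> Cs n L2 k" for f g k
    using that by (fastforce simp: join_def Cs_def Vq_def nth_append)
  have "bij_betw (\<Phi> k) (hcomp ?D k) (Cs n (L1 @ L2) k)" for k
  proof (rule bij_betwI')
    fix u v :: "'k vec" assume "u \<in> hcomp ?D k" "v \<in> hcomp ?D k"
    then obtain a b c d where ab: "a \<in> hcomp X k" "b \<in> hcomp Y k" "u = a @\<^sub>v b"
      and cd: "c \<in> hcomp X k" "d \<in> hcomp Y k" "v = c @\<^sub>v d" using spl by metis
    show "\<Phi> k u = \<Phi> k v \<longleftrightarrow> u = v"
    proof
      assume "\<Phi> k u = \<Phi> k v"
      then have e: "join (?F k a) (?G k b) q l = join (?F k c) (?G k d) q l" for q l using ab cd ap by simp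
      have "?F k a q l = ?F k c q l" for q l
        using e[of q l] Cs_outside2[OF coord_in[OF cX ab(1)], of l q] Cs_outside2[OF coord_in[OF cX cd(1)], of l q]
        by (cases "l < length L1") (auto simp: join_def)
      moreover have "?G k b q l = ?G k d q l" for q l
        using e[of q "length L1 + l"] by (auto simp: join_def)
      ultimately have "?F k a = ?F k c" "?G k b = ?G k d" by (intro ext, blast)+
      then show "u = v" using coord_inj[OF cX ab(1) cd(1)] coord_inj[OF cY ab(2) cd(2)] ab cd by simp
    qed simp
  next
    fix u :: "'k vec" assume "u \<in> hcomp ?D k"
    then obtain a b where ab: "a \<in> hcomp X k" "b \<in> hcomp Y k" "u = a @\<^sub>v b" using spl by metis
    show "\<Phi> k u \<in> Cs n (L1 @ L2) k" using ap[OF ab(1,2)] ab(3) join_Cs[OF coord_in[OF cX ab(1)] coord_in[OF cY ab(2)]] by simp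
  next
    fix w :: "nat \<Rightarrow> nat \<Rightarrow> 'k" assume w: "w \<in> Cs n (L1 @ L2) k"
    have W: "l < length L1 + length L2 \<and> in_supp n ((L1 @ L2) ! l) q k" if "w q l \<noteq> 0" for q l
      using w that by (auto simp: Cs_def Vq_def)
    have "(\<lambda>q l. if l < length L1 then w q l else 0) \<in> Cs n L1 k"
      using W by (fastforce simp: Cs_def Vq_def nth_append)
    moreover have "(\<lambda>q l. w q (length L1 + l)) \<in> Cs n L2 k"
      using W[of _ "length L1 + _"] by (auto simp: Cs_def Vq_def nth_append_length_plus)
    ultimately
    obtain a b where ab: "a \<in> hcomp X k" "?F k a = (\<lambda>q l. if l < length L1 then w q l else 0)"
      "b \<in> hcomp Y k" "?G k b = (\<lambda>q l. w q (length L1 + l))"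
      using coord_surj[OF cX] coord_surj[OF cY] by meson
    then have "\<Phi> k (a @\<^sub>v b) = w" using ap[OF ab(1,3)] by (auto simp: join_def fun_eq_iff)
    moreover have "a @\<^sub>v b \<in> hcomp ?D k" using ab unfolding gd by simp
    ultimately show "\<exists>x\<in>hcomp ?D k. w = \<Phi> k x" by metis
  qed
  moreover have "\<Phi> k (u + v) q l = \<Phi> k u q l + \<Phi> k v q l"
    if "u \<in> hcomp ?D k" "v \<in> hcomp ?D k" for k u v q l
  proof -
    from that obtain a b c d where ab: "a \<in> hcomp X k" "b \<in> hcomp Y k" "u = a @\<^sub>v b"
      and cd: "c \<in> hcomp X k" "d \<in> hcomp Y k" "v = c @\<^sub>v d" using spl by metis
    have "u + v = (a + c) @\<^sub>v (b + d)" unfolding ab cd by (rule append_vec_add[OF ab(1) cd(1) ab(2) cd(2)])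
    then show ?thesis using ab cd coord_add[OF cX ab(1) cd(1)] coord_add[OF cY ab(2) cd(2)]
      by (simp add: ap join_def)
  qed
  moreover have "\<Phi> k (c \<cdot>\<^sub>v u) q l = c * \<Phi> k u q l" if "u \<in> hcomp ?D k" for k u q l c
  proof -
    from that obtain a b where ab: "a \<in> hcomp X k" "b \<in> hcomp Y k" "u = a @\<^sub>v b" using spl by metis
    have "c \<cdot>\<^sub>v u = (c \<cdot>\<^sub>v a) @\<^sub>v (c \<cdot>\<^sub>v b)" unfolding ab by (intro eq_vecI) auto
    then show ?thesis using ab coord_smult[OF cX ab(1)] coord_smult[OF cY ab(2)]
      by (simp add: ap join_def)
  qed
  moreover have "gact ?D m k A \<in> carrier_mat (gdim ?D (m + k)) (gdim ?D k)" if A: "A \<in> Lam n m" for m k A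
    using coord_gact[OF cX A, of k] coord_gact[OF cY A, of k] by (auto simp: dsum_def)
  moreover have "\<Phi> (m + k) (gact ?D m k A *\<^sub>v u) = act n A (\<Phi> k u)"
    if A: "A \<in> Lam n m" and u: "u \<in> hcomp ?D k" for m k A u
  proof -
    from u obtain a b where ab: "a \<in> hcomp X k" "b \<in> hcomp Y k" "u = a @\<^sub>v b" using spl by metis
    note gX = coord_gact[OF cX A, of k] and gY = coord_gact[OF cY A, of k]
    have va: "gact X m k A *\<^sub>v a \<in> hcomp X (m + k)" "gact Y m k A *\<^sub>v b \<in> hcomp Y (m + k)"
      using gX gY ab by auto
    have z: "0\<^sub>m r c *\<^sub>v v = 0\<^sub>v r" if "v \<in> carrier_vec c" for r c and v :: "'k vec" using that by (intro eq_vecI) auto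
    have "gact ?D m k A *\<^sub>v u = (gact X m k A *\<^sub>v a) @\<^sub>v (gact Y m k A *\<^sub>v b)"
      unfolding ab dsum_def
      using four_block_mat_mult_vec[OF gX zero_carrier_mat zero_carrier_mat gY ab(1,2)] va ab by (simp add: z)
    then have "\<Phi> (m + k) (gact ?D m k A *\<^sub>v u) = join (act n A (?F k a)) (act n A (?G k b))"
      using ap[OF va] coord_act[OF cX A ab(1)] coord_act[OF cY A ab(2)] by simp
    also have "\<dots> = act n A (join (?F k a) (?G k b))"
      by (intro ext) (auto simp: join_def act_def)
    finally show ?thesis using ap[OF ab(1,2)] ab(3) by simp
  qed
  ultimately have "coord n ?D (L1 @ L2) \<Phi>"
    using coord_valid[OF cX] coord_valid[OF cY] unfolding coord_def by auto
  then show ?thesis by (auto simp: types_def)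
qed

lemma invertible_block:
  fixes A D :: "'k::field mat"
  assumes A: "A \<in> carrier_mat r r" "invertible_mat A" and D: "D \<in> carrier_mat s s" "invertible_mat D"
  shows "invertible_mat (four_block_mat A (0\<^sub>m r s) (0\<^sub>m s r) D)"
proof -
  have ex: "\<exists>B \<in> carrier_mat r r. A * B = 1\<^sub>m r \<and> B * A = 1\<^sub>m r" if A: "A \<in> carrier_mat r r" "invertible_mat A" for A :: "'k mat" and r
  proof -
    obtain B where B: "A * B = 1\<^sub>m (dim_row A)" "B * A = 1\<^sub>m (dim_row B)"
      using A(2) unfolding invertible_mat_def inverts_mat_def by blast
    have "dim_col (A * B) = dim_row A" "dim_col (B * A) = dim_row B" unfolding B by auto
    then have "B \<in> carrier_mat r r" using A by auto
    then show ?thesis using B A by auto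
  qed
  obtain A' where A': "A' \<in> carrier_mat r r" "A * A' = 1\<^sub>m r" "A' * A = 1\<^sub>m r" using ex[OF A] by blast
  obtain D' where D': "D' \<in> carrier_mat s s" "D * D' = 1\<^sub>m s" "D' * D = 1\<^sub>m s" using ex[OF D] by blast
  let ?M = "four_block_mat A (0\<^sub>m r s) (0\<^sub>m s r) D" and ?N = "four_block_mat A' (0\<^sub>m r s) (0\<^sub>m s r) D'"
  have M: "?M \<in> carrier_mat (r + s) (r + s)" and N: "?N \<in> carrier_mat (r + s) (r + s)" using A D A' D' by auto
  have "?M * ?N = 1\<^sub>m (r + s)" "?N * ?M = 1\<^sub>m (r + s)"
    using A(1) D(1) A' D' by (simp_all add: mult_four_block_mat[of _ r r _ s _ s _ _ r _ s])
  then show ?thesis using M N A(1) D(1) A'(1) D'(1)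
    unfolding invertible_mat_def inverts_mat_def by (auto intro!: exI[of _ ?N])
qed

definition hbasis :: "nat \<Rightarrow> 'k::field gmod \<Rightarrow> nat \<Rightarrow> (nat \<Rightarrow> int) \<Rightarrow> (nat \<Rightarrow> 'k vec) \<Rightarrow> bool" where
  "hbasis n X r e b \<longleftrightarrow> (\<forall>l<r. b l \<in> hcomp X (e l)) \<and>
    (\<forall>k. length (filter (\<lambda>l. e l \<le> k) [0..<r]) = gdim X k) \<and>
    (\<forall>k. invertible_mat (mat_of_cols (gdim X k) [xpow n X (k - e l) (e l) *\<^sub>v b l. l \<leftarrow> filter (\<lambda>l. e l \<le> k) [0..<r]]))"

lemma CM_iff_hbasis: "is_CM n X \<longleftrightarrow> is_gmod n X \<and> (\<exists>r e b. hbasis n X r e b)"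
  by (simp add: is_CM_def hbasis_def Let_def all_conj_distrib)

text \<open>The two bases are concatenated. In each degree the vectors coming from \<open>X\<close>
  precede those from \<open>Y\<close>, so the matrix of columns is block diagonal with invertible
  blocks.\<close>

lemma dsum_CM:
  fixes X Y :: "'k::field gmod"
  assumes n: "n \<ge> 3" and tX: "types n X L1" and tY: "types n Y L2" and X: "is_CM n X" and Y: "is_CM n Y"
  shows "is_CM n (dsum X Y)"
proof -
  let ?D = "dsum X Y"
  have gd: "gdim ?D k = gdim X k + gdim Y k" for k by (simp add: dsum_def)
  have gm: "is_gmod n ?D" by (rule types_gmod[OF n types_dsum[OF tX tY]])
  obtain r1 e1 b1 where h1: "hbasis n X r1 e1 b1" using X by (auto simp: CM_iff_hbasis)
  have b1: "\<And>l. l < r1 \<Longrightarrow> b1 l \<in> hcomp X (e1 l)"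
    and l1: "\<And>k. length (filter (\<lambda>l. e1 l \<le> k) [0..<r1]) = gdim X k"
    and v1: "\<And>k. invertible_mat (mat_of_cols (gdim X k) [xpow n X (k - e1 l) (e1 l) *\<^sub>v b1 l. l \<leftarrow> filter (\<lambda>l. e1 l \<le> k) [0..<r1]])"
    using h1 by (simp_all add: hbasis_def)
  obtain r2 e2 b2 where h2: "hbasis n Y r2 e2 b2" using Y by (auto simp: CM_iff_hbasis)
  have b2: "\<And>l. l < r2 \<Longrightarrow> b2 l \<in> hcomp Y (e2 l)"
    and l2: "\<And>k. length (filter (\<lambda>l. e2 l \<le> k) [0..<r2]) = gdim Y k"
    and v2: "\<And>k. invertible_mat (mat_of_cols (gdim Y k) [xpow n Y (k - e2 l) (e2 l) *\<^sub>v b2 l. l \<leftarrow> filter (\<lambda>l. e2 l \<le> k) [0..<r2]])"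
    using h2 by (simp_all add: hbasis_def)
  define e where "e l = (if l < r1 then e1 l else e2 (l - r1))" for l
  define b where "b l = (if l < r1 then b1 l @\<^sub>v 0\<^sub>v (gdim Y (e1 l)) else 0\<^sub>v (gdim X (e2 (l - r1))) @\<^sub>v b2 (l - r1))" for l
  have bc: "b l \<in> hcomp ?D (e l)" if "l < r1 + r2" for l
    using b1[of l] b2[of "l - r1"] that by (auto simp: b_def e_def gd)
  have z: "0\<^sub>m r c *\<^sub>v v = 0\<^sub>v r" if "v \<in> carrier_vec c" for r c and v :: "'k vec" using that by (intro eq_vecI) auto
  have z': "A *\<^sub>v 0\<^sub>v c = 0\<^sub>v r" if "A \<in> carrier_mat r c" for r c and A :: "'k mat" using that by (intro eq_vecI) auto
  have one: "(1\<^sub>m n :: 'k mat) \<in> Lam n (k - m)" if "m \<le> k" for m k by (rule Lam_one[OF n]) (use that in simp)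
  have xc: "xpow n X (k - m) m \<in> carrier_mat (gdim X k) (gdim X m)" "xpow n Y (k - m) m \<in> carrier_mat (gdim Y k) (gdim Y m)" if "m \<le> k" for m k
    using coord_gact[OF types_coord[OF tX] one[OF that], of m] coord_gact[OF types_coord[OF tY] one[OF that], of m] by (auto simp: xpow_def)
  have xD: "xpow n ?D (k - m) m *\<^sub>v (u @\<^sub>v v) = (xpow n X (k - m) m *\<^sub>v u) @\<^sub>v (xpow n Y (k - m) m *\<^sub>v v)"
    if "m \<le> k" "u \<in> hcomp X m" "v \<in> hcomp Y m" for k m u v
    using four_block_mat_mult_vec[OF xc(1)[OF that(1)] zero_carrier_mat zero_carrier_mat xc(2)[OF that(1)] that(2,3)]
      mult_mat_vec_carrier[OF xc(1)[OF that(1)] that(2)] mult_mat_vec_carrier[OF xc(2)[OF that(1)] that(3)] that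
    by (simp add: xpow_def dsum_def z)
  have "let vs = [xpow n ?D (k - e l) (e l) *\<^sub>v b l. l \<leftarrow> filter (\<lambda>l. e l \<le> k) [0..<r1 + r2]]
             in length vs = gdim ?D k \<and> invertible_mat (mat_of_cols (gdim ?D k) vs)" for k
  proof -
    let ?vs = "[xpow n ?D (k - e l) (e l) *\<^sub>v b l. l \<leftarrow> filter (\<lambda>l. e l \<le> k) [0..<r1 + r2]]"
    let ?f1 = "filter (\<lambda>l. e1 l \<le> k) [0..<r1]" and ?f2 = "filter (\<lambda>l. e2 l \<le> k) [0..<r2]"
    let ?v1 = "[xpow n X (k - e1 l) (e1 l) *\<^sub>v b1 l. l \<leftarrow> ?f1]" and ?v2 = "[xpow n Y (k - e2 l) (e2 l) *\<^sub>v b2 l. l \<leftarrow> ?f2]"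
    have sp1: "[0..<r1 + r2] = [0..<r1] @ map (\<lambda>i. i + r1) [0..<r2]"
      by (metis map_add_upt add.commute upt_add_eq_append zero_le)
    have fl: "filter (\<lambda>l. e l \<le> k) [0..<r1 + r2] = ?f1 @ map (\<lambda>i. i + r1) ?f2"
      unfolding sp1 filter_append filter_map by (auto simp: e_def o_def intro!: filter_cong)
    have vs: "?vs = map (\<lambda>v. v @\<^sub>v 0\<^sub>v (gdim Y k)) ?v1 @ map (\<lambda>v. 0\<^sub>v (gdim X k) @\<^sub>v v) ?v2"
      unfolding fl map_append map_map
      using b1 b2 by (auto simp: e_def b_def o_def xD z'[OF xc(2)] z'[OF xc(1)])
    note l1 = l1[of k] and l2 = l2[of k]
    have v1c: "?v1 ! j \<in> hcomp X k" if "j < gdim X k" for j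
    proof -
      have "?f1 ! j \<in> set ?f1" using that l1 by (metis nth_mem)
      then show ?thesis using that l1 b1 xc(1)[of "e1 (?f1 ! j)" k] by simp
    qed
    have v2c: "?v2 ! j \<in> hcomp Y k" if "j < gdim Y k" for j
    proof -
      have "?f2 ! j \<in> set ?f2" using that l2 by (metis nth_mem)
      then show ?thesis using that l2 b2 xc(2)[of "e2 (?f2 ! j)" k] by simp
    qed
    define V1 where "V1 = ?v1"
    define V2 where "V2 = ?v2"
    have lv1: "length V1 = gdim X k" and lv2: "length V2 = gdim Y k" using l1 l2 by (simp_all add: V1_def V2_def)
    note V1c = v1c[folded V1_def] and V2c = v2c[folded V2_def] and vs' = vs[folded V1_def V2_def]
    have M1: "mat_of_cols (gdim X k) V1 \<in> carrier_mat (gdim X k) (gdim X k)" and M2: "mat_of_cols (gdim Y k) V2 \<in> carrier_mat (gdim Y k) (gdim Y k)"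
      using lv1 lv2 by (simp_all add: carrier_matI)
    have "mat_of_cols (gdim ?D k) ?vs = four_block_mat (mat_of_cols (gdim X k) V1) (0\<^sub>m (gdim X k) (gdim Y k)) (0\<^sub>m (gdim Y k) (gdim X k)) (mat_of_cols (gdim Y k) V2)"
      (is "?L = ?R")
    proof (rule eq_matI)
      fix i j assume "i < dim_row ?R" "j < dim_col ?R"
      then have ij: "i < gdim X k + gdim Y k" "j < gdim X k + gdim Y k" using lv1 lv2 by auto
      have lv: "j < length ?vs" unfolding vs' using ij lv1 lv2 by simp
      have "?L $$ (i, j) = ?vs ! j $ i" using ij lv by (simp add: mat_of_cols_index gd)
      also have "\<dots> = ?R $$ (i, j)"
      proof (cases "j < gdim X k")
        case True
        then have "?vs ! j = V1 ! j @\<^sub>v 0\<^sub>v (gdim Y k)" unfolding vs' using lv1 by (simp add: nth_append)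
        then show ?thesis using True ij V1c[OF True] lv1 lv2 by (simp add: mat_of_cols_index)
      next
        case False
        then have j: "j - gdim X k < gdim Y k" using ij by simp
        have "?vs ! j = 0\<^sub>v (gdim X k) @\<^sub>v V2 ! (j - gdim X k)" unfolding vs' using lv1 lv2 False j by (simp add: nth_append)
        then show ?thesis using False ij V2c[OF j] lv1 lv2 j by (simp add: mat_of_cols_index)
      qed
      finally show "?L $$ (i, j) = ?R $$ (i, j)" .
    next
      show "dim_row ?L = dim_row ?R" by (simp add: gd)
      have "length ?vs = gdim X k + gdim Y k" unfolding vs' using lv1 lv2 by simp
      then show "dim_col ?L = dim_col ?R" using lv1 lv2 by simp
    qed
    moreover have "invertible_mat ?R" by (rule invertible_block[OF M1 _ M2]) (use v1[of k] v2[of k] M2 in \<open>simp_all add: V1_def V2_def\<close>)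
    moreover have "length ?vs = gdim ?D k" unfolding vs' using lv1 lv2 by (simp add: gd)
    ultimately show ?thesis by (simp only: Let_def)
  qed
  then show ?thesis unfolding is_CM_def using gm bc by blast
qed

definition zero_gmod :: "'k::field gmod" where
  "zero_gmod = \<lparr> gdim = (\<lambda>k. 0), gact = (\<lambda>m k A. 0\<^sub>m 0 0) \<rparr>"

lemma types_zero_gmod: "types n (zero_gmod :: 'k::field gmod) []"
proof -
  have c: "carrier_vec 0 = {vec 0 (\<lambda>_. 0 :: 'k)}" by auto
  have "Cs n [] k = {\<lambda>_ _. 0 :: 'k}" for k by (auto simp: Cs_def Vq_def fun_eq_iff)
  then have "coord n (zero_gmod :: 'k gmod) [] (\<lambda>k v q l. 0)"
    by (auto simp: coord_def zero_gmod_def act_def fun_eq_iff bij_betw_def c)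
  then show ?thesis by (auto simp: types_def)
qed

lemma zero_gmod_CM: "n \<ge> 3 \<Longrightarrow> is_CM n (zero_gmod :: 'k::field gmod)"
proof -
  assume n: "n \<ge> 3"
  have "invertible_mat (mat_of_cols 0 [] :: 'k mat)"
    by (auto simp: invertible_mat_def inverts_mat_def intro!: exI[of _ "0\<^sub>m 0 0"])
  then show ?thesis unfolding is_CM_def using types_gmod[OF n types_zero_gmod]
    by (intro conjI exI[of _ 0]) (auto simp: zero_gmod_def)
qed

text \<open>Provides a Cohen-Macaulay complement with a prescribed list when one summand is split
  off.\<close>

definition thin_sum :: "nat \<Rightarrow> (int \<times> int) list \<Rightarrow> 'k::field gmod" where
  "thin_sum n L = foldr (\<lambda>P X. dsum (thin n P) X) L zero_gmod"

lemma thin_sum_types_CM: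
  assumes n: "n \<ge> 3" and v: "\<forall>P\<in>set L. valid n P"
  shows "types n (thin_sum n L :: 'k::field gmod) L \<and> is_CM n (thin_sum n L :: 'k gmod)"
  using v
proof (induction L)
  case Nil
  then show ?case by (simp add: thin_sum_def types_zero_gmod zero_gmod_CM[OF n])
next
  case (Cons P L)
  have e: "thin_sum n (P # L) = dsum (thin n P) (thin_sum n L :: 'k gmod)" by (simp add: thin_sum_def)
  have P: "valid n P" using Cons by simp
  show ?case unfolding e
    using types_dsum[OF types_thin[OF n P]] dsum_CM[OF n types_thin[OF n P] _ thin_CM[OF n P]] Cons by fastforce
qed


subsection \<open>A common adapted basis of two filtrations\<close>

lemma int_last:
  assumes "P (m::int)" "\<not> P m'" "\<And>u v. u \<le> v \<Longrightarrow> P v \<Longrightarrow> P u"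
  obtains a where "P a" "\<not> P (a + 1)"
proof -
  have "\<exists>a. P a \<and> \<not> P (a + 1)"
  proof (rule ccontr)
    assume "\<nexists>a. P a \<and> \<not> P (a + 1)"
    then have step: "P a \<Longrightarrow> P (a + 1)" for a by blast
    have "P k" if "k \<ge> m" for k using that assms(1) by (induction k rule: int_ge_induct) (auto intro: step)
    then have "P (max m m')" by simp
    then show False using assms(2) assms(3)[of m' "max m m'"] by simp
  qed
  then show thesis using that by blast
qed

text \<open>For independent \<open>w\<close>, the number \<open>a l\<close> is the last index at
  which the filtration still contains \<open>w l\<close>.\<close>

definition adapted :: "('b set \<Rightarrow> 'b set) \<Rightarrow> (int \<Rightarrow> 'b set) \<Rightarrow> nat \<Rightarrow> (nat \<Rightarrow> 'b) \<Rightarrow> (nat \<Rightarrow> int) \<Rightarrow> bool" where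
  "adapted spn A s w a \<longleftrightarrow> (\<forall>u. A u = spn (w ` {l. l < s \<and> u \<le> a l}))"

context vector_space
begin

text \<open>The modular law for the line through \<open>v\<close>: an element of \<open>C\<close>
  differs from an element of \<open>span T\<close> by a multiple of \<open>v\<close>, and the
  difference stays in \<open>C\<close> because \<open>v\<close> does.\<close>

lemma subspace_split:
  assumes C: "subspace C" "C \<subseteq> span (insert v T)" "v \<in> C" and X: "span X = C \<inter> span T"
  shows "C = span (insert v X)"
proof
  show "C \<subseteq> span (insert v X)"
  proof
    fix x assume x: "x \<in> C"
    then obtain k where k: "x - scale k v \<in> span T" using C(2) by (auto simp: span_insert)
    have "x - scale k v \<in> C" using C x by (intro subspace_diff subspace_scale)
    then have "x - scale k v \<in> span X" using k X by blast
    then show "x \<in> span (insert v X)" by (auto simp: span_insert)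
  qed
  show "span (insert v X) \<subseteq> C"
  proof (rule span_minimal)
    have "X \<subseteq> span X" by (rule span_superset)
    then show "insert v X \<subseteq> C" using X C(3) by blast
  qed (rule C(1))
qed

text \<open>The common adapted basis is built one vector at a time: for the last index \<^term>\<open>a\<close> with
  \<^term>\<open>A a \<noteq> {0}\<close> and the last index \<^term>\<open>b\<close> with \<^term>\<open>A a \<inter> B b \<noteq> {0}\<close>, a nonzero vector of
  \<^term>\<open>A a \<inter> B b\<close> splits off, a complement being any hyperplane through \<^term>\<open>B (b + 1)\<close> avoiding it.\<close>

lemma two_filtrations:
  fixes A B :: "int \<Rightarrow> 'b set"
  assumes sub: "\<And>u. subspace (A u)" "\<And>u. subspace (B u)"
    and dec: "\<And>u v. u \<le> v \<Longrightarrow> A v \<subseteq> A u" "\<And>u v. u \<le> v \<Longrightarrow> B v \<subseteq> B u"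
    and low: "A lo = W" "B lo = W" and high: "A hi = {0}" "B hi = {0}"
    and le: "\<And>u. A u \<subseteq> W" "\<And>u. B u \<subseteq> W"
    and S: "finite S" "independent S" "W = span S"
  shows "\<exists>s w a b. inj_on w {..<s} \<and> independent (w ` {..<s}) \<and> adapted span A s w a \<and> adapted span B s w b"
  using assms
proof (induction "card S" arbitrary: S W A B rule: less_induct)
  case less
  show ?case
  proof (cases "S = {}")
    case True
    then have "W = {0}" using less.prems by simp
    then have "A u = {0}" "B u = {0}" for u
      using less.prems(9,10)[of u] subspace_0[OF less.prems(1)[of u]] subspace_0[OF less.prems(2)[of u]] by auto
    then show ?thesis by (intro exI[of _ 0]) (simp add: adapted_def independent_empty)
  next
    case False
    note sub = less.prems(1,2) and dec = less.prems(3,4) and low = less.prems(5,6) and high = less.prems(7,8)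
      and le = less.prems(9,10) and S = less.prems(11-13)
    from False obtain x where x: "x \<in> S" by blast
    then have x0: "x \<noteq> 0" using S dependent_zero by blast
    have xW: "x \<in> W" using x S span_base by blast
    \<comment> \<open>With \<open>a\<close> chosen last for \<open>A\<close>, the filtration
      \<open>A\<close> vanishes beyond \<open>a\<close>; the complement of \<open>v\<close> then
      only has to be compatible with \<open>B\<close>.\<close>
    obtain a where a: "A a \<noteq> {0}" "\<not> A (a + 1) \<noteq> {0}"
    proof (rule int_last[of "\<lambda>u. A u \<noteq> {0}" lo hi])
      show "A lo \<noteq> {0}" using low xW x0 by auto
      show "\<not> A hi \<noteq> {0}" using high by simp
      show "A u \<noteq> {0}" if "u \<le> v" "A v \<noteq> {0}" for u v
        using dec(1)[OF that(1)] that(2) subspace_0[OF sub(1)[of v]] by auto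
    qed
    obtain b where b: "A a \<inter> B b \<noteq> {0}" "\<not> A a \<inter> B (b + 1) \<noteq> {0}"
    proof (rule int_last[of "\<lambda>u. A a \<inter> B u \<noteq> {0}" lo hi])
      show "A a \<inter> B lo \<noteq> {0}" using low a(1) le(1)[of a] by (simp add: Int_absorb2)
      show "\<not> A a \<inter> B hi \<noteq> {0}" using high subspace_0[OF sub(1)[of a]] by auto
      show "A a \<inter> B u \<noteq> {0}" if "u \<le> v" "A a \<inter> B v \<noteq> {0}" for u v
        using dec(2)[OF that(1)] that(2) subspace_0[OF sub(2)[of v]] subspace_0[OF sub(1)[of a]] by blast
    qed
    obtain v where v: "v \<in> A a" "v \<in> B b" "v \<noteq> 0"
      using b(1) subspace_0[OF sub(1)[of a]] subspace_0[OF sub(2)[of b]] by blast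
    have vB: "v \<notin> B (b + 1)" using b(2) v by blast
    \<comment> \<open>A basis of \<open>B (b + 1)\<close> together with \<open>v\<close> is extended
      to a basis of \<open>W\<close>. Dropping \<open>v\<close> leaves a basis \<open>R\<close> of a
      hyperplane that contains \<open>B (b + 1)\<close> but not \<open>v\<close>.\<close>
    obtain T where T: "T \<subseteq> B (b + 1)" "independent T" "B (b + 1) \<subseteq> span T"
      using maximal_independent_subset by blast
    have "span T \<subseteq> B (b + 1)" by (rule span_minimal[OF T(1) sub(2)])
    then have "v \<notin> span T" using vB by blast
    then have indT: "independent (insert v T)" by (rule independent_insertI) (rule T)
    have "insert v T \<subseteq> W" using T le v by blast
    then obtain S' where S': "insert v T \<subseteq> S'" "S' \<subseteq> W" "independent S'" "W \<subseteq> span S'"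
      using maximal_independent_subset_extend indT by metis
    define R where "R = S' - {v}"
    have iS': "insert v R = S'" using S' by (auto simp: R_def)
    have vR: "v \<notin> span R" using S'(1,3) unfolding dependent_def R_def by blast
    have fS': "finite S'" "card S' \<le> card S" using independent_span_bound[OF S(1) S'(3)] S'(2) S(3) by auto
    have cR: "card R < card S" using fS' S'(1) card_Diff1_less[of S' v] by (auto simp: R_def)
    have RW: "span R \<subseteq> W" using S'(2) S(3) by (intro span_minimal) (auto simp: R_def)
    have indR: "independent R" using S'(3) by (rule independent_mono) (auto simp: R_def)
    have TR: "T \<subseteq> R" using S'(1) \<open>v \<notin> span T\<close> span_base by (auto simp: R_def)
    have WR: "C \<subseteq> span (insert v R)" if "C \<subseteq> W" for C using that S'(4) iS' by auto
    \<comment> \<open>The induction hypothesis is applied to both filtrations intersected with the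
      hyperplane.\<close>
    have ih: "\<exists>s w a b. inj_on w {..<s} \<and> independent (w ` {..<s}) \<and>
        adapted span (\<lambda>u. A u \<inter> span R) s w a \<and> adapted span (\<lambda>u. B u \<inter> span R) s w b"
    proof (rule less.hyps[OF cR])
      show "A lo \<inter> span R = span R" "B lo \<inter> span R = span R" using low RW by auto
      show "A hi \<inter> span R = {0}" "B hi \<inter> span R = {0}" using high span_zero by auto
    qed (use sub dec indR fS' in \<open>auto intro: subspace_inter simp: R_def subset_iff\<close>)
    then obtain s w a' b' where w: "inj_on w {..<s}" "independent (w ` {..<s})"
      "adapted span (\<lambda>u. A u \<inter> span R) s w a'" "adapted span (\<lambda>u. B u \<inter> span R) s w b'" by blast
    have wR: "w ` {..<s} \<subseteq> span R"
    proof safe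
      fix l assume l: "l < s"
      then have "w l \<in> span (w ` {j. j < s \<and> a' l \<le> a' j})" by (intro span_base) auto
      then show "w l \<in> span R" using w(3) by (auto simp: adapted_def)
    qed
    have vw: "v \<notin> span (w ` {..<s})" using vR span_minimal[OF wR subspace_span] by blast
    define w' where "w' = w(s := v)"
    have im: "w' ` {l. l < Suc s \<and> u \<le> (c(s := d)) l} =
        (if u \<le> d then insert v (w ` {l. l < s \<and> u \<le> c l}) else w ` {l. l < s \<and> u \<le> c l})" for u d and c :: "nat \<Rightarrow> int"
      by (auto simp: w'_def less_Suc_eq image_iff)
    have "inj_on w' {..<Suc s}"
      using w(1) vw span_base by (auto simp: w'_def inj_on_def less_Suc_eq)
    moreover have "independent (w' ` {..<Suc s})"
    proof -
      have "w' ` {..<Suc s} = insert v (w ` {..<s})" by (auto simp: w'_def less_Suc_eq image_iff)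
      then show ?thesis using independent_insertI[OF vw w(2)] by simp
    qed
    moreover have "adapted span A (Suc s) w' (a'(s := a))"
      unfolding adapted_def im
    proof
      fix u
      show "A u = span (if u \<le> a then insert v (w ` {l. l < s \<and> u \<le> a' l}) else w ` {l. l < s \<and> u \<le> a' l})"
      proof (cases "u \<le> a")
        case True
        have "v \<in> A u" using dec(1)[OF True] v by blast
        then show ?thesis using True subspace_split[OF sub(1) WR[OF le(1)]] w(3) by (simp add: adapted_def)
      next
        case False
        \<comment> \<open>Beyond \<open>a\<close> there is nothing left to split: \<open>A u\<close>
          is zero and so lies in the hyperplane.\<close>
        then have "A u \<subseteq> {0}" using dec(1)[of "a + 1" u] a(2) by auto
        then have "A u \<inter> span R = A u" using span_zero by auto
        then show ?thesis using False w(3) by (simp add: adapted_def)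
      qed
    qed
    moreover have "adapted span B (Suc s) w' (b'(s := b))"
      unfolding adapted_def im
    proof
      fix u
      show "B u = span (if u \<le> b then insert v (w ` {l. l < s \<and> u \<le> b' l}) else w ` {l. l < s \<and> u \<le> b' l})"
      proof (cases "u \<le> b")
        case True
        have "v \<in> B u" using dec(2)[OF True] v by blast
        then show ?thesis using True subspace_split[OF sub(2) WR[OF le(2)]] w(4) by (simp add: adapted_def)
      next
        case False
        \<comment> \<open>Here the choice of the hyperplane is used: beyond \<open>b\<close> the
          filtration \<open>B\<close> lies inside it.\<close>
        then have "B u \<subseteq> span R" using dec(2)[of "b + 1" u] T(3) span_mono[OF TR] by auto
        then have "B u \<inter> span R = B u" by auto
        then show ?thesis using False w(4) by (simp add: adapted_def)
      qed
    qed
    ultimately show ?thesis by blast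
  qed
qed

text \<open>Turns an inclusion between spans of basis vectors into a statement about indices; this
  is how the inclusions between A and B become inequalities.\<close>

lemma span_index:
  assumes "inj_on w {..<s}" "independent (w ` {..<s})" "l < s" "J \<subseteq> {..<s}" "w l \<in> span (w ` J)"
  shows "l \<in> J"
proof (rule ccontr)
  assume "l \<notin> J"
  then have "w ` J \<subseteq> w ` {..<s} - {w l}" using assms by (auto simp: inj_on_def)
  then have "w l \<in> span (w ` {..<s} - {w l})" using assms(5) span_mono by blast
  then show False using assms(2,3) unfolding dependent_def by blast
qed

end


subsection \<open>Every Cohen-Macaulay module has coordinates\<close>

text \<open>\<^term>\<open>cl k\<close> embeds the degree-\<open>k\<close> component of a module into the colimit along multiplication by \<open>x\<close>.\<close>

definition colim :: "nat \<Rightarrow> 'k::field gmod \<Rightarrow> nat \<Rightarrow> int \<Rightarrow> (int \<Rightarrow> 'k vec \<Rightarrow> nat \<Rightarrow> 'k) \<Rightarrow> bool" where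
  "colim n X r K cl \<longleftrightarrow>
    (\<forall>k. \<forall>v\<in>hcomp X k. \<forall>l. cl k v l \<noteq> 0 \<longrightarrow> l < r) \<and>
    (\<forall>k. \<forall>v\<in>hcomp X k. cl k v = (\<lambda>_. 0) \<longrightarrow> v = 0\<^sub>v (gdim X k)) \<and>
    (\<forall>k. \<forall>u\<in>hcomp X k. \<forall>v\<in>hcomp X k. cl k (u + v) = (\<lambda>l. cl k u l + cl k v l)) \<and>
    (\<forall>k c. \<forall>u\<in>hcomp X k. cl k (c \<cdot>\<^sub>v u) = (\<lambda>l. c * cl k u l)) \<and>
    (\<forall>k. \<forall>m\<ge>0. \<forall>v\<in>hcomp X k. cl (m + k) (gact X m k (1\<^sub>m n) *\<^sub>v v) = cl k v) \<and>
    (\<forall>k\<le>-K. gdim X k = 0) \<and>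
    (\<forall>k\<ge>K. \<forall>c. (\<forall>l. c l \<noteq> 0 \<longrightarrow> l < r) \<longrightarrow> (\<exists>v\<in>hcomp X k. cl k v = c))"

text \<open>An element of degree k is uniquely a combination of the x^(k - e l) b_l with e l \<le>
  k. Its coefficients do not change under multiplication by x, so the coefficient vector is the
  image in the colimit.\<close>

lemma CM_colim:
  fixes X :: "'k::field gmod"
  assumes n: "n \<ge> 3" and X: "is_CM n X"
  shows "\<exists>cl r K. colim n X r K cl"
proof -
  obtain r e b where gm: "is_gmod n X" and hb: "hbasis n X r e b" using X by (auto simp: CM_iff_hbasis)
  have b: "b l \<in> hcomp X (e l)" if "l < r" for l using hb that by (simp add: hbasis_def)
  define I where "I k = {l. l < r \<and> e l \<le> k}" for k
  define fs where "fs k = filter (\<lambda>l. e l \<le> k) [0..<r]" for k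
  have fsI: "set (fs k) = I k" "distinct (fs k)" for k by (auto simp: fs_def I_def)
  have lf: "length (fs k) = gdim X k" for k using hb by (simp add: hbasis_def fs_def)
  have finI: "finite (I k)" for k by (simp add: I_def)
  define y where "y k l = xpow n X (k - e l) (e l) *\<^sub>v b l" for k l
  have gact_carrier: "gact X m k A \<in> carrier_mat (gdim X (m + k)) (gdim X k)" if "A \<in> Lam n m" for m k A
    using gm that by (simp add: is_gmod_def)
  have one: "(1\<^sub>m n :: 'k mat) \<in> Lam n m" if "m \<ge> 0" for m by (rule Lam_one[OF n that])
  have yc: "y k l \<in> hcomp X k" if "l \<in> I k" for k l
    using that b[of l] gact_carrier[OF one[of "k - e l"], of "e l"] by (auto simp: y_def xpow_def I_def)
  define lc where "lc k c = vec (gdim X k) (\<lambda>i. \<Sum>l\<in>I k. c l * y k l $ i)" for k and c :: "nat \<Rightarrow> 'k"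
  have lcc: "lc k c \<in> hcomp X k" for k c by (simp add: lc_def)
  define M where "M k = mat_of_cols (gdim X k) (map (y k) (fs k))" for k
  have Mc: "M k \<in> carrier_mat (gdim X k) (gdim X k)" for k using lf[of k] by (simp add: M_def carrier_matI)
  have inv: "\<exists>N \<in> carrier_mat (gdim X k) (gdim X k). M k * N = 1\<^sub>m (gdim X k) \<and> N * M k = 1\<^sub>m (gdim X k)" for k
  proof -
    have iM: "invertible_mat (M k)" using hb by (simp add: hbasis_def M_def fs_def y_def[abs_def])
    obtain N where N: "M k * N = 1\<^sub>m (dim_row (M k))" "N * M k = 1\<^sub>m (dim_row N)"
      using iM unfolding invertible_mat_def inverts_mat_def by blast
    have "dim_col (M k * N) = dim_row (M k)" "dim_col (N * M k) = dim_row N" unfolding N by auto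
    then have "N \<in> carrier_mat (gdim X k) (gdim X k)" using Mc[of k] by auto
    then show ?thesis using N Mc[of k] by auto
  qed
  \<comment> \<open>In this form invertibility of \<open>M k\<close> gives existence and uniqueness
    of coefficients.\<close>
  have lcM: "lc k c = M k *\<^sub>v vec (gdim X k) (\<lambda>j. c (fs k ! j))" for k c
  proof (rule eq_vecI)
    fix i assume "i < dim_vec (M k *\<^sub>v vec (gdim X k) (\<lambda>j. c (fs k ! j)))"
    then have i: "i < gdim X k" using Mc[of k] by simp
    have bij: "bij_betw ((!) (fs k)) {..<gdim X k} (I k)"
      using bij_betw_nth[OF fsI(2)[of k], of "{..<gdim X k}" "I k"] lf[of k] fsI(1)[of k] by simp
    have "lc k c $ i = (\<Sum>l\<in>I k. c l * y k l $ i)" using i by (simp add: lc_def)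
    also have "\<dots> = (\<Sum>j<gdim X k. c (fs k ! j) * y k (fs k ! j) $ i)"
      by (rule sum.reindex_bij_betw[OF bij, symmetric])
    also have "\<dots> = (M k *\<^sub>v vec (gdim X k) (\<lambda>j. c (fs k ! j))) $ i"
      using i lf[of k] by (auto simp: M_def scalar_prod_def mat_of_cols_index atLeast0LessThan intro!: sum.cong)
    finally show "lc k c $ i = (M k *\<^sub>v vec (gdim X k) (\<lambda>j. c (fs k ! j))) $ i" .
  qed (use Mc[of k] in \<open>simp add: lc_def\<close>)
  have lc_inj: "c = c'" if e: "lc k c = lc k c'" and s: "\<forall>l. c l \<noteq> 0 \<longrightarrow> l \<in> I k" "\<forall>l. c' l \<noteq> 0 \<longrightarrow> l \<in> I k" for k c c'
  proof -
    obtain N where N: "N \<in> carrier_mat (gdim X k) (gdim X k)" "N * M k = 1\<^sub>m (gdim X k)" using inv by blast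
    have "vec (gdim X k) (\<lambda>j. c (fs k ! j)) = N *\<^sub>v lc k c" for c
      using assoc_mult_mat_vec[OF N(1) Mc, of "vec (gdim X k) (\<lambda>j. c (fs k ! j))"] N(2) by (simp add: lcM)
    then have v: "vec (gdim X k) (\<lambda>j. c (fs k ! j)) = vec (gdim X k) (\<lambda>j. c' (fs k ! j))" using e by simp
    have eq: "c (fs k ! j) = c' (fs k ! j)" if "j < gdim X k" for j
      using arg_cong[OF v, of "\<lambda>v. v $ j"] that by simp
    show ?thesis
    proof
      fix l show "c l = c' l"
      proof (cases "l \<in> I k")
        case True
        then have "l \<in> set (fs k)" using fsI(1) by blast
        then obtain j where "j < length (fs k)" "l = fs k ! j" by (auto simp: in_set_conv_nth)
        then show ?thesis using eq lf by simp
      qed (use s in metis)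
    qed
  qed
  have lc_surj: "\<exists>c. (\<forall>l. c l \<noteq> 0 \<longrightarrow> l \<in> I k) \<and> lc k c = v" if v: "v \<in> hcomp X k" for k v
  proof -
    obtain N where N: "N \<in> carrier_mat (gdim X k) (gdim X k)" "M k * N = 1\<^sub>m (gdim X k)" using inv by blast
    define ix where "ix l = (SOME j. j < length (fs k) \<and> fs k ! j = l)" for l
    have ix: "ix (fs k ! j) = j" if j: "j < gdim X k" for j
    proof -
      have "ix (fs k ! j) < length (fs k) \<and> fs k ! ix (fs k ! j) = fs k ! j"
        unfolding ix_def by (rule someI[of _ j]) (use j lf in simp)
      then show ?thesis using nth_eq_iff_index_eq[OF fsI(2)[of k], of "ix (fs k ! j)" j] j lf[of k] by simp
    qed
    define c where "c l = (if l \<in> I k then (N *\<^sub>v v) $ ix l else 0)" for l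
    have "c (fs k ! j) = (N *\<^sub>v v) $ j" if "j < gdim X k" for j
    proof -
      have "fs k ! j \<in> I k" using that lf fsI(1) nth_mem by metis
      then show ?thesis using ix[OF that] by (simp add: c_def)
    qed
    then have "vec (gdim X k) (\<lambda>j. c (fs k ! j)) = N *\<^sub>v v" using N v by (intro eq_vecI) auto
    then have "lc k c = v" using assoc_mult_mat_vec[OF Mc N(1) v] N(2) v by (simp add: lcM)
    then show ?thesis by (intro exI[of _ c]) (simp add: c_def)
  qed
  define cl where "cl k v = (SOME c. (\<forall>l. c l \<noteq> 0 \<longrightarrow> l \<in> I k) \<and> lc k c = v)" for k v
  have cl: "(\<forall>l. cl k v l \<noteq> 0 \<longrightarrow> l \<in> I k) \<and> lc k (cl k v) = v" if "v \<in> hcomp X k" for k v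
    using lc_surj[OF that] unfolding cl_def by (rule someI_ex)
  have cl_eq: "cl k v = c" if "v \<in> hcomp X k" "\<forall>l. c l \<noteq> 0 \<longrightarrow> l \<in> I k" "lc k c = v" for k v c
    using lc_inj[of k "cl k v" c] cl[OF that(1)] that by blast
  \<comment> \<open>\<open>K\<close> exceeds every \<bar>e l\<bar>: no basis element has appeared by
    degree -K, and all are present from degree \<open>K\<close> on.\<close>
  define K where "K = 1 + (\<Sum>l<r. \<bar>e l\<bar>)"
  have Ke: "\<bar>e l\<bar> < K" if "l < r" for l
    using member_le_sum[of l "{..<r}" "\<lambda>l. \<bar>e l\<bar>"] that by (simp add: K_def)
  have 1: "l < r" if "v \<in> hcomp X k" "cl k v l \<noteq> 0" for k v l
    using cl[OF that(1)] that(2) by (auto simp: I_def)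
  have 2: "v = 0\<^sub>v (gdim X k)" if "v \<in> hcomp X k" "cl k v = (\<lambda>_. 0)" for k v
  proof -
    have "v = lc k (\<lambda>_. 0)" using cl[OF that(1)] that(2) by simp
    then show ?thesis by (auto simp: lc_def)
  qed
  have 3: "cl k (u + v) = (\<lambda>l. cl k u l + cl k v l)" if u: "u \<in> hcomp X k" and v: "v \<in> hcomp X k" for k u v
  proof (rule cl_eq)
    have "lc k (\<lambda>l. cl k u l + cl k v l) = lc k (cl k u) + lc k (cl k v)"
      by (intro eq_vecI) (auto simp: lc_def algebra_simps sum.distrib)
    then show "lc k (\<lambda>l. cl k u l + cl k v l) = u + v" using cl[OF u] cl[OF v] by simp
    show "\<forall>l. cl k u l + cl k v l \<noteq> 0 \<longrightarrow> l \<in> I k" using cl[OF u] cl[OF v] by (metis add.right_neutral)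
  qed (use u v in simp)
  have 4: "cl k (c \<cdot>\<^sub>v u) = (\<lambda>l. c * cl k u l)" if u: "u \<in> hcomp X k" for k u c
  proof (rule cl_eq)
    have "lc k (\<lambda>l. c * cl k u l) = c \<cdot>\<^sub>v lc k (cl k u)"
      by (intro eq_vecI) (auto simp: lc_def algebra_simps sum_distrib_left)
    then show "lc k (\<lambda>l. c * cl k u l) = c \<cdot>\<^sub>v u" using cl[OF u] by simp
    show "\<forall>l. c * cl k u l \<noteq> 0 \<longrightarrow> l \<in> I k" using cl[OF u] by auto
  qed (use u in simp)
  have 5: "cl (m + k) (gact X m k (1\<^sub>m n) *\<^sub>v v) = cl k v" if m: "m \<ge> 0" and v: "v \<in> hcomp X k" for m k v
  proof (rule cl_eq)
    note g = gact_carrier[OF one[OF m], of k]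
    show "gact X m k (1\<^sub>m n) *\<^sub>v v \<in> hcomp X (m + k)" using g v by simp
    have sub: "I k \<subseteq> I (m + k)" using m by (auto simp: I_def)
    then show "\<forall>l. cl k v l \<noteq> 0 \<longrightarrow> l \<in> I (m + k)" using cl[OF v] by blast
    have yy: "gact X m k (1\<^sub>m n) *\<^sub>v y k l = y (m + k) l" if l: "l \<in> I k" for l
    proof -
      have l': "l < r" "e l \<le> k" using l by (auto simp: I_def)
      have "gact X (m + (k - e l)) (e l) (1\<^sub>m n * 1\<^sub>m n) = gact X m ((k - e l) + e l) (1\<^sub>m n) * gact X (k - e l) (e l) (1\<^sub>m n)"
        using gm one[OF m] one[of "k - e l"] l' unfolding is_gmod_def by (metis diff_ge_0_iff_ge)
      then have "xpow n X (m + k - e l) (e l) = gact X m k (1\<^sub>m n) * gact X (k - e l) (e l) (1\<^sub>m n)"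
        by (simp add: xpow_def add_diff_eq)
      then show ?thesis using assoc_mult_mat_vec[OF g _ b[OF l'(1)], of "gact X (k - e l) (e l) (1\<^sub>m n)"] gact_carrier[OF one[of "k - e l"], of "e l"] l'
        by (simp add: y_def xpow_def)
    qed
    have "gact X m k (1\<^sub>m n) *\<^sub>v lc k (cl k v) = lc (m + k) (cl k v)"
    proof (rule eq_vecI)
      fix i assume "i < dim_vec (lc (m + k) (cl k v))"
      then have i: "i < gdim X (m + k)" by (simp add: lc_def)
      let ?G = "gact X m k (1\<^sub>m n)"
      have "(?G *\<^sub>v lc k (cl k v)) $ i = (\<Sum>j<gdim X k. ?G $$ (i,j) * (\<Sum>l\<in>I k. cl k v l * y k l $ j))"
        using i g by (auto simp: scalar_prod_def lc_def atLeast0LessThan intro!: sum.cong)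
      also have "\<dots> = (\<Sum>l\<in>I k. cl k v l * (\<Sum>j<gdim X k. ?G $$ (i,j) * y k l $ j))"
        by (simp add: sum_distrib_left mult.left_commute) (rule sum.swap)
      also have "\<dots> = (\<Sum>l\<in>I k. cl k v l * y (m + k) l $ i)"
      proof (rule sum.cong[OF refl])
        fix l assume l: "l \<in> I k"
        have "(\<Sum>j<gdim X k. ?G $$ (i,j) * y k l $ j) = (?G *\<^sub>v y k l) $ i"
          using i g yc[OF l] by (auto simp: scalar_prod_def atLeast0LessThan intro!: sum.cong)
        then show "cl k v l * (\<Sum>j<gdim X k. ?G $$ (i,j) * y k l $ j) = cl k v l * y (m + k) l $ i" using yy[OF l] by simp
      qed
      also have "\<dots> = (\<Sum>l\<in>I (m + k). cl k v l * y (m + k) l $ i)"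
        using cl[OF v] sub finI by (intro sum.mono_neutral_left) auto
      finally show "(?G *\<^sub>v lc k (cl k v)) $ i = lc (m + k) (cl k v) $ i" using i by (simp add: lc_def)
    qed (use g in \<open>simp add: lc_def\<close>)
    then show "lc (m + k) (cl k v) = gact X m k (1\<^sub>m n) *\<^sub>v v" using cl[OF v] by simp
  qed
  have 6: "gdim X k = 0" if "k \<le> - K" for k
  proof -
    have "fs k = []" using Ke that by (fastforce simp: fs_def filter_empty_conv)
    then show ?thesis using lf[of k] by simp
  qed
  have 7: "\<exists>v\<in>hcomp X k. cl k v = c" if "k \<ge> K" "\<forall>l. c l \<noteq> 0 \<longrightarrow> l < r" for k c
  proof -
    have "\<forall>l. c l \<noteq> 0 \<longrightarrow> l \<in> I k" using that Ke by (fastforce simp: I_def)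
    then show ?thesis using cl_eq[OF lcc _ refl] lcc by blast
  qed
  have "colim n X r K cl"
    unfolding colim_def by (intro conjI allI impI ballI) (fact 1 2 3 4 5 6 7)+
  then show ?thesis by blast
qed


section \<open>The components of a module as subspaces of one vector space\<close>

definition fsc :: "'k::field \<Rightarrow> (nat \<Rightarrow> 'k) \<Rightarrow> nat \<Rightarrow> 'k" where
  "fsc c f = (\<lambda>l. c * f l)"

interpretation fv: vector_space "fsc :: 'k::field \<Rightarrow> _"
  by unfold_locales (auto simp: fsc_def fun_eq_iff algebra_simps)

lemma sum_fsc_apply: "(\<Sum>q\<in>S. fsc (c q) (f q)) l = (\<Sum>q\<in>S. c q * f q l)"
  by (induction S rule: infinite_finite_induct) (auto simp: fsc_def)

lemma gact_comp:
  assumes X: "is_gmod n X" and A: "A \<in> Lam n m" and B: "B \<in> Lam n m'" and v: "v \<in> hcomp X k"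
  shows "gact X m (m' + k) A *\<^sub>v (gact X m' k B *\<^sub>v v) = gact X (m + m') k (A * B) *\<^sub>v v"
proof -
  have a: "gact X m (m' + k) A \<in> carrier_mat (gdim X (m + (m' + k))) (gdim X (m' + k))"
    "gact X m' k B \<in> carrier_mat (gdim X (m' + k)) (gdim X k)"
    "gact X (m + m') k (A * B) = gact X m (m' + k) A * gact X m' k B"
    using X A B by (auto simp: is_gmod_def)
  show ?thesis using assoc_mult_mat_vec[OF a(1,2) v] a(3) by simp
qed

text \<open>The unit E_0q, rather than E_qq, moves the q-th component to coordinate 0, so that all
  coordinates can be compared in one space. It lies in \<Lambda> in degree 0 because row 0 has
  exponents at most 0.\<close>

definition emb :: "nat \<Rightarrow> 'k::field gmod \<Rightarrow> (int \<Rightarrow> 'k vec \<Rightarrow> nat \<Rightarrow> 'k) \<Rightarrow> int \<Rightarrow> 'k vec \<Rightarrow> nat \<Rightarrow> nat \<Rightarrow> 'k" where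
  "emb n X cl k v q = (if q < n then cl k (gact X 0 k (Emat n 0 q) *\<^sub>v v) else 0)"

definition rowmat :: "nat \<Rightarrow> 'k::field mat \<Rightarrow> nat \<Rightarrow> nat \<Rightarrow> 'k mat" where
  "rowmat n A p t = mat n n (\<lambda>(i,j). if i = 0 \<and> j < t then A $$ (p,j) else 0)"

context
  fixes n :: nat and X :: "'k::field gmod" and r :: nat and K :: int and cl
  assumes n: "n \<ge> 3" and X: "is_gmod n X" and cm: "colim n X r K cl"
begin

lemma cl_supp: "v \<in> hcomp X k \<Longrightarrow> cl k v l \<noteq> 0 \<Longrightarrow> l < r"
  and cl_inj: "v \<in> hcomp X k \<Longrightarrow> cl k v = 0 \<Longrightarrow> v = 0\<^sub>v (gdim X k)"
  and cl_add: "u \<in> hcomp X k \<Longrightarrow> v \<in> hcomp X k \<Longrightarrow> cl k (u + v) = cl k u + cl k v"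
  and cl_smult: "u \<in> hcomp X k \<Longrightarrow> cl k (c \<cdot>\<^sub>v u) = fsc c (cl k u)"
  and cl_shift: "m \<ge> 0 \<Longrightarrow> v \<in> hcomp X k \<Longrightarrow> cl (m + k) (gact X m k (1\<^sub>m n) *\<^sub>v v) = cl k v"
  and cl_low: "k \<le> - K \<Longrightarrow> gdim X k = 0"
  and cl_high: "k \<ge> K \<Longrightarrow> \<forall>l. d l \<noteq> 0 \<longrightarrow> l < r \<Longrightarrow> \<exists>v\<in>hcomp X k. cl k v = d"
  using cm unfolding colim_def by (auto simp: fsc_def fun_eq_iff zero_fun_def plus_fun_def)

lemma gact_carrier: "A \<in> Lam n m \<Longrightarrow> gact X m k A \<in> carrier_mat (gdim X (m + k)) (gdim X k)"
  using X by (simp add: is_gmod_def)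

lemma gact_vec: "A \<in> Lam n m \<Longrightarrow> v \<in> hcomp X k \<Longrightarrow> gact X m k A *\<^sub>v v \<in> hcomp X (m + k)"
  using gact_carrier[of A m k] by simp

lemma gact_vec0: "A \<in> Lam n 0 \<Longrightarrow> v \<in> hcomp X k \<Longrightarrow> gact X 0 k A *\<^sub>v v \<in> hcomp X k"
  using gact_vec[of A 0 v k] by simp

lemma Emat_Lam0: "(Emat n 0 q :: 'k mat) \<in> Lam n 0"
  by (rule Emat_Lam) simp

lemma cl_0: "cl k (0\<^sub>v (gdim X k)) = 0"
proof -
  have "0 \<cdot>\<^sub>v 0\<^sub>v (gdim X k) = (0\<^sub>v (gdim X k) :: 'k vec)" by auto
  then show ?thesis using cl_smult[of "0\<^sub>v (gdim X k)" k 0] by (simp add: fsc_def zero_fun_def)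
qed

lemma gact_add_vec: "A \<in> Lam n m \<Longrightarrow> B \<in> Lam n m \<Longrightarrow> v \<in> hcomp X k \<Longrightarrow>
    gact X m k (A + B) *\<^sub>v v = gact X m k A *\<^sub>v v + gact X m k B *\<^sub>v v"
  using X add_mult_distrib_mat_vec[OF gact_carrier gact_carrier] by (simp add: is_gmod_def)

lemma gact_smult_vec:
  assumes "A \<in> Lam n m" "v \<in> hcomp X k"
  shows "gact X m k (c \<cdot>\<^sub>m A) *\<^sub>v v = c \<cdot>\<^sub>v (gact X m k A *\<^sub>v v)"
proof -
  have "gact X m k (c \<cdot>\<^sub>m A) = c \<cdot>\<^sub>m gact X m k A" using X assms by (simp add: is_gmod_def)
  then show ?thesis using gact_carrier[OF assms(1), of k] assms(2) by (intro eq_vecI) auto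
qed

lemma emb_add: "u \<in> hcomp X k \<Longrightarrow> v \<in> hcomp X k \<Longrightarrow> emb n X cl k (u + v) q = emb n X cl k u q + emb n X cl k v q"
  using mult_add_distrib_mat_vec[OF gact_carrier[OF Emat_Lam0, of k q], of u v] cl_add[OF gact_vec0[OF Emat_Lam0, of u] gact_vec0[OF Emat_Lam0, of v]] by (simp add: emb_def)

lemma emb_smult: "u \<in> hcomp X k \<Longrightarrow> emb n X cl k (c \<cdot>\<^sub>v u) q = fsc c (emb n X cl k u q)"
  using mult_mat_vec[OF gact_carrier[OF Emat_Lam0, of k q], of u c] cl_smult[OF gact_vec0[OF Emat_Lam0, of u]] by (simp add: emb_def fsc_def zero_fun_def)

text \<open>The factor \<open>x\<close> in front of \<open>E\<^sub>0\<^sub>p A\<close> makes all degrees nonnegative: \<open>\<Lambda>\<close> also lives in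
  degree -1, where \<^term>\<open>rowmat n A p t\<close> need not lie in \<open>\<Lambda>\<close>.\<close>

lemma emb_act:
  assumes A: "A \<in> Lam n m" and v: "v \<in> hcomp X k" and p: "p < n"
  shows "emb n X cl (m + k) (gact X m k A *\<^sub>v v) p = (\<Sum>q<n. fsc (A $$ (p,q)) (emb n X cl k v q))"
proof (cases "m \<ge> -1")
  case True
  then have N0: "1 + m \<ge> 0" by simp
  have one: "(1\<^sub>m n :: 'k mat) \<in> Lam n d" if "d \<ge> 0" for d by (rule Lam_one[OF n that])
  have RL: "rowmat n A p t \<in> Lam n (1 + m)" for t
  proof -
    have "cexp n 0 j \<le> 1 + m" for j using cexp_0[of n j] N0 by linarith
    then show ?thesis by (auto simp: rowmat_def Lam_def)
  qed
  have EL: "(Emat n 0 q :: 'k mat) \<in> Lam n (1 + m)" for q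
    by (rule Emat_Lam) (use cexp_0[of n q] N0 in linarith)
  have E: "cl ((1 + m) + k) (gact X (1 + m) k (Emat n 0 q) *\<^sub>v v) = emb n X cl k v q" if "q < n" for q
  proof -
    have "1\<^sub>m n * (Emat n 0 q :: 'k mat) = Emat n 0 q" by (simp add: Emat_def)
    then have "gact X (1 + m) k (Emat n 0 q) *\<^sub>v v = gact X (1 + m) k (1\<^sub>m n) *\<^sub>v (gact X 0 k (Emat n 0 q) *\<^sub>v v)"
      using gact_comp[OF X one[OF N0] Emat_Lam0 v, of q] by simp
    then show ?thesis using cl_shift[OF N0 gact_vec0[OF Emat_Lam0 v]] that by (simp add: emb_def)
  qed
  have R: "cl ((1 + m) + k) (gact X (1 + m) k (rowmat n A p t) *\<^sub>v v) = (\<Sum>q<t. fsc (A $$ (p,q)) (emb n X cl k v q))" if "t \<le> n" for t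
    using that
  proof (induction t)
    case 0
    have "rowmat n A p 0 = 0 \<cdot>\<^sub>m (Emat n 0 0 :: 'k mat)" by (auto simp: rowmat_def Emat_def)
    then have "cl ((1 + m) + k) (gact X (1 + m) k (rowmat n A p 0) *\<^sub>v v) = fsc 0 (emb n X cl k v 0)"
      using gact_smult_vec[OF EL v, of 0 0] cl_smult[OF gact_vec[OF EL v, of 0], of 0] E[of 0] n by simp
    then show ?case by (simp add: fsc_def zero_fun_def)
  next
    case (Suc t)
    have e: "rowmat n A p (Suc t) = rowmat n A p t + A $$ (p,t) \<cdot>\<^sub>m Emat n 0 t"
      by (auto simp: rowmat_def Emat_def less_Suc_eq)
    have "gact X (1 + m) k (rowmat n A p (Suc t)) *\<^sub>v v = gact X (1 + m) k (rowmat n A p t) *\<^sub>v v + A $$ (p,t) \<cdot>\<^sub>v (gact X (1 + m) k (Emat n 0 t) *\<^sub>v v)"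
      unfolding e gact_add_vec[OF RL Lam_smult[OF EL] v] gact_smult_vec[OF EL v] ..
    then show ?case using Suc E[of t] cl_add[OF gact_vec[OF RL v, of t] smult_carrier_vec[THEN iffD2, OF gact_vec[OF EL v, of t]]] cl_smult[OF gact_vec[OF EL v, of t]] by simp
  qed
  have prod: "1\<^sub>m n * (Emat n 0 p * A) = rowmat n A p n"
  proof -
    have A': "A \<in> carrier_mat n n" using A by (rule Lam_carrier)
    have "Emat n 0 p * A = rowmat n A p n"
    proof (rule eq_matI)
      fix i j assume "i < dim_row (rowmat n A p n)" "j < dim_col (rowmat n A p n)"
      then have ij: "i < n" "j < n" by (auto simp: rowmat_def)
      have "(Emat n 0 p * A) $$ (i,j) = (\<Sum>q<n. (if i = 0 \<and> q = p then 1 else 0) * A $$ (q,j))"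
        using ij A' by (auto simp: Emat_def scalar_prod_def atLeast0LessThan intro!: sum.cong)
      also have "\<dots> = (\<Sum>q<n. if q = p then (if i = 0 then A $$ (q,j) else 0) else 0)" by (intro sum.cong) auto
      also have "\<dots> = rowmat n A p n $$ (i,j)" using ij p by (auto simp: rowmat_def)
      finally show "(Emat n 0 p * A) $$ (i,j) = rowmat n A p n $$ (i,j)" .
    qed (use A' in \<open>auto simp: Emat_def rowmat_def\<close>)
    then show ?thesis by (simp add: rowmat_def)
  qed
  have one1: "(1\<^sub>m n :: 'k mat) \<in> Lam n 1" by (rule one) simp
  have EA: "Emat n 0 p * A \<in> Lam n m" using Lam_mult[OF n Emat_Lam0 A] by simp
  have "emb n X cl (m + k) (gact X m k A *\<^sub>v v) p = cl (m + k) (gact X 0 (m + k) (Emat n 0 p) *\<^sub>v (gact X m k A *\<^sub>v v))"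
    using p by (simp add: emb_def)
  also have "gact X 0 (m + k) (Emat n 0 p) *\<^sub>v (gact X m k A *\<^sub>v v) = gact X m k (Emat n 0 p * A) *\<^sub>v v"
    using gact_comp[OF X Emat_Lam0 A v] by simp
  also have "cl (m + k) (gact X m k (Emat n 0 p * A) *\<^sub>v v) = cl (1 + (m + k)) (gact X 1 (m + k) (1\<^sub>m n) *\<^sub>v (gact X m k (Emat n 0 p * A) *\<^sub>v v))"
    by (rule cl_shift[symmetric]) (use gact_vec[OF EA v] in auto)
  also have "\<dots> = cl ((1 + m) + k) (gact X (1 + m) k (rowmat n A p n) *\<^sub>v v)"
    using gact_comp[OF X one1 EA v] prod by (simp add: add.assoc)
  finally show ?thesis using R[of n] by simp
next
  case False
  \<comment> \<open>Below degree -1 the component of \<Lambda> is zero, since no exponent is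
    smaller.\<close>
  have z: "A $$ (i,j) = 0" if "i < n" "j < n" for i j
    using A that False cexp_ge[of n i j m] by (auto simp: Lam_def)
  have "A = 0 \<cdot>\<^sub>m A" using Lam_carrier[OF A] z by auto
  then have "gact X m k A *\<^sub>v v = 0 \<cdot>\<^sub>v (gact X m k A *\<^sub>v v)" using gact_smult_vec[OF A v, of 0] by simp
  then have "emb n X cl (m + k) (gact X m k A *\<^sub>v v) p = 0"
    using emb_smult[OF gact_vec[OF A v], of 0 p] by (simp add: fsc_def zero_fun_def)
  moreover have "(\<Sum>q<n. fsc (A $$ (p,q)) (emb n X cl k v q)) = 0"
    using z[OF p] by (intro sum.neutral) (auto simp: fsc_def zero_fun_def)
  ultimately show ?thesis by simp
qed

lemma emb_matrix_unit:
  assumes "cexp n p q \<le> m" "p < n" "q < n" "v \<in> hcomp X k" "i < n"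
  shows "emb n X cl (m + k) (gact X m k (Emat n p q) *\<^sub>v v) i = (if i = p then emb n X cl k v q else 0)"
proof -
  have "emb n X cl (m + k) (gact X m k (Emat n p q) *\<^sub>v v) i = (\<Sum>j<n. fsc (Emat n p q $$ (i,j)) (emb n X cl k v j))"
    by (rule emb_act[OF Emat_Lam]) (use assms in auto)
  also have "\<dots> = (\<Sum>j<n. if j = q then (if i = p then emb n X cl k v q else 0) else 0)"
    using assms(5) by (intro sum.cong) (auto simp: Emat_def fsc_def zero_fun_def)
  finally show ?thesis using assms(3) by simp
qed

text \<open>Multiplication by x^2 is injective and is the sum of the E_qq x^2, each of which factors
  as (E_q0 x^2) E_0q and so sees only \<open>emb\<close> at \<open>q\<close>. The exponent 2 is the
  largest one, which admits every E_q0.\<close>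

lemma emb_inj:
  assumes v: "v \<in> hcomp X k" and z: "\<And>q. q < n \<Longrightarrow> emb n X cl k v q = 0"
  shows "v = 0\<^sub>v (gdim X k)"
proof -
  define D where "D t = (mat n n (\<lambda>(i,j). if i = j \<and> j < t then 1 else 0) :: 'k mat)" for t
  have DL: "D t \<in> Lam n 2" for t by (auto simp: D_def Lam_def cexp_def)
  have EL: "(Emat n q q :: 'k mat) \<in> Lam n 2" for q by (rule Emat_Lam) (simp add: cexp_def)
  have Eq: "gact X 2 k (Emat n q q) *\<^sub>v v = 0\<^sub>v (gdim X (2 + k))" if q: "q < n" for q
  proof -
    have E2: "(Emat n q 0 :: 'k mat) \<in> Lam n 2" by (rule Emat_Lam) (simp add: cexp_def)
    have "gact X 0 k (Emat n 0 q) *\<^sub>v v = 0\<^sub>v (gdim X k)"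
      using z[OF q] q cl_inj[OF gact_vec0[OF Emat_Lam0 v]] by (simp add: emb_def)
    moreover have "(Emat n q 0 :: 'k mat) * Emat n 0 q = Emat n q q"
    proof (rule eq_matI)
      fix i j assume "i < dim_row (Emat n q q :: 'k mat)" "j < dim_col (Emat n q q :: 'k mat)"
      then have ij: "i < n" "j < n" by (auto simp: Emat_def)
      have "((Emat n q 0 :: 'k mat) * Emat n 0 q) $$ (i,j) = (\<Sum>l<n. Emat n q 0 $$ (i,l) * Emat n 0 q $$ (l,j))"
        using ij by (simp add: Emat_def scalar_prod_def atLeast0LessThan)
      also have "\<dots> = (\<Sum>l<n. if l = 0 then (if i = q \<and> j = q then 1 else 0) else 0)"
        using ij by (intro sum.cong) (auto simp: Emat_def)
      also have "\<dots> = Emat n q q $$ (i,j)" using ij n by (simp add: Emat_def)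
      finally show "((Emat n q 0 :: 'k mat) * Emat n 0 q) $$ (i,j) = Emat n q q $$ (i,j)" .
    qed (auto simp: Emat_def)
    ultimately have "gact X 2 k (Emat n q q) *\<^sub>v v = gact X 2 k (Emat n q 0) *\<^sub>v 0\<^sub>v (gdim X k)"
      using gact_comp[OF X E2 Emat_Lam0 v, of q] by simp
    also have "\<dots> = 0\<^sub>v (gdim X (2 + k))" using gact_carrier[OF E2, of k] by (intro eq_vecI) auto
    finally show ?thesis .
  qed
  have "gact X 2 k (D t) *\<^sub>v v = 0\<^sub>v (gdim X (2 + k))" if "t \<le> n" for t
    using that
  proof (induction t)
    case 0
    have "D 0 = 0 \<cdot>\<^sub>m Emat n 0 0" by (auto simp: D_def Emat_def)
    then show ?case using gact_smult_vec[OF EL v, of 0 0] Eq[of 0] n by auto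
  next
    case (Suc t)
    have "D (Suc t) = D t + Emat n t t" by (auto simp: D_def Emat_def less_Suc_eq)
    then show ?case using gact_add_vec[OF DL EL v, of t t] Suc Eq[of t] by simp
  qed
  moreover have "D n = 1\<^sub>m n" by (auto simp: D_def)
  ultimately have "gact X 2 k (1\<^sub>m n) *\<^sub>v v = 0\<^sub>v (gdim X (2 + k))" by (metis order_refl)
  then have "cl k v = 0" using cl_shift[of 2, OF _ v] cl_0[of "2 + k"] by simp
  then show ?thesis by (rule cl_inj[OF v])
qed

lemma emb_0: "emb n X cl k (0\<^sub>v (gdim X k)) q = 0"
proof -
  have "0 \<cdot>\<^sub>v 0\<^sub>v (gdim X k) = (0\<^sub>v (gdim X k) :: 'k vec)" by auto
  then show ?thesis using emb_smult[of "0\<^sub>v (gdim X k)" k 0 q] by (simp add: fsc_def zero_fun_def)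
qed

definition "Fl q k = (\<lambda>v. emb n X cl k v q) ` hcomp X k"

lemma Fl_subspace: "fv.subspace (Fl q k)"
  unfolding fv.subspace_def
proof (intro conjI ballI allI)
  show "0 \<in> Fl q k" unfolding Fl_def using emb_0[of k q] by (metis imageI zero_carrier_vec)
  show "x + y \<in> Fl q k" if "x \<in> Fl q k" "y \<in> Fl q k" for x y
    using that emb_add[of _ k _ q] unfolding Fl_def image_iff by (metis add_carrier_vec)
  show "fsc c x \<in> Fl q k" if "x \<in> Fl q k" for x c
    using that emb_smult[of _ k c q] unfolding Fl_def image_iff by (metis smult_carrier_vec)
qed

text \<open>After the embedding, E_pq x^m acts as an inclusion of subspaces; every relation among
  the filtrations comes from such an inclusion.\<close>

lemma Fl_mono:
  assumes "cexp n p q \<le> m" "p < n" "q < n"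
  shows "Fl q k \<subseteq> Fl p (m + k)"
proof
  fix x assume "x \<in> Fl q k"
  then obtain v where v: "v \<in> hcomp X k" "x = emb n X cl k v q" by (auto simp: Fl_def)
  have "emb n X cl (m + k) (gact X m k (Emat n p q) *\<^sub>v v) p = x"
    using emb_matrix_unit[OF assms v(1) assms(2)] v(2) by simp
  then show "x \<in> Fl p (m + k)" using gact_vec[OF Emat_Lam[OF assms(1)] v(1)] unfolding Fl_def by blast
qed

lemma Fl_low: "k \<le> - K \<Longrightarrow> Fl q k = {0}"
proof -
  assume "k \<le> - K"
  then have "v \<in> hcomp X k \<Longrightarrow> v = 0\<^sub>v (gdim X k)" for v :: "'k vec" using cl_low by (intro eq_vecI) auto
  then have "x = 0" if "x \<in> Fl q k" for x using that emb_0[of k q] by (auto simp: Fl_def)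
  then show ?thesis using fv.subspace_0[OF Fl_subspace[of q k]] by (intro equalityI subsetI) auto
qed

text \<open>From degree \<open>K\<close> on the component at coordinate 0 is stationary, since the
  whole colimit is already reached. Passing from coordinate 0 to \<open>q\<close> by E_q0 x^2 may
  cost two more degrees, hence \<open>K + 2\<close>.\<close>

lemma Fl_high:
  assumes q: "q < n" and k: "k \<ge> K + 2"
  shows "Fl q k = Fl 0 K"
proof -
  have n0: "0 < n" using n by simp
  have down: "Fl 0 k' \<subseteq> Fl 0 K" if k': "K \<le> k'" for k'
  proof
    fix x assume "x \<in> Fl 0 k'"
    then obtain v' where v': "v' \<in> hcomp X k'" "x = emb n X cl k' v' 0" by (auto simp: Fl_def)
    obtain v where v: "v \<in> hcomp X K" "cl K v = cl k' v'"
      using cl_high[of K "cl k' v'"] cl_supp[OF v'(1)] by auto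
    have d: "k' - K \<ge> 0" using k' by simp
    have one: "(1\<^sub>m n :: 'k mat) \<in> Lam n (k' - K)" by (rule Lam_one[OF n d])
    let ?u = "gact X (k' - K) K (1\<^sub>m n) *\<^sub>v v"
    have u: "?u \<in> hcomp X k'" using gact_vec[OF one v(1)] by simp
    have cu: "cl k' ?u = cl k' v'" using cl_shift[OF d v(1)] v(2) by simp
    have "cl k' (?u + (-1) \<cdot>\<^sub>v v') = cl k' ?u + fsc (-1) (cl k' v')" using cl_add[OF u, of "(-1) \<cdot>\<^sub>v v'"] cl_smult[OF v'(1)] v'(1) by simp
    then have "cl k' (?u + (-1) \<cdot>\<^sub>v v') = 0" using cu by (simp add: fsc_def fun_eq_iff)
    then have z: "?u + (-1) \<cdot>\<^sub>v v' = 0\<^sub>v (gdim X k')" using cl_inj[of "?u + (-1) \<cdot>\<^sub>v v'" k'] u v'(1) by simp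
    have "?u = v'"
    proof (rule eq_vecI)
      fix i assume "i < dim_vec v'"
      then have i: "i < gdim X k'" using v'(1) by simp
      have "(?u + (-1) \<cdot>\<^sub>v v') $ i = 0" using z i by simp
      then show "?u $ i = v' $ i" using i u v'(1) by simp
    qed (metis carrier_vecD u v'(1))
    moreover have "emb n X cl k' ?u 0 = emb n X cl K v 0"
    proof -
      have "emb n X cl ((k' - K) + K) ?u 0 = (\<Sum>q<n. fsc ((1\<^sub>m n :: 'k mat) $$ (0,q)) (emb n X cl K v q))"
        by (rule emb_act[OF one v(1) n0])
      also have "\<dots> = (\<Sum>q<n. if q = 0 then emb n X cl K v 0 else 0)"
        using n0 by (intro sum.cong) (auto simp: fsc_def zero_fun_def)
      finally show ?thesis using n0 by simp
    qed
    ultimately show "x \<in> Fl 0 K" using v v'(2) by (auto simp: Fl_def)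
  qed
  show ?thesis
  proof
    have "Fl q k \<subseteq> Fl 0 (0 + k)" by (rule Fl_mono) (use q n0 in auto)
    then show "Fl q k \<subseteq> Fl 0 K" using down[of k] k by auto
    have "cexp n q 0 \<le> k - K" using k by (simp add: cexp_def)
    then show "Fl 0 K \<subseteq> Fl q k" using Fl_mono[of q 0 "k - K" K] q n0 by simp
  qed
qed

lemma Fl_le: "q < n \<Longrightarrow> Fl q k \<subseteq> Fl 0 K"
proof -
  assume q: "q < n"
  define k' where "k' = max k (K + 2)"
  have "cexp n q q \<le> k' - k" using cexp_diag[of n q] n by (simp add: k'_def)
  then have "Fl q k \<subseteq> Fl q k'" using Fl_mono[of q q "k' - k" k] q by simp
  then show ?thesis using Fl_high[OF q, of k'] by (simp add: k'_def)
qed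

text \<open>The ambient function space is infinite dimensional; finiteness of the basis of
  \<open>Fl 0 K\<close> comes from this bound.\<close>

lemma Fl_span: "Fl 0 K \<subseteq> fv.span ((\<lambda>l i. if i = l then 1 else 0) ` {..<r})"
proof
  fix x assume "x \<in> Fl 0 K"
  then obtain v where v: "v \<in> hcomp X K" "x = emb n X cl K v 0" by (auto simp: Fl_def)
  have s: "x l \<noteq> 0 \<Longrightarrow> l < r" for l using v cl_supp[OF gact_vec0[OF Emat_Lam0 v(1)]] n by (auto simp: emb_def)
  have "x = (\<Sum>l<r. fsc (x l) (\<lambda>i. if i = l then 1 else 0))"
    using s by (auto simp: fun_eq_iff sum_fsc_apply if_distrib[of "\<lambda>x. _ * x"] cong: if_cong)
  moreover have "\<dots> \<in> fv.span ((\<lambda>l i. if i = l then 1 else 0) ` {..<r})"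
    by (intro fv.span_sum fv.span_scale fv.span_base) auto
  ultimately show "x \<in> fv.span ((\<lambda>l i. if i = l then 1 else 0) ` {..<r})" by simp
qed

end


lemma cexp_le_2: "cexp n p q \<le> 2"
  by (simp add: cexp_def)

lemma pos_div_mod:
  assumes "q < n"
  shows "nat ((int q + 1 - t * int n - 1) mod int n) = q" "- ((int q + 1 - t * int n - 1) div int n) = t"
proof -
  have e: "int q + 1 - t * int n - 1 = int q + (- t) * int n" by simp
  have "(int q + 1 - t * int n - 1) mod int n = int q mod int n" unfolding e by (rule mod_mult_self1)
  then show "nat ((int q + 1 - t * int n - 1) mod int n) = q" using assms by simp
  have "(int q + 1 - t * int n - 1) div int n = - t + int q div int n" unfolding e using assms by (intro div_mult_self1) auto
  then show "- ((int q + 1 - t * int n - 1) div int n) = t" using assms by simp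
qed

lemma CM_types:
  fixes X :: "'k::field gmod"
  assumes n: "n \<ge> 3" and CM: "is_CM n X"
  shows "\<exists>L. types n X L"
proof -
  have X: "is_gmod n X" using CM by (simp add: is_CM_def)
  obtain cl r K where cm: "colim n X r K cl" using CM_colim[OF n CM] by blast
  note ctx = n X cm
  define F where "F = Fl n X cl"
  have Fsub: "fv.subspace (F q k)" for q k unfolding F_def by (rule Fl_subspace[OF ctx])
  have Fmono: "F q k \<subseteq> F p k'" if "cexp n p q \<le> k' - k" "p < n" "q < n" for p q k k'
    using Fl_mono[OF ctx that, of k] by (simp add: F_def)
  have Flow: "F q k = {0}" if "k \<le> - K" for q k unfolding F_def by (rule Fl_low[OF ctx that])
  have Fhigh: "F q k = F 0 K" if "q < n" "K + 2 \<le> k" for q k unfolding F_def by (rule Fl_high[OF ctx that])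
  have Fle: "F q k \<subseteq> F 0 K" if "q < n" for q k unfolding F_def by (rule Fl_le[OF ctx that])
  have Fspan: "F 0 K \<subseteq> fv.span ((\<lambda>l i. if i = l then 1 else 0) ` {..<r})" unfolding F_def by (rule Fl_span[OF ctx])
  \<comment> \<open>\<open>qq u\<close> and \<open>tt u\<close> are the coordinate and half the
    (even) degree belonging to position \<open>u\<close>; the sign in \<open>tt\<close> reflects
    that positions fall as degrees grow.\<close>
  define qq where "qq u = nat ((u - 1) mod int n)" for u
  define tt where "tt u = - ((u - 1) div int n)" for u
  define A where "A u = F (qq u) (2 * tt u)" for u
  define B where "B u = F (qq u) (2 * tt u + 1)" for u
  have qq: "qq u < n" for u using n by (simp add: qq_def nat_less_iff)
  have iq: "int (qq u) = (u - 1) mod int n" for u using n by (simp add: qq_def)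
  have u_eq: "u = int (qq u) + 1 - tt u * int n" for u
    using div_mult_mod_eq[of "u - 1" "int n"] by (simp add: iq tt_def)
  have pos: "qq (int q + 1 - t * int n) = q" "tt (int q + 1 - t * int n) = t" if "q < n" for q t
    using pos_div_mod[OF that, of t] by (simp_all only: qq_def tt_def)
  have Fpos: "F q k = (if even k then A else B) (int q + 1 - (k div 2) * int n)" if "q < n" for q k
    by (auto simp: A_def B_def pos[OF that])
  have tmono: "tt v \<le> tt u" if "u \<le> v" for u v
    unfolding tt_def using zdiv_mono1[of "u - 1" "v - 1" "int n"] that n by simp
  have qmono: "qq u \<le> qq v" if "u \<le> v" "tt u = tt v" for u v
    using u_eq[of u] u_eq[of v] that by simp
  have step: "cexp n (qq u) (qq v) \<le> 2 * tt u - 2 * tt v" if "u \<le> v" for u v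
  proof (cases "tt u = tt v")
    case True
    then show ?thesis using qmono[OF that] by (simp add: cexp_def)
  next
    case False
    then have "tt v + 1 \<le> tt u" using tmono[OF that] by simp
    then show ?thesis using cexp_le_2[of n "qq u" "qq v"] by simp
  qed
  have Adec: "A v \<subseteq> A u" if "u \<le> v" for u v
    unfolding A_def by (rule Fmono) (use step[OF that] qq in auto)
  have Bdec: "B v \<subseteq> B u" if "u \<le> v" for u v
    unfolding B_def by (rule Fmono) (use step[OF that] qq in auto)
  \<comment> \<open>Inside a block the inclusion is given by E_(q+1,q) x. At the last coordinate the
    next position lies in the preceding block, and the corner E_(0,n-1) x^-1 is used.\<close>
  have AB: "A u \<subseteq> B (u + 1)" for u
  proof (cases "qq u + 1 < n")
    case True
    have "u + 1 = int (qq u + 1) + 1 - tt u * int n" using u_eq[of u] by simp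
    then have "qq (u + 1) = qq u + 1" "tt (u + 1) = tt u" using pos[OF True, of "tt u"] by metis+
    then show ?thesis unfolding A_def B_def by (intro Fmono) (use True qq in \<open>auto simp: cexp_def\<close>)
  next
    case False
    then have q: "qq u = n - 1" using qq[of u] by linarith
    have "u + 1 = int 0 + 1 - (tt u - 1) * int n" using u_eq[of u] n by (simp add: q algebra_simps)
    then have "qq (u + 1) = 0" "tt (u + 1) = tt u - 1" using pos[of 0 "tt u - 1"] n by (metis less_le_trans zero_less_numeral)+
    then show ?thesis unfolding A_def B_def by (intro Fmono) (use q n in \<open>auto simp: cexp_def\<close>)
  qed
  \<comment> \<open>The same two elements of \<Lambda>, now starting from odd degrees and ending in
    even ones.\<close>
  have BA: "B u \<subseteq> A (u + 1 - int n)" for u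
  proof (cases "qq u + 1 < n")
    case True
    have "u + 1 - int n = int (qq u + 1) + 1 - (tt u + 1) * int n" using u_eq[of u] by (simp add: algebra_simps)
    then have "qq (u + 1 - int n) = qq u + 1" "tt (u + 1 - int n) = tt u + 1" using pos[OF True, of "tt u + 1"] by metis+
    then show ?thesis unfolding A_def B_def by (intro Fmono) (use True qq in \<open>auto simp: cexp_def\<close>)
  next
    case False
    then have q: "qq u = n - 1" using qq[of u] by linarith
    have "u + 1 - int n = int 0 + 1 - tt u * int n" using u_eq[of u] n by (simp add: q algebra_simps)
    then have "qq (u + 1 - int n) = 0" "tt (u + 1 - int n) = tt u" using pos[of 0 "tt u"] n by (metis less_le_trans zero_less_numeral)+
    then show ?thesis unfolding A_def B_def by (intro Fmono) (use q n in \<open>auto simp: cexp_def\<close>)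
  qed
  obtain S where S: "S \<subseteq> F 0 K" "fv.independent S" "F 0 K \<subseteq> fv.span S"
    using fv.maximal_independent_subset by blast
  have Sspan: "F 0 K = fv.span S" using S fv.span_minimal[OF S(1) Fsub] by blast
  have Sfin: "finite S" using fv.independent_span_bound[of "(\<lambda>l i. if i = l then 1 else 0) ` {..<r}" S] S Fspan by blast
  \<comment> \<open>The block of \<open>lo\<close> lies in degrees at least \<open>K + 2\<close>,
    where \<open>Fl_high\<close> applies, and the block of \<open>hi\<close> in degrees at most -K,
    where the module is zero.\<close>
  define lo where "lo = 1 - int n * (\<bar>K\<bar> + 2)"
  define hi where "hi = int n * (\<bar>K\<bar> + 2) + 1"
  have "lo - 1 = int n * - (\<bar>K\<bar> + 2)" by (simp add: lo_def algebra_simps)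
  then have tlo: "tt lo = \<bar>K\<bar> + 2" using n unfolding tt_def by (simp only: nonzero_mult_div_cancel_left)
  have thi: "tt hi = - (\<bar>K\<bar> + 2)" using n by (simp add: tt_def hi_def)
  have klo: "K + 2 \<le> 2 * (\<bar>K\<bar> + 2)" "K + 2 \<le> 2 * (\<bar>K\<bar> + 2) + 1" by auto
  have "\<exists>s w a b. inj_on w {..<s} \<and> fv.independent (w ` {..<s}) \<and> adapted fv.span A s w a \<and> adapted fv.span B s w b"
  proof (rule fv.two_filtrations[where lo=lo and hi=hi and W="F 0 K" and S=S])
    show "A lo = F 0 K" "B lo = F 0 K" using Fhigh[OF qq klo(1)] Fhigh[OF qq klo(2)] by (simp_all only: A_def B_def tlo)
    show "A hi = {0}" "B hi = {0}" unfolding A_def B_def thi by (rule Flow, simp)+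
  qed (use Fsub Adec Bdec Fle qq S Sfin Sspan in \<open>auto simp: A_def B_def\<close>)
  then obtain s w a b where w: "inj_on w {..<s}" "fv.independent (w ` {..<s})"
    and ad: "adapted fv.span A s w a" "adapted fv.span B s w b" by blast
  have Aw: "A u = fv.span (w ` {l. l < s \<and> u \<le> a l})" and Bw: "B u = fv.span (w ` {l. l < s \<and> u \<le> b l})" for u
    using ad by (simp_all only: adapted_def)
  define L where "L = map (\<lambda>l. (a l, b l)) [0..<s]"
  have lL: "length L = s" and nL: "\<And>l. l < s \<Longrightarrow> L ! l = (a l, b l)" by (auto simp: L_def)
  let ?Bs = "w ` {..<s}"
  have Fw: "F q k = fv.span (w ` {l. l < s \<and> in_supp n (L ! l) q k})" if q: "q < n" for q k
  proof -
    have "{l. l < s \<and> in_supp n (L ! l) q k} = {l. l < s \<and> int q + 1 - (k div 2) * int n \<le> (if even k then a l else b l)}"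
      using q by (auto simp: in_supp_def nL)
    then show ?thesis using Aw Bw Fpos[OF q, of k] by simp
  qed
  \<comment> \<open>The vector \<open>w l\<close> lies in \<open>A (a l)\<close>, hence in
    \<open>B (a l + 1)\<close>, so a l + 1 \<le> b l; the inclusion \<open>BA\<close> gives the
    other bound.\<close>
  have val: "valid n (L ! l)" if l: "l < s" for l
  proof -
    have "w l \<in> A (a l)" unfolding Aw using l by (intro fv.span_base) auto
    then have "w l \<in> fv.span (w ` {j. j < s \<and> a l + 1 \<le> b j})" using AB[of "a l"] Bw by blast
    then have "l \<in> {j. j < s \<and> a l + 1 \<le> b j}" by (intro fv.span_index[OF w l]) auto
    moreover have "w l \<in> B (b l)" unfolding Bw using l by (intro fv.span_base) auto
    then have "w l \<in> fv.span (w ` {j. j < s \<and> b l + 1 - int n \<le> a j})" using BA[of "b l"] Aw by blast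
    then have "l \<in> {j. j < s \<and> b l + 1 - int n \<le> a j}" by (intro fv.span_index[OF w l]) auto
    ultimately show ?thesis using l by (simp add: valid_def nL)
  qed
  define em where "em = emb n X cl"
  have emF: "em k v q \<in> F q k" if "v \<in> hcomp X k" for k v q
    using that by (auto simp: em_def F_def Fl_def[OF ctx])
  have emZ: "em k v q = 0" if "\<not> q < n" for k v q using that by (simp add: em_def emb_def)
  have emS: "em k v q \<in> fv.span ?Bs" if "v \<in> hcomp X k" for k v q
  proof (cases "q < n")
    case True
    have "fv.span (w ` {l. l < s \<and> in_supp n (L ! l) q k}) \<subseteq> fv.span ?Bs" by (rule fv.span_mono) auto
    then show ?thesis using emF[OF that, of q] Fw[OF True] by blast
  qed (simp add: emZ fv.span_zero)
  \<comment> \<open>The coordinates are the coefficients with respect to the adapted basis;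
    adaptedness confines them to the supports.\<close>
  define \<Phi> where "\<Phi> k v q l = (if l < s then fv.representation ?Bs (em k v q) (w l) else 0)" for k v q l
  have rep_sum: "x = (\<Sum>l<s. fsc (fv.representation ?Bs x (w l)) (w l))" if "x \<in> fv.span ?Bs" for x
    using fv.sum_representation_eq[OF w(2) that, of ?Bs] by (simp add: sum.reindex[OF w(1)])
  have rep_of: "fv.representation ?Bs (\<Sum>l<s. fsc (c l) (w l)) (w j) = c j" if j: "j < s" for c j
  proof -
    have "fv.representation ?Bs (\<Sum>l<s. fsc (c l) (w l)) (w j) = (\<Sum>l<s. fv.representation ?Bs (fsc (c l) (w l)) (w j))"
      by (subst fv.representation_sum[OF w(2)]) (auto intro: fv.span_scale fv.span_base)
    also have "\<dots> = (\<Sum>l<s. if l = j then c j else 0)"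
    proof (rule sum.cong[OF refl])
      fix l assume "l \<in> {..<s}"
      then have l: "l < s" "w l \<in> ?Bs" by auto
      have "(w j = w l) = (l = j)" using w(1) l j by (auto simp: inj_on_def)
      then show "fv.representation ?Bs (fsc (c l) (w l)) (w j) = (if l = j then c j else 0)"
        using fv.representation_scale[OF w(2) fv.span_base[OF l(2)], of "c l"] fv.representation_basis[OF w(2) l(2)] by auto
    qed
    finally show ?thesis using j by simp
  qed
  have Cin: "\<Phi> k v \<in> Cs n L k" if v: "v \<in> hcomp X k" for k v
    unfolding Cs_def Vq_def
  proof (safe)
    fix q l assume nz: "\<Phi> k v q l \<noteq> 0"
    then show "l < length L" by (auto simp: \<Phi>_def lL split: if_splits)
    from nz have l: "l < s" and rnz: "fv.representation ?Bs (em k v q) (w l) \<noteq> 0" by (auto simp: \<Phi>_def split: if_splits)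
    have q: "q < n"
    proof (rule ccontr)
      assume "\<not> q < n"
      then show False using rnz by (simp add: emZ fv.representation_zero)
    qed
    let ?J = "{l. l < s \<and> in_supp n (L ! l) q k}"
    have "em k v q \<in> fv.span (w ` ?J)" using emF[OF v, of q] Fw[OF q] by simp
    then have "fv.representation ?Bs (em k v q) = fv.representation (w ` ?J) (em k v q)"
      by (intro fv.representation_extend[OF w(2)]) auto
    then have "fv.representation (w ` ?J) (em k v q) (w l) \<noteq> 0" using rnz by simp
    then have "w l \<in> w ` ?J" by (rule fv.representation_ne_zero)
    then show "in_supp n (L ! l) q k" using w(1) l by (auto simp: inj_on_def)
  qed
  have em_rec: "em k v q = (\<Sum>l<s. fsc (\<Phi> k v q l) (w l))" if v: "v \<in> hcomp X k" for k v q
    using rep_sum[OF emS[OF v, of q]] by (simp add: \<Phi>_def)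
  have bij: "bij_betw (\<Phi> k) (hcomp X k) (Cs n L k)" for k
  proof (rule bij_betwI')
    fix u v :: "'k vec" assume u: "u \<in> hcomp X k" and v: "v \<in> hcomp X k"
    show "\<Phi> k u = \<Phi> k v \<longleftrightarrow> u = v"
    proof
      assume e: "\<Phi> k u = \<Phi> k v"
      let ?d = "u + (-1) \<cdot>\<^sub>v v"
      have d: "?d \<in> hcomp X k" using u v by simp
      have "em k ?d q = 0" for q
      proof -
        have "em k ?d q = em k u q + fsc (-1) (em k v q)"
          unfolding em_def using emb_add[OF ctx u, of "(-1) \<cdot>\<^sub>v v" q] emb_smult[OF ctx v, of "-1" q] v by simp
        also have "em k u q = em k v q" using em_rec[OF u, of q] em_rec[OF v, of q] e by simp
        finally show ?thesis by (simp add: fsc_def fun_eq_iff)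
      qed
      then have z: "?d = 0\<^sub>v (gdim X k)" using emb_inj[OF ctx d] by (simp add: em_def)
      show "u = v"
      proof (rule eq_vecI)
        fix i assume "i < dim_vec v"
        then have i: "i < gdim X k" using v by simp
        have "?d $ i = 0" using z i by simp
        then show "u $ i = v $ i" using i u v by simp
      qed (use u v in simp)
    qed simp
  next
    fix u :: "'k vec" assume "u \<in> hcomp X k" then show "\<Phi> k u \<in> Cs n L k" by (rule Cin)
  next
    fix c :: "nat \<Rightarrow> nat \<Rightarrow> 'k" assume c: "c \<in> Cs n L k"
    define x where "x q = (\<Sum>l<s. fsc (c q l) (w l))" for q
    have "x q \<in> F q k" if q: "q < n" for q
      unfolding Fw[OF q] x_def
    proof (rule fv.span_sum)
      fix l assume l: "l \<in> {..<s}"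
      show "fsc (c q l) (w l) \<in> fv.span (w ` {l. l < s \<and> in_supp n (L ! l) q k})"
      proof (cases "c q l = 0")
        case True
        then have z: "fsc (c q l) (w l) = 0" by (simp add: fsc_def zero_fun_def)
        show ?thesis unfolding z by (rule fv.span_zero)
      next
        case False
        then have "in_supp n (L ! l) q k" using c by (auto simp: Cs_def Vq_def)
        then show ?thesis using l by (intro fv.span_scale fv.span_base) auto
      qed
    qed
    then have ex: "\<exists>v. v \<in> hcomp X k \<and> em k v q = x q" if "q < n" for q
      using that unfolding F_def Fl_def[OF ctx] em_def by (metis imageE)
    define vv where "vv q = (SOME v. v \<in> hcomp X k \<and> em k v q = x q)" for q
    have vv: "vv q \<in> hcomp X k \<and> em k (vv q) q = x q" if "q < n" for q
      using ex[OF that] unfolding vv_def by (rule someI_ex)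
    \<comment> \<open>The E_tt of degree 0 isolate single coordinates, so an element with prescribed
      components is built up one coordinate at a time.\<close>
    have "\<exists>v\<in>hcomp X k. \<forall>p<n. em k v p = (if p < t then x p else 0)" if "t \<le> n" for t
      using that
    proof (induction t)
      case 0
      show ?case by (rule bexI[of _ "0\<^sub>v (gdim X k)"]) (auto simp: em_def emb_0[OF ctx])
    next
      case (Suc t)
      then obtain v where v: "v \<in> hcomp X k" "\<forall>p<n. em k v p = (if p < t then x p else 0)" by auto
      have t: "t < n" using Suc by simp
      have vt: "vv t \<in> hcomp X k" "em k (vv t) t = x t" using vv[OF t] by auto
      have c0: "cexp n t t \<le> 0" by (simp add: cexp_def)
      let ?g = "gact X 0 k (Emat n t t) *\<^sub>v vv t"
      have g: "?g \<in> hcomp X k" by (rule gact_vec0[OF ctx Emat_Lam[OF c0] vt(1)])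
      have eg: "em k ?g p = (if p = t then x t else 0)" if "p < n" for p
        using emb_matrix_unit[OF ctx c0 t t vt(1) that] vt(2) by (simp add: em_def)
      have "\<forall>p<n. em k (v + ?g) p = (if p < Suc t then x p else 0)"
        using emb_add[OF ctx v(1) g] v(2) eg by (auto simp: em_def less_Suc_eq)
      then show ?case using v(1) g by (meson add_carrier_vec)
    qed
    from this[of n] obtain v where v: "v \<in> hcomp X k" "\<forall>p<n. em k v p = x p" by auto
    have "\<Phi> k v = c"
    proof (intro ext)
      fix q l
      show "\<Phi> k v q l = c q l"
      proof (cases "q < n \<and> l < s")
        case True
        then show ?thesis using v(2) rep_of[of l "c q"] by (simp add: \<Phi>_def x_def)
      next
        case False
        then show ?thesis using Cs_outside[OF c, of q l] Cs_outside2[OF c, of l q] Cs_outside[OF Cin[OF v(1)], of q l]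
          by (auto simp: lL \<Phi>_def not_less)
      qed
    qed
    then show "\<exists>v\<in>hcomp X k. c = \<Phi> k v" using v(1) by blast
  qed
  have add: "\<Phi> k (u + v) q l = \<Phi> k u q l + \<Phi> k v q l"
    if u: "u \<in> hcomp X k" and v: "v \<in> hcomp X k" for k u v q l
    using emb_add[OF ctx u v, of q] fv.representation_add[OF w(2) emS[OF v, of q] emS[OF u, of q]]
    by (simp add: \<Phi>_def em_def)
  have smult: "\<Phi> k (c \<cdot>\<^sub>v u) q l = c * \<Phi> k u q l" if u: "u \<in> hcomp X k" for k u c q l
    using emb_smult[OF ctx u, of c q] fv.representation_scale[OF w(2) emS[OF u, of q], of c]
    by (simp add: \<Phi>_def em_def)
  have act: "\<Phi> (m + k) (gact X m k D *\<^sub>v u) = act n D (\<Phi> k u)"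
    if D: "D \<in> Lam n m" and u: "u \<in> hcomp X k" for m k D u
  proof (intro ext)
    fix p l
    show "\<Phi> (m + k) (gact X m k D *\<^sub>v u) p l = act n D (\<Phi> k u) p l"
    proof (cases "p < n \<and> l < s")
      case True
      then have "\<Phi> (m + k) (gact X m k D *\<^sub>v u) p l = fv.representation ?Bs (\<Sum>q<n. fsc (D $$ (p,q)) (em k u q)) (w l)"
        using emb_act[OF ctx D u, of p] by (simp add: \<Phi>_def em_def)
      also have "\<dots> = (\<Sum>q<n. fv.representation ?Bs (fsc (D $$ (p,q)) (em k u q)) (w l))"
        by (subst fv.representation_sum[OF w(2)]) (auto intro: fv.span_scale emS[OF u])
      also have "\<dots> = (\<Sum>q<n. D $$ (p,q) * \<Phi> k u q l)"
        using fv.representation_scale[OF w(2) emS[OF u]] True by (simp add: \<Phi>_def)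
      finally show ?thesis using True by (simp add: act_def)
    next
      case False
      then show ?thesis using emZ[of p] by (auto simp: \<Phi>_def act_def fv.representation_zero)
    qed
  qed
  have "\<forall>P\<in>set L. valid n P" using val lL by (metis in_set_conv_nth)
  then have "coord n X L \<Phi>"
    unfolding coord_def using bij add smult act gact_carrier[OF ctx] by auto
  then show ?thesis by (auto simp: types_def)
qed


subsection \<open>Indecomposable, projective and injective modules\<close>

lemma is_zero_iff_Nil:
  fixes X :: "'k::field gmod"
  assumes n: "n \<ge> 3" and X: "types n X L"
  shows "is_zero X \<longleftrightarrow> L = []"
proof
  assume z: "is_zero X"
  show "L = []"
  proof (rule ccontr)
    assume "L \<noteq> []"
    then have l: "0 < length L" by simp
    obtain q k where q: "q < n" "\<And>P. in_supp n P q k \<longleftrightarrow> fst (L ! 0) \<le> fst P" using even_position[of n] n by (metis gr_zeroI not_numeral_le_zero)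
    let ?u = "\<lambda>l::nat. if l = 0 then 1 else (0::'k)"
    have "?u \<in> Vq n L q k" using l q by (auto simp: Vq_def)
    then obtain v where v: "v \<in> hcomp X k" "coords n X L k v = (\<lambda>q'. if q' = q then ?u else (\<lambda>_. 0))"
      using elem_at_position[OF X] by blast
    have "v = 0\<^sub>v (gdim X k)" using v(1) z by (intro eq_vecI) (auto simp: is_zero_def)
    then have "coords n X L k v = (\<lambda>_ _. 0)" using coord_zero[OF types_coord[OF X]] by simp
    then have "coords n X L k v q 0 = 0" by simp
    then show False by (simp add: v(2))
  qed
next
  assume L: "L = []"
  show "is_zero X"
    unfolding is_zero_def
  proof (rule allI, rule ccontr)
    fix k assume nz: "gdim X k \<noteq> 0"
    have "coords n X L k v = (\<lambda>_ _. 0)" if "v \<in> hcomp X k" for v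
      using coords_Vq[OF X that] L by (auto simp: Vq_def fun_eq_iff)
    then have "(unit_vec (gdim X k) 0 :: 'k vec) = 0\<^sub>v (gdim X k)"
      using coord_eq0[OF types_coord[OF X], of "unit_vec (gdim X k) 0" k] by simp
    then show False using nz by simp
  qed
qed

text \<open>The identity on \<open>Y\<close> factors through rank one: C i 0 * D 0 j is 1 for i = j
  and 0 otherwise, which is impossible for two indices. For the one remaining index both entries are
  nonzero, so the two pairs bound each other.\<close>

lemma iso_types_single:
  fixes X Y :: "'k::field gmod"
  assumes n: "n \<ge> 3" and X: "types n X [P]" and Y: "types n Y L" and iso: "is_iso n X Y"
  shows "L = [P]"
proof -
  obtain C D :: "nat \<Rightarrow> nat \<Rightarrow> 'k" where g: "graded [P] L C" "graded L [P] D"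
    and DC: "mprod (length L) D C 0 0 = idc 0 0"
    and CD: "\<forall>i<length L. \<forall>j<length L. mprod (length [P]) C D i j = idc i j"
    using iso_matrix[OF n X Y iso] by auto
  have cd: "C i 0 * D 0 j = (if i = j then 1 else 0)" if "i < length L" "j < length L" for i j
    using CD that by (simp add: mprod_def idc_def)
  have "length L \<noteq> 0" using DC by (auto simp: mprod_def idc_def)
  moreover have "\<not> 2 \<le> length L"
  proof
    assume "2 \<le> length L"
    then have l: "0 < length L" "1 < length L" by auto
    show False using cd[OF l(1) l(1)] cd[OF l(2) l(2)] cd[OF l(1) l(2)] by auto
  qed
  ultimately have "length L = 1" by linarith
  then obtain Q where L: "L = [Q]" by (auto simp: length_Suc_conv)
  have "C 0 0 \<noteq> 0" "D 0 0 \<noteq> 0" using cd[of 0 0] L by auto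
  then have "ple P Q" "ple Q P" using g L by (auto simp: graded_def)
  then show ?thesis using L ple_antisym by blast
qed

lemma indec_single:
  fixes X :: "'k::field gmod"
  assumes n: "n \<ge> 3" and X: "types n X [P]" and CM: "is_CM n X"
  shows "indec n X"
  unfolding indec_def
proof (intro conjI allI impI CM)
  show "\<not> is_zero X" using is_zero_iff_Nil[OF n X] by simp
  fix Y Z :: "'k gmod" assume Y: "is_CM n Y" and Z: "is_CM n Z" and iso: "is_iso n X (dsum Y Z)"
  obtain L1 L2 where L: "types n Y L1" "types n Z L2" using CM_types[OF n] Y Z by metis
  have "L1 @ L2 = [P]" by (rule iso_types_single[OF n X types_dsum[OF L] iso])
  then have "L1 = [] \<or> L2 = []" by (cases L1) auto
  then show "is_zero Y \<or> is_zero Z" using is_zero_iff_Nil[OF n] L by blast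
qed

text \<open>If the list begins with \<open>P\<close> and continues with \<open>L'\<close>, the
  module is isomorphic to \<open>dsum (thin n P) (thin_sum n L')\<close>, having the same list;
  indecomposability then makes \<open>L'\<close> empty.\<close>

lemma indec_types:
  fixes X :: "'k::field gmod"
  assumes n: "n \<ge> 3" and X: "types n X L" and ind: "indec n X"
  shows "\<exists>P. L = [P]"
proof (cases L)
  case Nil
  then show ?thesis using ind is_zero_iff_Nil[OF n X] by (simp add: indec_def)
next
  case (Cons P L')
  have val: "\<forall>P\<in>set L. valid n P" using coord_valid[OF types_coord[OF X]] by blast
  then have vP: "valid n P" and vL': "\<forall>P\<in>set L'. valid n P" using Cons by auto
  let ?Y = "thin n P :: 'k gmod" and ?Z = "thin_sum n L' :: 'k gmod"
  note tP = types_thin[OF n vP, where 'k='k] and cP = thin_CM[OF n vP, where 'k='k]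
  have tZ: "types n ?Z L'" "is_CM n ?Z" using thin_sum_types_CM[OF n vL'] by auto
  have "types n (dsum ?Y ?Z) L" using types_dsum[OF tP tZ(1)] Cons by simp
  then have "is_iso n X (dsum ?Y ?Z)" by (rule types_iso[OF n X])
  then have "is_zero ?Y \<or> is_zero ?Z" using ind cP tZ(2) unfolding indec_def by blast
  then have "L' = []" using is_zero_iff_Nil[OF n tP] is_zero_iff_Nil[OF n tZ(1)] by simp
  then show ?thesis using Cons by blast
qed

lemma ses_matrices:
  assumes n: "n \<ge> 3" and X: "types n X L" and Y: "types n Y L'" and Z: "types n Z L''" and s: "ses n X Y Z f g"
  shows "\<exists>C D. hrep n X L Y L' f C \<and> hrep n Y L' Z L'' g D \<and> (\<forall>q k. exact_at n L L' L'' C D q k)"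
proof -
  have h: "is_hom n X Y f" "is_hom n Y Z g" "is_CM n X" "is_CM n Y" "is_CM n Z" using s by (auto simp: ses_def)
  obtain C where C: "hrep n X L Y L' f C" using hom_matrix[OF n X Y h(1)] by blast
  obtain D where D: "hrep n Y L' Z L'' g D" using hom_matrix[OF n Y Z h(2)] by blast
  show ?thesis using C D ses_iff[OF n C D h(3-5)] s by blast
qed

lemma Vq_single: "in_supp n P q k \<Longrightarrow> (\<lambda>l. if l = 0 then c else 0) \<in> Vq n [P] q k"
  by (auto simp: Vq_def)

text \<open>A nonzero entry between copies of the same rank-one module is an invertible scalar; its
  inverse, placed at \<open>l\<close>, is a section. The next lemma is the dual.\<close>

lemma section_ex:
  assumes n: "n \<ge> 3" and g: "hrep n Y L Z [P] g D" and l: "l < length L" "D 0 l \<noteq> 0" "L ! l = P"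
  shows "split_epi n Y Z g"
proof -
  let ?S = "\<lambda>(i::nat) (j::nat). if i = l then 1 / D 0 l else 0"
  have "graded [P] L ?S" using l by (auto simp: graded_def)
  moreover have "mprod (length L) D ?S 0 0 = idc 0 0"
    using l by (simp add: mprod_def idc_def if_distrib[of "\<lambda>x. _ * x"] cong: if_cong)
  ultimately show ?thesis by (subst split_epi_iff[OF n g]) auto
qed

lemma retraction_ex:
  assumes n: "n \<ge> 3" and f: "hrep n X [P] Y L f C" and l: "l < length L" "C l 0 \<noteq> 0" "L ! l = P"
  shows "split_mono n X Y f"
proof -
  let ?S = "\<lambda>(i::nat) (j::nat). if j = l then 1 / C l 0 else 0"
  have "graded L [P] ?S" using l by (auto simp: graded_def)
  moreover have "mprod (length L) ?S C 0 0 = idc 0 0"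
    using l by (simp add: mprod_def idc_def if_distrib[of "\<lambda>x. x * _"] cong: if_cong)
  ultimately show ?thesis by (subst split_mono_iff[OF n f]) auto
qed

text \<open>The condition says that \<open>Z\<close> is freely generated by its element at the
  position (\<open>q\<close>, \<open>k\<close>): a lift of that element along \<open>g\<close> has
  components only in summands above \<open>P\<close>, so its coefficients already form a graded
  section.\<close>

lemma proj_criterion:
  fixes Z :: "'k::field gmod"
  assumes n: "n \<ge> 3" and Z: "types n Z [P]" and CM: "is_CM n Z" and s: "in_supp n P q k"
    and least: "\<And>P'. valid n P' \<Longrightarrow> in_supp n P' q k \<Longrightarrow> ple P P'"
  shows "proj n Z"
  unfolding proj_def
proof (intro conjI allI impI CM)
  fix X Y :: "'k gmod" and f g assume ses: "ses n X Y Z f g"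
  obtain L0 L where L: "types n X L0" "types n Y L" using CM_types[OF n] ses unfolding ses_def by metis
  obtain C D where g: "hrep n Y L Z [P] g D" and ex: "\<forall>q k. exact_at n L0 L [P] C D q k"
    using ses_matrices[OF n L Z ses] by blast
  obtain v where v: "v \<in> Vq n L q k" "mapp 1 (length L) D v = (\<lambda>l. if l = 0 then 1 else 0)"
  proof -
    from exact_surj[OF ex[rule_format] Vq_single[OF s, of 1]] show thesis using that by auto
  qed
  have "graded [P] L (\<lambda>i j. v i)"
    using v(1) least types_valid[OF L(2)] by (auto simp: graded_def Vq_def)
  moreover have "mprod (length L) D (\<lambda>i j. v i) 0 0 = 1"
    using fun_cong[OF v(2), of 0] by (simp add: mapp_def mprod_def)
  ultimately show "split_epi n Y Z g"
    by (subst split_epi_iff[OF n g]) (auto simp: idc_def)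
qed

text \<open>The position (\<open>q\<close>, \<open>k\<close>) is missing from \<open>P\<close> but
  present in everything strictly above \<open>P\<close>. If \<open>f\<close> did not split, the
  image of a generator would have components only strictly above \<open>P\<close> and so would exist
  at (\<open>q\<close>, \<open>k\<close>) too. There it lies in the kernel of \<open>D\<close> and
  has to come from \<open>X\<close>, which is zero at that position.\<close>

lemma inj_criterion:
  fixes X :: "'k::field gmod"
  assumes n: "n \<ge> 3" and X: "types n X [P]" and CM: "is_CM n X" and s: "\<not> in_supp n P q k"
    and above: "\<And>P'. valid n P' \<Longrightarrow> ple P P' \<Longrightarrow> P' \<noteq> P \<Longrightarrow> in_supp n P' q k"
  shows "inj_obj n X"
  unfolding inj_obj_def
proof (intro conjI allI impI CM)
  fix Y Z :: "'k gmod" and f g assume ses: "ses n X Y Z f g"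
  obtain L L2 where L: "types n Y L" "types n Z L2" using CM_types[OF n] ses unfolding ses_def by metis
  obtain C D where f: "hrep n X [P] Y L f C" and ex: "\<forall>q k. exact_at n [P] L L2 C D q k"
    using ses_matrices[OF n X L ses] by blast
  show "split_mono n X Y f"
  proof (rule ccontr)
    assume ns: "\<not> split_mono n X Y f"
    \<comment> \<open>A position where \<open>X\<close> is nonzero, used to produce the vector
      \<open>v\<close>; its coefficients are then moved to (\<open>q\<close>,
      \<open>k\<close>).\<close>
    obtain q' k' where q': "q' < n" "\<And>Q. in_supp n Q q' k' \<longleftrightarrow> fst P \<le> fst Q" using even_position[of n] n by (metis gr_zeroI not_numeral_le_zero)
    let ?u = "\<lambda>l::nat. if l = 0 then 1 else (0::'k)"
    have u: "?u \<in> Vq n [P] q' k'" by (rule Vq_single) (simp add: q')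
    define v where "v = mapp (length L) 1 C ?u"
    have vl: "v l = (if l < length L then C l 0 else 0)" for l
      by (simp add: v_def mapp_def)
    have vV: "v \<in> Vq n L q' k'" using graded_mapp[OF hrep_graded[OF f] u] by (simp add: v_def)
    have v0: "v \<noteq> (\<lambda>_. 0)"
    proof
      assume "v = (\<lambda>_. 0)"
      then have "mapp (length L) (length [P]) C ?u = (\<lambda>_. 0)" by (simp add: v_def)
      then have "?u = (\<lambda>_. 0)" using exact_inj[of n "[P]" L L2 C D q' k' ?u] ex u by blast
      then have "?u 0 = 0" by metis
      then show False by simp
    qed
    have Dv: "mapp (length L2) (length L) D v = (\<lambda>_. 0)"
    proof -
      have "mapp (length L2) (length L) D v = (\<lambda>_. 0) \<longleftrightarrow> (\<exists>u\<in>Vq n [P] q' k'. mapp (length L) (length [P]) C u = v)"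
        by (rule exact_ker[OF ex[rule_format] vV])
      moreover have "mapp (length L) (length [P]) C ?u = v" by (simp add: v_def)
      ultimately show ?thesis using u by blast
    qed
    have "v \<in> Vq n L q k"
      unfolding Vq_def
    proof safe
      fix l assume "v l \<noteq> 0"
      then have l: "l < length L" "C l 0 \<noteq> 0" by (auto simp: vl split: if_splits)
      then have "ple P (L ! l)" using hrep_graded[OF f] by (auto simp: graded_def)
      moreover have "L ! l \<noteq> P" using retraction_ex[OF n f l] ns by blast
      ultimately show "in_supp n (L ! l) q k" using above types_valid[OF L(1) l(1)] by blast
      show "l < length L" by (rule l(1))
    qed
    then have "\<exists>u\<in>Vq n [P] q k. mapp (length L) (length [P]) C u = v"
      using exact_ker[OF ex[rule_format]] Dv by metis
    then obtain u' where u': "u' \<in> Vq n [P] q k" "mapp (length L) 1 C u' = v" by auto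
    have "u' = (\<lambda>_. 0)" using u'(1) s by (auto simp: Vq_def fun_eq_iff)
    then show False using u'(2) v0 by simp
  qed
qed

text \<open>At the extreme gaps validity ties one coordinate to the other. If j = i + 1, then i
  \<le> fst P' already gives j \<le> snd P', and a strictly larger pair must raise the second
  coordinate. If j = i + n - 1, then j \<le> snd P' gives i \<le> fst P', and a strictly larger pair
  must raise the first.\<close>

lemma proj_inj_side:
  fixes X :: "'k::field gmod"
  assumes n: "n \<ge> 3" and X: "types n X [(i, j)]" and CM: "is_CM n X" and ij: "j = i + 1 \<or> j = i + int n - 1"
  shows "proj n X" "inj_obj n X"
proof -
  have n0: "n > 0" using n by simp
  consider (1) "j = i + 1" | (2) "j = i + int n - 1" using ij by blast
  then show "proj n X"
  proof cases
    case 1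
    obtain q k where q: "q < n" "\<And>P. in_supp n P q k \<longleftrightarrow> i \<le> fst P" using even_position[OF n0] by metis
    show ?thesis by (rule proj_criterion[OF n X CM, of q k]) (auto simp: q 1 valid_def ple_def)
  next
    case 2
    obtain q k where q: "q < n" "\<And>P. in_supp n P q k \<longleftrightarrow> j \<le> snd P" using odd_position[OF n0] by metis
    show ?thesis by (rule proj_criterion[OF n X CM, of q k]) (auto simp: q 2 valid_def ple_def)
  qed
  consider (1) "j = i + 1" | (2) "j = i + int n - 1" using ij by blast
  then show "inj_obj n X"
  proof cases
    case 1
    obtain q k where q: "q < n" "\<And>P. in_supp n P q k \<longleftrightarrow> j + 1 \<le> snd P" using odd_position[OF n0] by metis
    show ?thesis by (rule inj_criterion[OF n X CM, of q k]) (auto simp: q 1 valid_def ple_def)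
  next
    case 2
    obtain q k where q: "q < n" "\<And>P. in_supp n P q k \<longleftrightarrow> i + 1 \<le> fst P" using even_position[OF n0] by metis
    show ?thesis by (rule inj_criterion[OF n X CM, of q k]) (auto simp: q 2 valid_def ple_def)
  qed
qed

section \<open>Construction of the Auslander-Reiten sequences\<close>

lemma sum_2: "(\<Sum>l<(2::nat). f l) = f 0 + (f 1 :: 'k::field)"
  by (simp add: numeral_2_eq_2)

text \<open>Each position tests one coordinate of a pair, so the supports of the middle pairs have
  the support of (i, j) as union and that of (i - 1, j - 1) as intersection; the matrices (1, 1) and
  (1, -1) are therefore exact. A pair below (i, j) and different from it lies below one of the
  middle pairs, which lets non-split morphisms factor; the left side is dual.\<close>

lemma almost_split_ex:
  fixes X Y Z :: "'k::field gmod"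
  assumes n: "n \<ge> 3" and X: "types n X [(i - 1, j - 1)]" and Y: "types n Y [(i - 1, j), (i, j - 1)]" and Z: "types n Z [(i, j)]"
    and CM: "is_CM n X" "is_CM n Y" "is_CM n Z"
  shows "\<exists>f g. almost_split n X Y Z f g"
proof -
  let ?L = "[(i - 1, j - 1)]" and ?L' = "[(i - 1, j), (i, j - 1)]" and ?L'' = "[(i, j)]"
  define C where "C = (\<lambda>(a::nat) (b::nat). 1 :: 'k)"
  define D where "D = (\<lambda>(a::nat) (b::nat). if b = 0 then 1 else (-1 :: 'k))"
  have "graded ?L ?L' C" by (auto simp: graded_def ple_def less_Suc_eq C_def nth_Cons')
  then obtain f where f: "hrep n X ?L Y ?L' f C" using matrix_hom[OF X Y] by blast
  have "graded ?L' ?L'' D" by (auto simp: graded_def ple_def less_Suc_eq D_def nth_Cons')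
  then obtain g where g: "hrep n Y ?L' Z ?L'' g D" using matrix_hom[OF Y Z] by blast
  have mC: "mapp (length ?L') (length ?L) C u = (\<lambda>a. if a < 2 then u 0 else 0)" for u by (auto simp: mapp_def C_def)
  have mD: "mapp (length ?L'') (length ?L') D v = (\<lambda>a. if a < 1 then v 0 - v 1 else 0)" for v
    by (auto simp: mapp_def D_def sum_2 numeral_2_eq_2)
  have "exact_at n ?L ?L' ?L'' C D q k" for q k
    unfolding exact_at_def mC mD
  proof (intro conjI ballI impI)
    fix u :: "nat \<Rightarrow> 'k" assume u: "u \<in> Vq n ?L q k" "(\<lambda>a::nat. if a < 2 then u 0 else 0) = (\<lambda>_. 0)"
    have "u 0 = 0" using fun_cong[OF u(2), of 0] by simp
    then show "u = (\<lambda>_. 0)" using u(1) by (auto simp: Vq_def fun_eq_iff)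
  next
    fix w :: "nat \<Rightarrow> 'k" assume w: "w \<in> Vq n ?L'' q k"
    have w0: "w l = 0" if "0 < l" for l using w that by (auto simp: Vq_def)
    show "\<exists>v\<in>Vq n ?L' q k. (\<lambda>a. if a < 1 then v 0 - v 1 else 0) = w"
    proof (cases "in_supp n (i - 1, j) q k")
      case True
      then have "(\<lambda>l. if l = 0 then w 0 else 0) \<in> Vq n ?L' q k" by (auto simp: Vq_def)
      then show ?thesis using w0 by (intro bexI[of _ "\<lambda>l. if l = 0 then w 0 else 0"]) (auto simp: fun_eq_iff)
    next
      case False
      then have "in_supp n (i, j - 1) q k" if "w 0 \<noteq> 0" using w that by (auto simp: Vq_def in_supp_def split: if_splits)
      then have "(\<lambda>l. if l = 1 then - w 0 else 0) \<in> Vq n ?L' q k" by (auto simp: Vq_def)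
      then show ?thesis using w0 by (intro bexI[of _ "\<lambda>l. if l = 1 then - w 0 else 0"]) (auto simp: fun_eq_iff)
    qed
  next
    fix v :: "nat \<Rightarrow> 'k" assume v: "v \<in> Vq n ?L' q k"
    show "(\<lambda>a. if a < 1 then v 0 - v 1 else 0) = (\<lambda>_::nat. 0) \<longleftrightarrow> (\<exists>u\<in>Vq n ?L q k. (\<lambda>a. if a < 2 then u 0 else 0) = v)"
    proof
      assume "(\<lambda>a. if a < 1 then v 0 - v 1 else 0) = (\<lambda>_::nat. 0)"
      then have e: "v 0 = v 1" by (metis less_one right_minus_eq)
      have "in_supp n (i - 1, j - 1) q k" if "v 0 \<noteq> 0"
      proof -
        have "in_supp n (?L' ! 0) q k" "in_supp n (?L' ! 1) q k" using Vq_supp[OF v, of 0] Vq_supp[OF v, of 1] that e by auto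
        then show ?thesis by (auto simp: in_supp_def split: if_splits)
      qed
      then have "(\<lambda>l. if l = 0 then v 0 else 0) \<in> Vq n ?L q k" by (auto simp: Vq_def)
      moreover have "(\<lambda>a. if a < 2 then v 0 else 0) = v"
      proof
        fix a show "(if a < 2 then v 0 else 0) = v a"
          using v e by (cases "a < 2") (auto simp: Vq_def less_Suc_eq numeral_2_eq_2)
      qed
      ultimately show "\<exists>u\<in>Vq n ?L q k. (\<lambda>a. if a < 2 then u 0 else 0) = v"
        by (intro bexI[of _ "\<lambda>l. if l = 0 then v 0 else 0"]) simp_all
    qed auto
  qed
  then have ses: "ses n X Y Z f g" by (subst ses_iff[OF n f g CM]) blast
  have nse: "\<not> split_epi n Y Z g"
  proof
    assume "split_epi n Y Z g"
    then obtain S where S: "graded ?L'' ?L' S" "mprod 2 D S 0 0 = idc 0 0"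
      using split_epi_iff[OF n g] by (auto simp: numeral_2_eq_2)
    have "S 0 0 = 0" "S 1 0 = 0" using S(1) by (auto simp: graded_def ple_def less_Suc_eq)
    then show False using S(2) by (simp add: mprod_def sum_2 idc_def)
  qed
  have nsm: "\<not> split_mono n X Y f"
  proof
    assume "split_mono n X Y f"
    then obtain S where S: "graded ?L' ?L S" "mprod 2 S C 0 0 = idc 0 0"
      using split_mono_iff[OF n f] by (auto simp: numeral_2_eq_2)
    have "S 0 0 = 0" "S 0 1 = 0" using S(1) by (auto simp: graded_def ple_def less_Suc_eq)
    then show False using S(2) by (simp add: mprod_def sum_2 idc_def)
  qed
  have right: "\<exists>t. is_hom n W Y t \<and> comp g t = h" if W: "is_CM n W" and h: "is_hom n W Z h" and ns: "\<not> split_epi n W Z h" for W h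
  proof -
    obtain L where tW: "types n W L" using CM_types[OF n W] by blast
    obtain H where H: "hrep n W L Z ?L'' h H" using hom_matrix[OF n tW Z h] by blast
    have Hl: "ple (L ! l) (i, j) \<and> L ! l \<noteq> (i, j)" if "l < length L" "H 0 l \<noteq> 0" for l
      using that hrep_graded[OF H] section_ex[OF n H that] ns by (auto simp: graded_def)
    \<comment> \<open>Each entry goes to the first middle summand if it fits there and otherwise to
      the second, where the sign in \<open>D\<close> has to be undone.\<close>
    define T where "T = (\<lambda>a l. if a = (0::nat) then (if ple (L ! l) (i - 1, j) then H 0 l else 0)
      else (if ple (L ! l) (i - 1, j) then 0 else - H 0 l))"
    have "ple (L ! l) (i, j - 1)" if "l < length L" "H 0 l \<noteq> 0" "\<not> ple (L ! l) (i - 1, j)" for l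
      using Hl[OF that(1,2)] that(3) by (auto simp: ple_def prod_eq_iff)
    then have "graded L ?L' T" by (auto simp: graded_def T_def less_Suc_eq split: if_splits)
    then obtain t where t: "hrep n W L Y ?L' t T" using matrix_hom[OF tW Y] by blast
    have "comp g t = h"
      by (rule hrep_eq[OF hrep_comp[OF n t g] H]) (auto simp: mprod_def D_def T_def)
    then show ?thesis using hrep_hom[OF t] by blast
  qed
  have left: "\<exists>t. is_hom n Y W t \<and> comp t f = h" if W: "is_CM n W" and h: "is_hom n X W h" and ns: "\<not> split_mono n X W h" for W h
  proof -
    obtain L where tW: "types n W L" using CM_types[OF n W] by blast
    obtain H where H: "hrep n X ?L W L h H" using hom_matrix[OF n X tW h] by blast
    have Hl: "ple (i - 1, j - 1) (L ! l) \<and> L ! l \<noteq> (i - 1, j - 1)" if "l < length L" "H l 0 \<noteq> 0" for l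
      using that hrep_graded[OF H] retraction_ex[OF n H that] ns by (auto simp: graded_def)
    define T where "T = (\<lambda>l a. if a = (0::nat) then (if ple (i - 1, j) (L ! l) then H l 0 else 0)
      else (if ple (i - 1, j) (L ! l) then 0 else H l 0))"
    have "ple (i, j - 1) (L ! l)" if "l < length L" "H l 0 \<noteq> 0" "\<not> ple (i - 1, j) (L ! l)" for l
      using Hl[OF that(1,2)] that(3) by (auto simp: ple_def prod_eq_iff)
    then have "graded ?L' L T" by (auto simp: graded_def T_def less_Suc_eq split: if_splits)
    then obtain t where t: "hrep n Y ?L' W L t T" using matrix_hom[OF Y tW] by blast
    have "comp t f = h"
      by (rule hrep_eq[OF hrep_comp[OF n f t] H]) (auto simp: mprod_def C_def T_def)
    then show ?thesis using hrep_hom[OF t] by blast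
  qed
  show ?thesis
    using ses nse nsm left right unfolding almost_split_def left_almost_split_def right_almost_split_def by blast
qed


subsection \<open>Extensions and almost split sequences\<close>

text \<open>A high degree shows that the middle term has rank two. At every position the support of
  \<open>P'\<close> is covered by those of \<open>Q\<close> and \<open>R\<close>, and that of
  \<open>P\<close> contains their intersection. Since non-splitness keeps \<open>Q\<close> and
  \<open>R\<close> different from \<open>P'\<close>, each of them takes one coordinate from
  \<open>P'\<close> and the other from \<open>P\<close>.\<close>

lemma nonsplit_ses:
  fixes X Y Z :: "'k::field gmod"
  assumes n: "n \<ge> 3" and X: "types n X [P]" and Y: "types n Y L" and Z: "types n Z [P']"
    and ses: "ses n X Y Z f g" and ns: "\<not> split_epi n Y Z g"
  shows "fst P < fst P' \<and> fst P' < snd P \<and> snd P < snd P' \<and> snd P' < fst P + int n \<and>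
    (L = [(fst P', snd P), (fst P, snd P')] \<or> L = [(fst P, snd P'), (fst P', snd P)])"
proof -
  have n0: "n > 0" using n by simp
  obtain C D where f: "hrep n X [P] Y L f C" and g: "hrep n Y L Z [P'] g D" and ex: "\<forall>q k. exact_at n [P] L [P'] C D q k"
    using ses_matrices[OF n X Y Z ses] by blast
  define c where "c l = C l 0" for l
  define d where "d l = D 0 l" for l
  define r where "r = length L"
  have mC: "mapp (length L) (length [P]) C u = (\<lambda>l. if l < r then c l * u 0 else 0)" for u
    by (auto simp: mapp_def c_def r_def)
  have mD: "mapp (length [P']) (length L) D w = (\<lambda>a. if a = 0 then \<Sum>l<r. d l * w l else 0)" for w
    by (auto simp: mapp_def d_def r_def fun_eq_iff)
  note mC = mC mC[simplified] and mD = mD mD[simplified]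
  have cP: "ple P (L ! l)" if "l < r" "c l \<noteq> 0" for l using hrep_graded[OF f] that by (auto simp: graded_def c_def r_def)
  have dP: "ple (L ! l) P'" if "l < r" "d l \<noteq> 0" for l using hrep_graded[OF g] that by (auto simp: graded_def d_def r_def)
  have dne: "L ! l \<noteq> P'" if "l < r" "d l \<noteq> 0" for l
    using section_ex[OF n g, of l] that ns by (auto simp: d_def r_def)
  have surj: "\<exists>w. (\<forall>l. w l \<noteq> 0 \<longrightarrow> l < r \<and> in_supp n (L ! l) q k) \<and> (\<Sum>l<r. d l * w l) = 1" if s: "in_supp n P' q k" for q k
  proof -
    obtain w where w: "w \<in> Vq n L q k" "mapp (length [P']) (length L) D w = (\<lambda>l. if l = 0 then 1 else 0)"
      using exact_surj[OF ex[rule_format] Vq_single[OF s, of 1]] by blast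
    have "(\<Sum>l<r. d l * w l) = 1" using fun_cong[OF w(2), of 0] unfolding mD by simp
    then show ?thesis using w(1) by (auto simp: Vq_def r_def)
  qed
  have ker: "\<exists>x. (x \<noteq> 0 \<longrightarrow> in_supp n P q k) \<and> (\<forall>l<r. w l = c l * x)"
    if w: "\<forall>l. w l \<noteq> 0 \<longrightarrow> l < r \<and> in_supp n (L ! l) q k" and z: "(\<Sum>l<r. d l * w l) = 0" for w q k
  proof -
    have wV: "w \<in> Vq n L q k" using w by (auto simp: Vq_def r_def)
    have "mapp (length [P']) (length L) D w = (\<lambda>_. 0)" unfolding mD using z by auto
    then obtain u where u: "u \<in> Vq n [P] q k" "mapp (length L) (length [P]) C u = w"
      using exact_ker[OF ex[rule_format] wV] by blast
    have "w l = c l * u 0" if "l < r" for l using fun_cong[OF u(2), of l] that by (simp add: mC)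
    then show ?thesis using u(1) by (intro exI[of _ "u 0"]) (auto simp: Vq_def)
  qed
  \<comment> \<open>In degree \<open>N\<close> all summands are present, and at coordinate 0 the
    sequence is an exact sequence of vector spaces with ends of dimension one.\<close>
  obtain N where N: "\<And>q k Q. Q \<in> set (P # P' # L) \<Longrightarrow> q < n \<Longrightarrow> k \<ge> N \<Longrightarrow> in_supp n Q q k" using in_supp_high_list by blast
  have hi: "in_supp n P 0 N" "in_supp n P' 0 N" "\<And>l. l < r \<Longrightarrow> in_supp n (L ! l) 0 N" using N[of _ 0 N] n0 by (auto simp: r_def)
  let ?u = "\<lambda>l::nat. if l = 0 then 1 else (0::'k)"
  have u: "?u \<in> Vq n [P] 0 N" by (rule Vq_single[OF hi(1)])
  have c_ex: "\<exists>l<r. c l \<noteq> 0"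
  proof (rule ccontr)
    assume "\<not> (\<exists>l<r. c l \<noteq> 0)"
    then have "mapp (length L) (length [P]) C ?u = (\<lambda>_. 0)" by (auto simp: mC)
    then have "?u = (\<lambda>_. 0)" using exact_inj ex u by blast
    then have "?u 0 = 0" by metis
    then show False by simp
  qed
  have dc: "(\<Sum>l<r. d l * c l) = 0"
  proof -
    have v: "mapp (length L) (length [P]) C ?u \<in> Vq n L 0 N" using graded_mapp[OF hrep_graded[OF f] u] .
    then have "mapp (length [P']) (length L) D (mapp (length L) (length [P]) C ?u) = (\<lambda>_. 0)"
      using exact_ker[OF ex[rule_format] v] u by blast
    from fun_cong[OF this, of 0] show ?thesis by (simp add: mC mD)
  qed
  have d_ex: "\<exists>l<r. d l \<noteq> 0"
  proof (rule ccontr)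
    assume a: "\<not> (\<exists>l<r. d l \<noteq> 0)"
    obtain w where "(\<Sum>l<r. d l * w l) = 1" using surj[OF hi(2)] by blast
    moreover have "(\<Sum>l<r. d l * w l) = 0" using a by (intro sum.neutral) auto
    ultimately show False by simp
  qed
  then obtain l1 where l1: "l1 < r" "d l1 \<noteq> 0" by blast
  \<comment> \<open>In degree \<open>N\<close> the kernel of \<open>D\<close> is the line through
    \<open>c\<close>. A kernel vector supported on \<open>l\<close> and \<open>l1\<close> is a
    multiple of \<open>c\<close>, so \<open>c l\<close> is nonzero and \<open>c\<close> vanishes
    away from \<open>l\<close> and \<open>l1\<close>.\<close>
  have kl: "\<exists>x. x \<noteq> 0 \<and> c l * x = 1 \<and> (\<forall>m<r. m \<noteq> l \<longrightarrow> m \<noteq> l1 \<longrightarrow> c m = 0)" if l: "l < r" "l \<noteq> l1" for l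
  proof -
    define w where "w m = (if m = l then 1 else if m = l1 then - d l / d l1 else 0)" for m
    have "(\<Sum>m<r. d m * w m) = (\<Sum>m\<in>{l, l1}. d m * w m)"
      using l l1 by (intro sum.mono_neutral_right) (auto simp: w_def)
    also have "\<dots> = 0" using l l1 by (simp add: w_def)
    finally have z: "(\<Sum>m<r. d m * w m) = 0" .
    have "\<forall>m. w m \<noteq> 0 \<longrightarrow> m < r \<and> in_supp n (L ! m) 0 N" using hi(3) l l1 by (auto simp: w_def split: if_splits)
    then obtain x where x: "\<forall>m<r. w m = c m * x" using ker[OF _ z] by blast
    have "c l * x = 1" using x[rule_format, OF l(1)] by (simp add: w_def)
    moreover then have "x \<noteq> 0" by auto
    moreover then have "c m = 0" if "m < r" "m \<noteq> l" "m \<noteq> l1" for m using x[rule_format, OF that(1)] that by (simp add: w_def)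
    ultimately show ?thesis by blast
  qed
  have r2: "r = 2"
  proof -
    have "r \<noteq> 0" using l1 by auto
    moreover have "r \<noteq> 1"
    proof
      assume "r = 1"
      then show False using c_ex dc l1 by auto
    qed
    moreover have "\<not> r \<ge> 3"
    proof
      \<comment> \<open>Two indices other than \<open>l1\<close> contradict each other:
        \<open>kl\<close> for one of them makes \<open>c\<close> vanish at the other.\<close>
      assume r3: "r \<ge> 3"
      obtain a b where ab: "a < r" "b < r" "a \<noteq> b" "a \<noteq> l1" "b \<noteq> l1"
      proof -
        consider "l1 = 0" | "l1 = 1" | "l1 \<ge> 2" by linarith
        then show thesis using r3 that[of 1 2] that[of 0 2] that[of 0 1] by cases auto
      qed
      show False using kl[OF ab(1,4)] kl[OF ab(2,5)] ab by auto
    qed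
    ultimately show ?thesis by linarith
  qed
  define Q where "Q = L ! 0"
  define R where "R = L ! 1"
  have L: "L = [Q, R]" using r2 unfolding Q_def R_def r_def by (auto simp: length_Suc_conv numeral_2_eq_2)
  have dc2: "d 0 * c 0 + d 1 * c 1 = 0" using dc r2 by (simp add: sum_2)
  have surj': "\<exists>w0 w1. (w0 \<noteq> 0 \<longrightarrow> in_supp n Q q k) \<and> (w1 \<noteq> 0 \<longrightarrow> in_supp n R q k) \<and> d 0 * w0 + d 1 * w1 = 1" if s: "in_supp n P' q k" for q k
  proof -
    obtain w where w: "\<forall>l. w l \<noteq> 0 \<longrightarrow> l < r \<and> in_supp n (L ! l) q k" "(\<Sum>l<r. d l * w l) = 1" using surj[OF s] by blast
    show ?thesis using w r2 by (intro exI[of _ "w 0"] exI[of _ "w 1"]) (auto simp: Q_def R_def sum_2)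
  qed
  \<comment> \<open>Otherwise d 1 = 0 and \<open>Q\<close> alone covers \<open>P'\<close> at every
    position, which forces Q = P'.\<close>
  have c0: "c 0 \<noteq> 0"
  proof
    assume z: "c 0 = 0"
    then have "c 1 \<noteq> 0" using c_ex r2 by (metis less_2_cases One_nat_def)
    then have d1: "d 1 = 0" using dc2 z by simp
    then have d0: "d 0 \<noteq> 0" using d_ex r2 by (metis less_2_cases One_nat_def)
    have "in_supp n Q q k" if "in_supp n P' q k" for q k using surj'[OF that] d1 by force
    then have "ple P' Q" using ple_iff_in_supp[OF n0] by blast
    then show False using dP[of 0] dne[of 0] d0 r2 ple_antisym by (auto simp: Q_def)
  qed
  have c1: "c 1 \<noteq> 0"
  proof
    assume z: "c 1 = 0"
    then have d0: "d 0 = 0" using dc2 c0 by simp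
    then have d1: "d 1 \<noteq> 0" using d_ex r2 by (metis less_2_cases One_nat_def)
    have "in_supp n R q k" if "in_supp n P' q k" for q k using surj'[OF that] d0 by force
    then have "ple P' R" using ple_iff_in_supp[OF n0] by blast
    then show False using dP[of 1] dne[of 1] d1 r2 ple_antisym by (auto simp: R_def)
  qed
  have dz: "d 0 \<noteq> 0 \<and> d 1 \<noteq> 0"
  proof -
    have "d 0 = 0 \<longleftrightarrow> d 1 = 0" using dc2 c0 c1 by auto
    then show ?thesis using d_ex r2 by (metis less_2_cases One_nat_def)
  qed
  have P: "ple P Q" "ple P R" "ple Q P'" "ple R P'" "Q \<noteq> P'" "R \<noteq> P'"
    using cP dP dne c0 c1 dz r2 by (auto simp: Q_def R_def)
  have top: "in_supp n Q q k \<or> in_supp n R q k" if "in_supp n P' q k" for q k using surj'[OF that] by force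
  have bot: "in_supp n P q k" if s: "in_supp n Q q k" "in_supp n R q k" for q k
  proof -
    \<comment> \<open>The obvious kernel vector of the row (d 0, d 1); both entries are nonzero, so
      it exists wherever \<open>Q\<close> and \<open>R\<close> are both supported.\<close>
    define w where "w l = (if l = 0 then d 1 else if l = 1 then - d 0 else 0)" for l :: nat
    have "\<forall>l. w l \<noteq> 0 \<longrightarrow> l < r \<and> in_supp n (L ! l) q k" using s r2 by (auto simp: w_def Q_def R_def split: if_splits)
    moreover have "(\<Sum>l<r. d l * w l) = 0" using r2 by (simp add: sum_2 w_def)
    ultimately obtain x where x: "x \<noteq> 0 \<longrightarrow> in_supp n P q k" "\<forall>l<r. w l = c l * x" using ker by blast
    have "w 0 \<noteq> 0" using dz by (simp add: w_def)
    then have "x \<noteq> 0" using x(2) r2 by auto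
    then show ?thesis using x(1) by blast
  qed
  have A: "fst P' \<le> fst Q \<or> fst P' \<le> fst R" and A': "min (fst Q) (fst R) \<le> fst P"
  proof -
    obtain q k where q: "\<And>P. in_supp n P q k \<longleftrightarrow> fst P' \<le> fst P" using even_position[OF n0] by metis
    show "fst P' \<le> fst Q \<or> fst P' \<le> fst R" using top[of q k] q by auto
    obtain q k where q: "\<And>P. in_supp n P q k \<longleftrightarrow> min (fst Q) (fst R) \<le> fst P" using even_position[OF n0] by metis
    show "min (fst Q) (fst R) \<le> fst P" using bot[of q k] q by auto
  qed
  have B: "snd P' \<le> snd Q \<or> snd P' \<le> snd R" and B': "min (snd Q) (snd R) \<le> snd P"
  proof -
    obtain q k where q: "\<And>P. in_supp n P q k \<longleftrightarrow> snd P' \<le> snd P" using odd_position[OF n0] by metis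
    show "snd P' \<le> snd Q \<or> snd P' \<le> snd R" using top[of q k] q by auto
    obtain q k where q: "\<And>P. in_supp n P q k \<longleftrightarrow> min (snd Q) (snd R) \<le> snd P" using odd_position[OF n0] by metis
    show "min (snd Q) (snd R) \<le> snd P" using bot[of q k] q by auto
  qed
  have val: "valid n Q" "valid n R" using types_valid[OF Y, of 0] types_valid[OF Y, of 1] L by auto
  \<comment> \<open>Each coordinate of \<open>P'\<close> is attained by \<open>Q\<close> or
    \<open>R\<close>, but neither attains both, so they share them out; the minima then force the
    remaining coordinates to be those of \<open>P\<close>.\<close>
  have cases: "(Q = (fst P', snd P) \<and> R = (fst P, snd P') \<or> Q = (fst P, snd P') \<and> R = (fst P', snd P)) \<and> fst P < fst P' \<and> snd P < snd P'"
  proof -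
    have lq: "fst P \<le> fst Q" "fst Q \<le> fst P'" "snd P \<le> snd Q" "snd Q \<le> snd P'"
      and lr: "fst P \<le> fst R" "fst R \<le> fst P'" "snd P \<le> snd R" "snd R \<le> snd P'"
      using P by (auto simp: ple_def)
    have nq: "fst Q \<noteq> fst P' \<or> snd Q \<noteq> snd P'" and nr: "fst R \<noteq> fst P' \<or> snd R \<noteq> snd P'"
      using P by (auto simp: prod_eq_iff)
    show ?thesis
    proof (cases "fst Q = fst P'")
      case True
      then have 1: "snd Q < snd P'" using nq lq by simp
      then have 2: "snd R = snd P'" using B lr by simp
      then have 3: "fst R < fst P'" using nr lr by simp
      have "fst R = fst P" using A' 3 True lr by simp
      moreover have "snd Q = snd P" using B' 1 2 lq by simp
      ultimately show ?thesis using True 1 2 3 by (auto simp: prod_eq_iff)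
    next
      case False
      then have 1: "fst Q < fst P'" using lq by simp
      then have 2: "fst R = fst P'" using A lr by simp
      then have 3: "snd R < snd P'" using nr lr by simp
      then have 4: "snd Q = snd P'" using B lq by simp
      have "fst Q = fst P" using A' 1 2 lq by simp
      moreover have "snd R = snd P" using B' 3 4 lr by simp
      ultimately show ?thesis using 1 2 3 4 by (auto simp: prod_eq_iff)
    qed
  qed
  \<comment> \<open>The inequalities fst P' < snd P and snd P' < fst P + n are validity of the two
    middle pairs.\<close>
  then show ?thesis using val L by (auto simp: valid_def)
qed

lemma types_swap_iso:
  fixes X Y :: "'k::field gmod"
  assumes n: "n \<ge> 3" and X: "types n X [Q, R]" and Y: "types n Y [R, Q]"
  shows "is_iso n X Y"
proof -
  define C where "C = (\<lambda>(i::nat) (j::nat). if i \<noteq> j then 1 else (0::'k))"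
  have "mprod 2 C C i j = idc i j" if "i < 2" "j < 2" for i j
    using that by (auto simp: mprod_def C_def idc_def sum_2 less_2_cases_iff)
  moreover have "graded [Q, R] [R, Q] C" "graded [R, Q] [Q, R] C"
    by (auto simp: graded_def C_def less_Suc_eq)
  ultimately show ?thesis by (intro matrix_iso[OF n X Y, of C C]) (simp_all add: numeral_2_eq_2)
qed

text \<open>If the source had several summands, the idempotents of the summands would factor through
  \<^term>\<open>f\<close>, and the sum of the factors would split \<^term>\<open>f\<close>.\<close>

lemma left_almost_split_rank:
  fixes X Y :: "'k::field gmod"
  assumes n: "n \<ge> 3" and X: "types n X L" and Y: "types n Y L'" and CM: "is_CM n X" and f: "is_hom n X Y f"
    and las: "left_almost_split n X Y f"
  shows "length L = 1"
proof -
  define r where "r = length L"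
  obtain C where C: "hrep n X L Y L' f C" using hom_matrix[OF n X Y f] by blast
  have nsm: "\<not> split_mono n X Y f" using las by (simp add: left_almost_split_def)
  have "r \<noteq> 0"
  proof
    assume "r = 0"
    then have "split_mono n X Y f" unfolding split_mono_iff[OF n C] by (auto simp: r_def graded_def)
    then show False using nsm by blast
  qed
  moreover have "\<not> r \<ge> 2"
  proof
    assume r2: "r \<ge> 2"
    define E where "E l = (\<lambda>i j. if i = j \<and> i = l then 1 else (0::'k))" for l :: nat
    have "\<exists>T. graded L' L T \<and> (\<forall>i<r. \<forall>j<r. mprod (length L') T C i j = E l i j)" if l: "l < r" for l
    proof -
      have "graded L L (E l)" by (auto simp: graded_def E_def)
      then obtain e where e: "hrep n X L X L e (E l)" using matrix_hom[OF X X] by blast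
      have "\<not> split_mono n X X e"
      proof
        assume "split_mono n X X e"
        then obtain S where S: "\<forall>i<r. \<forall>j<r. mprod r S (E l) i j = idc i j"
          using split_mono_iff[OF n e] by (auto simp: r_def)
        \<comment> \<open>With at least two summands, the idempotent of summand \<open>l\<close>
          kills another summand \<open>m\<close> and so has no left inverse.\<close>
        obtain m where m: "m < r" "m \<noteq> l" using r2 l that by (cases "l = 0") (auto intro: that[of 1] that[of 0])
        have "mprod r S (E l) m m = 0" using m by (auto simp: mprod_def E_def intro!: sum.neutral)
        then show False using S m by (simp add: idc_def)
      qed
      then obtain t where t: "is_hom n Y X t" "comp t f = e"
        using las CM hrep_hom[OF e] unfolding left_almost_split_def by blast
      obtain T where T: "hrep n Y L' X L t T" using hom_matrix[OF n Y X t(1)] by blast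
      have "hrep n X L X L e (mprod (length L') T C)" using hrep_comp[OF n C T] t(2) by simp
      then show ?thesis using hrep_unique[OF _ e n] hrep_graded[OF T] by (auto simp: r_def)
    qed
    then obtain T where T: "\<And>l. l < r \<Longrightarrow> graded L' L (T l)"
      "\<And>l i j. l < r \<Longrightarrow> i < r \<Longrightarrow> j < r \<Longrightarrow> mprod (length L') (T l) C i j = E l i j" by metis
    define S where "S i j = (\<Sum>l<r. T l i j)" for i j
    have "graded L' L S"
      unfolding graded_def
    proof (intro allI impI)
      fix i j assume ij: "i < length L" "j < length L'" "S i j \<noteq> 0"
      then obtain l where "l \<in> {..<r}" "T l i j \<noteq> 0" unfolding S_def by (blast elim: sum.not_neutral_contains_not_neutral)
      then show "ple (L' ! j) (L ! i)" using T(1)[of l] ij by (auto simp: graded_def)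
    qed
    moreover have "mprod (length L') S C i j = idc i j" if "i < r" "j < r" for i j
    proof -
      have "mprod (length L') S C i j = (\<Sum>l<r. mprod (length L') (T l) C i j)"
        unfolding mprod_def S_def sum_distrib_right by (rule sum.swap)
      also have "\<dots> = (\<Sum>l<r. if l = i then idc i j else 0)"
        using that by (intro sum.cong) (auto simp: T(2) E_def idc_def)
      finally show ?thesis using that by simp
    qed
    ultimately have "split_mono n X Y f" unfolding split_mono_iff[OF n C] by (auto simp: r_def)
    then show False using nsm by blast
  qed
  ultimately show ?thesis unfolding r_def by linarith
qed

text \<open>\<open>nonsplit_ses\<close> leaves only the pair (s, t) of the left term free. The
  morphisms from (i - 1, j) and (i, j - 1) to (i, j) are not split and must factor through
  \<open>Y\<close>, which bounds s and t from below; the bounds on the gap make these two pairs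
  valid.\<close>

lemma almost_split_types:
  fixes X Y Z :: "'k::field gmod"
  assumes n: "n \<ge> 3" and Z: "types n Z [(i, j)]" and ij: "2 \<le> j - i" "j - i \<le> int n - 2"
    and X: "types n X L" and Y: "types n Y L'" and as: "almost_split n X Y Z f g"
  shows "L = [(i - 1, j - 1)] \<and> (L' = [(i - 1, j), (i, j - 1)] \<or> L' = [(i, j - 1), (i - 1, j)])"
proof -
  have ses: "ses n X Y Z f g" and las: "left_almost_split n X Y f" and ras: "right_almost_split n Y Z g"
    using as by (auto simp: almost_split_def)
  have CM: "is_CM n X" "is_CM n Y" "is_CM n Z" and hom: "is_hom n X Y f" "is_hom n Y Z g" using ses by (auto simp: ses_def)
  have "length L = 1" by (rule left_almost_split_rank[OF n X Y CM(1) hom(1) las])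
  then obtain P where L: "L = [P]" by (auto simp: length_Suc_conv)
  obtain s t where P: "P = (s, t)" by (cases P)
  have ns: "\<not> split_epi n Y Z g" using ras by (simp add: right_almost_split_def)
  have ext: "s < i \<and> i < t \<and> t < j \<and> j < s + int n \<and> (L' = [(i, t), (s, j)] \<or> L' = [(s, j), (i, t)])"
    using nonsplit_ses[OF n X[unfolded L] Y Z ses ns] by (simp add: P)
  obtain D where D: "hrep n Y L' Z [(i, j)] g D" using hom_matrix[OF n Y Z hom(2)] by blast
  have fact: "\<exists>Q\<in>set L'. ple W Q" if v: "valid n W" and le: "ple W (i, j)" and ne: "W \<noteq> (i, j)" for W
  proof -
    let ?W = "thin n W :: 'k gmod"
    have tW: "types n ?W [W]" and cW: "is_CM n ?W" using types_thin[OF n v] thin_CM[OF n v] by auto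
    have "graded [W] [(i, j)] (\<lambda>_ _. 1 :: 'k)" using le by (auto simp: graded_def)
    then obtain h where h: "hrep n ?W [W] Z [(i, j)] h (\<lambda>_ _. 1)" using matrix_hom[OF tW Z] by blast
    have "\<not> split_epi n ?W Z h"
    proof
      assume "split_epi n ?W Z h"
      then obtain S :: "nat \<Rightarrow> nat \<Rightarrow> 'k" where S: "graded [(i, j)] [W] S" "mprod 1 (\<lambda>_ _. 1) S 0 0 = idc 0 0"
        using split_epi_iff[OF n h] by auto
      then have "S 0 0 \<noteq> 0" by (auto simp: mprod_def idc_def)
      then have "ple (i, j) W" using S(1) by (simp add: graded_def)
      then show False using ple_antisym le ne by blast
    qed
    then obtain t where t: "is_hom n ?W Y t" "comp g t = h"
      using ras cW hrep_hom[OF h] unfolding right_almost_split_def by blast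
    obtain T where T: "hrep n ?W [W] Y L' t T" using hom_matrix[OF n tW Y t(1)] by blast
    have "mprod (length L') D T 0 0 = 1"
      using hrep_unique[OF _ h n, of "mprod (length L') D T" 0 0] hrep_comp[OF n T D] t(2) by simp
    then have "(\<Sum>l<length L'. D 0 l * T l 0) \<noteq> 0" by (simp add: mprod_def)
    then obtain l where l: "l \<in> {..<length L'}" "D 0 l * T l 0 \<noteq> 0" by (rule sum.not_neutral_contains_not_neutral)
    then have "ple W (L' ! l)" using hrep_graded[OF T] by (auto simp: graded_def)
    then show ?thesis using l by auto
  qed
  \<comment> \<open>The pair (i - 1, j) cannot lie below (i, t), as t < j, so it lies below (s, j);
    the bound for t is symmetric.\<close>
  have "i - 1 \<le> s"
    using fact[of "(i - 1, j)"] ext ij by (auto simp: valid_def ple_def)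
  moreover have "j - 1 \<le> t"
    using fact[of "(i, j - 1)"] ext ij by (auto simp: valid_def ple_def)
  ultimately have st: "s = i - 1" "t = j - 1" using ext by auto
  then show ?thesis using L P ext by auto
qed


subsection \<open>The radical\<close>

lemma hrep_smult:
  fixes X Y :: "'k::field gmod"
  assumes f: "hrep n X L Y L' f C"
  shows "hrep n X L Y L' (\<lambda>k. c \<cdot>\<^sub>m f k) (\<lambda>i j. c * C i j)"
proof -
  note tX = hrep_types1[OF f] and tY = hrep_types2[OF f] and fc = hrep_carrier[OF f]
  have "(c \<cdot>\<^sub>m f (m + k)) * gact X m k A = gact Y m k A * (c \<cdot>\<^sub>m f k)" if A: "A \<in> Lam n m" for m k A
    using mult_smult_assoc_mat[OF fc coord_gact[OF types_coord[OF tX] A]]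
      mult_smult_distrib[OF coord_gact[OF types_coord[OF tY] A] fc] hrep_hom[OF f] A
    by (simp add: is_hom_def)
  then have h: "is_hom n X Y (\<lambda>k. c \<cdot>\<^sub>m f k)" using fc by (simp add: is_hom_def)
  have "coords n Y L' k ((c \<cdot>\<^sub>m f k) *\<^sub>v v) q = mapp (length L') (length L) (\<lambda>i j. c * C i j) (coords n X L k v q)"
    if v: "v \<in> hcomp X k" for k v q
  proof -
    have "(c \<cdot>\<^sub>m f k) *\<^sub>v v = c \<cdot>\<^sub>v (f k *\<^sub>v v)" using fc[of k] v by (intro eq_vecI) auto
    then show ?thesis
      using coord_smult_fun[OF types_coord[OF tY] hrep_vec[OF f v], of c] hrep_app[OF f v]
      by (auto simp: mapp_def fun_eq_iff sum_distrib_left mult.assoc)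
  qed
  moreover have "graded L L' (\<lambda>i j. c * C i j)" using hrep_graded[OF f] by (auto simp: graded_def)
  ultimately show ?thesis using h tX tY by (simp add: hrep_def)
qed

text \<open>Otherwise a multiple of a matrix unit gives \<^term>\<open>g\<close> such that \<open>1 - g f\<close> kills the
  summand \<^term>\<open>j\<close>.\<close>

lemma rad_entry:
  fixes X Y :: "'k::field gmod"
  assumes n: "n \<ge> 3" and f: "hrep n X L Y L' f C" and rad: "f \<in> rad n X Y"
    and ij: "i < length L'" "j < length L" "L ! j = L' ! i"
  shows "C i j = 0"
proof (rule ccontr)
  assume nz: "C i j \<noteq> 0"
  note tX = hrep_types1[OF f] and tY = hrep_types2[OF f]
  define G where "G a b = (if a = j \<and> b = i then 1 / C i j else 0)" for a b
  have "graded L' L G" using ij by (auto simp: graded_def G_def split: if_splits)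
  then obtain g where g: "hrep n Y L' X L g G" using matrix_hom[OF tY tX] by blast
  obtain h where h: "is_hom n X X h" "comp h (\<lambda>k. 1\<^sub>m (gdim X k) - g k * f k) = idm X"
    using rad hrep_hom[OF g] unfolding rad_def by blast
  obtain H where H: "hrep n X L X L h H" using hom_matrix[OF n tX tX h(1)] by blast
  define U where "U a b = idc a b - mprod (length L') G C a b" for a b
  have "hrep n X L X L (\<lambda>k. idm X k - comp g f k) U"
    using hrep_diff[OF n hrep_id[OF n tX] hrep_comp[OF n f g]] by (simp add: U_def[abs_def])
  then have U: "hrep n X L X L (\<lambda>k. 1\<^sub>m (gdim X k) - g k * f k) U" by (simp add: idm_def comp_def)
  have col: "U a j = 0" for a
  proof -
    have "mprod (length L') G C a j = (\<Sum>b<length L'. if b = i then (if a = j then 1 else 0) else 0)"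
      unfolding mprod_def using nz by (intro sum.cong) (auto simp: G_def)
    then show ?thesis using ij by (simp add: U_def idc_def)
  qed
  have "mprod (length L) H U j j = idc j j"
    using hrep_unique[OF hrep_comp[OF n U H, unfolded h(2)] hrep_id[OF n tX] n ij(2) ij(2)] .
  then show False using col by (simp add: mprod_def idc_def)
qed

text \<open>For different pairs, antisymmetry of \<open>ple\<close> leaves no nonzero composite back
  to \<open>X\<close>: g f = 0 for every g, and 1 - g f is the identity.\<close>

lemma rad_single:
  fixes X Y :: "'k::field gmod"
  assumes n: "n \<ge> 3" and X: "types n X [P]" and Y: "types n Y [Q]" and PQ: "P \<noteq> Q" and f: "is_hom n X Y f"
  shows "f \<in> rad n X Y"
proof -
  obtain C where C: "hrep n X [P] Y [Q] f C" using hom_matrix[OF n X Y f] by blast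
  have "\<exists>h. is_hom n X X h \<and> comp h (\<lambda>k. 1\<^sub>m (gdim X k) - g k * f k) = idm X \<and>
      comp (\<lambda>k. 1\<^sub>m (gdim X k) - g k * f k) h = idm X" if g: "is_hom n Y X g" for g
  proof -
    obtain G where G: "hrep n Y [Q] X [P] g G" using hom_matrix[OF n Y X g] by blast
    have "G 0 0 * C 0 0 = 0" using hrep_graded[OF C] hrep_graded[OF G] ple_antisym[of P Q] PQ by (auto simp: graded_def)
    then have z: "mprod (length [Q]) G C 0 0 = 0" by (simp add: mprod_def)
    have "(\<lambda>k. idm X k - comp g f k) = idm X"
      by (rule hrep_eq[OF hrep_diff[OF n hrep_id[OF n X] hrep_comp[OF n C G]] hrep_id[OF n X]]) (use z in simp)
    then have e: "(\<lambda>k. 1\<^sub>m (gdim X k) - g k * f k) = idm X" by (simp add: idm_def comp_def)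
    have "comp (idm X) (idm X) = idm X" by (simp add: comp_def idm_def)
    then show ?thesis unfolding e using hrep_hom[OF hrep_id[OF n X]] by blast
  qed
  then show ?thesis using f by (simp add: rad_def)
qed

lemma msum_zero: "(\<And>A. A \<in> set As \<Longrightarrow> A = 0\<^sub>m r c) \<Longrightarrow> msum r c As = 0\<^sub>m r c"
proof (induction As)
  case (Cons A As)
  then have "A = 0\<^sub>m r c" "msum r c As = 0\<^sub>m r c" by simp_all
  then show ?case by (simp add: msum_def)
qed (simp add: msum_def)

text \<open>A product of two radical morphisms passes through summands between \<open>P\<close> and
  \<open>Q\<close>. Only \<open>P\<close> and \<open>Q\<close> are available, and there one of the
  two radical factors has entry zero by \<open>rad_entry\<close>. So \<open>rad2\<close> is zero,
  while every radical morphism is a scalar multiple of \<open>\<theta>\<close>.\<close>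

lemma num_arrows_cover:
  fixes X Y :: "'k::field gmod"
  assumes n: "n \<ge> 3" and X: "types n X [P]" and Y: "types n Y [Q]"
    and PQ: "ple P Q" "P \<noteq> Q" and cover: "\<And>R. ple P R \<Longrightarrow> ple R Q \<Longrightarrow> R = P \<or> R = Q"
  shows "num_arrows n X Y 1"
proof -
  have "graded [P] [Q] (\<lambda>_ _. 1 :: 'k)" using PQ by (auto simp: graded_def)
  then obtain \<theta> where \<theta>: "hrep n X [P] Y [Q] \<theta> (\<lambda>_ _. 1)" using matrix_hom[OF X Y] by blast
  have \<theta>r: "\<theta> \<in> rad n X Y" by (rule rad_single[OF n X Y PQ(2) hrep_hom[OF \<theta>]])
  have rad2: "f k = 0\<^sub>m (gdim Y k) (gdim X k)" if f: "f \<in> rad2 n X Y" for f k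
  proof -
    obtain s :: nat and W :: "nat \<Rightarrow> 'k gmod" and gs hs where W: "\<forall>l<s. is_CM n (W l) \<and> gs l \<in> rad n X (W l) \<and> hs l \<in> rad n (W l) Y"
      and fk: "\<forall>k. f k = msum (gdim Y k) (gdim X k) [hs l k * gs l k. l \<leftarrow> [0..<s]]"
      using f unfolding rad2_def by blast
    have "hs l k * gs l k = 0\<^sub>m (gdim Y k) (gdim X k)" if l: "l < s" for l
    proof -
      have Wl: "is_CM n (W l)" "gs l \<in> rad n X (W l)" "hs l \<in> rad n (W l) Y" using W l by auto
      obtain L where L: "types n (W l) L" using CM_types[OF n Wl(1)] by blast
      have hm: "is_hom n X (W l) (gs l)" "is_hom n (W l) Y (hs l)" using Wl by (auto simp: rad_def)
      obtain G where G: "hrep n X [P] (W l) L (gs l) G" using hom_matrix[OF n X L hm(1)] by blast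
      obtain H where H: "hrep n (W l) L Y [Q] (hs l) H" using hom_matrix[OF n L Y hm(2)] by blast
      have "H 0 m * G m 0 = 0" if m: "m < length L" for m
      proof (rule ccontr)
        assume "H 0 m * G m 0 \<noteq> 0"
        then have nz: "H 0 m \<noteq> 0" "G m 0 \<noteq> 0" by auto
        then have "ple P (L ! m)" "ple (L ! m) Q" using hrep_graded[OF G] hrep_graded[OF H] m by (auto simp: graded_def)
        then have "L ! m = P \<or> L ! m = Q" by (rule cover)
        then show False using rad_entry[OF n G Wl(2) m, of 0] rad_entry[OF n H Wl(3) _ m, of 0] nz by auto
      qed
      then have "mprod (length L) H G 0 0 = 0" unfolding mprod_def by (intro sum.neutral) auto
      then have "comp (hs l) (gs l) = (\<lambda>k. 0\<^sub>m (gdim Y k) (gdim X k))"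
        by (intro hrep_eq[OF hrep_comp[OF n G H] hrep_0[OF n X Y]]) simp
      then show ?thesis by (simp add: comp_def fun_eq_iff)
    qed
    then show ?thesis unfolding fk[rule_format, of k] by (intro msum_zero) auto
  qed
  \<comment> \<open>The empty sum of products shows that the zero morphism lies in
    \<open>rad2\<close>.\<close>
  have zero: "(\<lambda>k. 0\<^sub>m (gdim Y k) (gdim X k)) \<in> rad2 n X Y"
    using is_hom_0[OF types_gmod[OF n X] types_gmod[OF n Y]]
    by (auto simp: rad2_def msum_def intro!: exI[of _ "0::nat"])
  have lc: "lincomb X Y 1 c (\<lambda>_. \<theta>) = (\<lambda>k. c 0 \<cdot>\<^sub>m \<theta> k)" for c
    using hrep_carrier[OF \<theta>] by (auto simp: lincomb_def msum_def intro!: ext)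
  show ?thesis
    unfolding num_arrows_def
  proof (intro exI[of _ "\<lambda>_. \<theta>"] conjI allI impI ballI)
    show "\<theta> \<in> rad n X Y" by (rule \<theta>r)
    fix c and l :: nat assume c: "lincomb X Y 1 c (\<lambda>_. \<theta>) \<in> rad2 n X Y" and l: "l < 1"
    have "(\<lambda>k. c 0 \<cdot>\<^sub>m \<theta> k) = (\<lambda>k. 0\<^sub>m (gdim Y k) (gdim X k))" using rad2[OF c, unfolded lc] by (intro ext)
    then have "c 0 * 1 = 0"
      using hrep_unique[OF hrep_smult[OF \<theta>, of "c 0"] _ n, of "\<lambda>_ _. 0" 0 0] hrep_0[OF n X Y] by simp
    then show "c l = 0" using l by simp
  next
    fix f assume f: "f \<in> rad n X Y"
    obtain F where F: "hrep n X [P] Y [Q] f F" using hom_matrix[OF n X Y] f unfolding rad_def by blast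
    define c where "c = (\<lambda>_::nat. F 0 0)"
    have e: "f = (\<lambda>k. c 0 \<cdot>\<^sub>m \<theta> k)" by (rule hrep_eq[OF F hrep_smult[OF \<theta>]]) (simp add: c_def)
    have "f k - lincomb X Y 1 c (\<lambda>_. \<theta>) k = 0\<^sub>m (gdim Y k) (gdim X k)" for k
      using minus_r_inv_mat[OF hrep_carrier[OF F, of k]] fun_cong[OF e, of k] unfolding lc by simp
    then have z: "(\<lambda>k. f k - lincomb X Y 1 c (\<lambda>_. \<theta>) k) = (\<lambda>k. 0\<^sub>m (gdim Y k) (gdim X k))" by (intro ext)
    show "\<exists>c. (\<lambda>k. f k - lincomb X Y 1 c (\<lambda>_. \<theta>) k) \<in> rad2 n X Y"
      by (rule exI[of _ c]) (simp only: z zero)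
  qed
qed

text \<open>A nonzero radical morphism factors through the rank-one module of an intermediate pair,
  and both factors are radical; hence rad and rad^2 coincide.\<close>

lemma num_arrows_no_cover:
  fixes X Y :: "'k::field gmod"
  assumes n: "n \<ge> 3" and X: "types n X [P]" and Y: "types n Y [Q]"
    and between: "ple P Q \<Longrightarrow> P \<noteq> Q \<Longrightarrow> \<exists>R. valid n R \<and> ple P R \<and> ple R Q \<and> R \<noteq> P \<and> R \<noteq> Q"
  shows "num_arrows n X Y 0"
proof -
  have rad2: "f \<in> rad2 n X Y" if f: "f \<in> rad n X Y" for f
  proof -
    have fh: "is_hom n X Y f" using f by (simp add: rad_def)
    obtain F where F: "hrep n X [P] Y [Q] f F" using hom_matrix[OF n X Y fh] by blast
    show ?thesis
    proof (cases "F 0 0 = 0")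
      case True
      have "f = (\<lambda>k. 0\<^sub>m (gdim Y k) (gdim X k))" by (rule hrep_eq[OF F hrep_0[OF n X Y]]) (simp add: True)
      then show ?thesis using fh by (auto simp: rad2_def msum_def intro!: exI[of _ "0::nat"])
    next
      case False
      then have "ple P Q" "P \<noteq> Q" using hrep_graded[OF F] rad_entry[OF n F f, of 0 0] by (auto simp: graded_def)
      then obtain R where R: "valid n R" "ple P R" "ple R Q" "R \<noteq> P" "R \<noteq> Q" using between by blast
      let ?W = "thin n R :: 'k gmod"
      have W: "types n ?W [R]" "is_CM n ?W" using types_thin[OF n R(1)] thin_CM[OF n R(1)] by auto
      have "graded [P] [R] (\<lambda>_ _. 1 :: 'k)" "graded [R] [Q] (\<lambda>_ _. F 0 0)" using R by (auto simp: graded_def)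
      then obtain g h where g: "hrep n X [P] ?W [R] g (\<lambda>_ _. 1)" and h: "hrep n ?W [R] Y [Q] h (\<lambda>_ _. F 0 0)"
        using matrix_hom[OF X W(1)] matrix_hom[OF W(1) Y] by meson
      have "f = comp h g" by (rule hrep_eq[OF F hrep_comp[OF n g h]]) (simp add: mprod_def)
      then have "f k = msum (gdim Y k) (gdim X k) [h k * g k. l \<leftarrow> [0..<1]]" for k
        using mult_carrier_mat[OF hrep_carrier[OF h, of k] hrep_carrier[OF g, of k]] by (simp add: comp_def msum_def)
      moreover have "g \<in> rad n X ?W" "h \<in> rad n ?W Y"
        using rad_single[OF n X W(1) _ hrep_hom[OF g]] rad_single[OF n W(1) Y _ hrep_hom[OF h]] R by auto
      ultimately show ?thesis
        unfolding rad2_def using fh W(2)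
        by (intro CollectI conjI exI[of _ "1::nat"] exI[of _ "\<lambda>_. ?W"] exI[of _ "\<lambda>_. g"] exI[of _ "\<lambda>_. h"]) auto
    qed
  qed
  have "(\<lambda>k. f k - lincomb X Y 0 c fs k) = f" if "f \<in> rad n X Y" for f c fs
  proof -
    have c: "f k \<in> carrier_mat (gdim Y k) (gdim X k)" for k using that by (simp add: rad_def is_hom_def)
    have "f k - 0\<^sub>m (gdim Y k) (gdim X k) = f k" for k using c[of k] by (intro eq_matI) auto
    then show ?thesis by (simp add: lincomb_def msum_def)
  qed
  then show ?thesis using rad2 by (simp add: num_arrows_def)
qed

lemma ple_between:
  assumes n: "n \<ge> 3" and P: "valid n (a, b)" and Q: "valid n (a', b')" and le: "ple (a, b) (a', b')" and ne: "(a, b) \<noteq> (a', b')"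
    and nc: "\<not> (a' = a + 1 \<and> b' = b)" "\<not> (a' = a \<and> b' = b + 1)"
  shows "\<exists>R. valid n R \<and> ple (a, b) R \<and> ple R (a', b') \<and> R \<noteq> (a, b) \<and> R \<noteq> (a', b')"
proof (cases "a < a' \<and> valid n (a + 1, b)")
  case True
  then show ?thesis using le nc by (intro exI[of _ "(a + 1, b)"]) (auto simp: ple_def)
next
  case False
  \<comment> \<open>If a = a', there is room to raise b. If raising a is blocked by validity, then b
    = a + 1, and n \<ge> 3 makes (a, b + 1) valid.\<close>
  then show ?thesis using n P Q le ne nc by (intro exI[of _ "(a, b + 1)"]) (auto simp: ple_def valid_def)
qed


section \<open>Assembly of the four statements\<close>

theorem theorem4p3:
  fixes n :: nat
  assumes "n \<ge> 3"
  shows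
  \<comment> \<open>(1) classification of indecomposables and projective-injectives\<close>
  "((\<forall>i j. 0 < j - i \<and> j - i < int n \<longrightarrow> indec n (pmod n i j :: 'k::field gmod)) \<and>
    (\<forall>i j i' j'. 0 < j - i \<and> j - i < int n \<and> 0 < j' - i' \<and> j' - i' < int n \<longrightarrow>
        is_iso n (pmod n i j :: 'k gmod) (pmod n i' j') \<longrightarrow> i = i' \<and> j = j') \<and>
    (\<forall>X :: 'k gmod. indec n X \<longrightarrow> (\<exists>i j. 0 < j - i \<and> j - i < int n \<and> is_iso n X (pmod n i j))) \<and>
    (\<forall>i j. 0 < j - i \<and> j - i < int n \<longrightarrow>
        (proj_inj n (pmod n i j :: 'k gmod) \<longleftrightarrow> j = i + 1 \<or> j = i + int n - 1))) \<and>
  \<comment> \<open>(2) non-split extensions of indecomposables\<close>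
   (\<forall>(X :: 'k gmod) Y Z f g. ses n X Y Z f g \<and> \<not> split_epi n Y Z g \<and> indec n X \<and> indec n Z \<longrightarrow>
      (\<exists>s s' t t'. s < s' \<and> s' < t \<and> t < t' \<and> t' < s + int n \<and>
         is_iso n X (pmod n s t) \<and> is_iso n Z (pmod n s' t') \<and>
         is_iso n Y (dsum (pmod n s t') (pmod n s' t)))) \<and>
  \<comment> \<open>(3) Auslander-Reiten sequences\<close>
   (\<forall>i j. 0 < j - i \<and> j - i < int n \<and> \<not> proj n (pmod n i j :: 'k gmod) \<longrightarrow>
      (\<exists>(X :: 'k gmod) Y f g. almost_split n X Y (pmod n i j) f g) \<and>
      (\<forall>(X :: 'k gmod) Y f g. almost_split n X Y (pmod n i j) f g \<longrightarrow>
          is_iso n X (pmod n (i - 1) (j - 1)) \<and>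
          is_iso n Y (dsum (pmod n (i - 1) j) (pmod n i (j - 1))))) \<and>
  \<comment> \<open>(4) Auslander-Reiten quiver\<close>
   (\<forall>i j i' j'. 0 < j - i \<and> j - i < int n \<and> 0 < j' - i' \<and> j' - i' < int n \<longrightarrow>
      num_arrows n (pmod n i j :: 'k gmod) (pmod n i' j')
        (if (i' = i + 1 \<and> j' = j) \<or> (i' = i \<and> j' = j + 1) then 1 else 0))"
proof -
  note n = assms
  note types = types_pmod[OF n, where 'a='k] and CM = pmod_CM[OF n, where 'a='k]
  have valid: "valid n (i, j) \<longleftrightarrow> 0 < j - i \<and> j - i < int n" for i j by (simp add: valid_def)
  have iso_dsum: "is_iso n Y (dsum (pmod n a b) (pmod n a' b'))"
    if v: "valid n (a, b)" "valid n (a', b')" and Y: "types n Y L" "L = [(a, b), (a', b')] \<or> L = [(a', b'), (a, b)]"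
    for Y :: "'k gmod" and a b a' b' L
  proof -
    have "types n (dsum (pmod n a b) (pmod n a' b') :: 'k gmod) [(a, b), (a', b')]"
      using types_dsum[OF types[OF v(1)] types[OF v(2)]] by simp
    then show ?thesis using Y types_iso[OF n] types_swap_iso[OF n] by blast
  qed
  have ar: "\<exists>(X :: 'k gmod) Y f g. almost_split n X Y (pmod n i j) f g"
    if v: "valid n (i, j)" and ne: "j \<noteq> i + 1" "j \<noteq> i + int n - 1" for i j
  proof -
    have v': "valid n (i - 1, j - 1)" "valid n (i - 1, j)" "valid n (i, j - 1)" using v ne by (auto simp: valid_def)
    show ?thesis
      using almost_split_ex[OF n types[OF v'(1)] types_dsum[OF types[OF v'(2)] types[OF v'(3)], simplified] types[OF v]
          CM[OF v'(1)] dsum_CM[OF n types[OF v'(2)] types[OF v'(3)] CM[OF v'(2)] CM[OF v'(3)]] CM[OF v]] by blast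
  qed
  have proj: "proj n (pmod n i j :: 'k gmod) \<longleftrightarrow> j = i + 1 \<or> j = i + int n - 1" if v: "valid n (i, j)" for i j
  proof
    assume p: "proj n (pmod n i j :: 'k gmod)"
    show "j = i + 1 \<or> j = i + int n - 1"
    proof (rule ccontr)
      assume "\<not> (j = i + 1 \<or> j = i + int n - 1)"
      \<comment> \<open>Away from the boundary an almost split sequence ends at the module; its
        epimorphism does not split, so the module is not projective.\<close>
      then obtain X Y :: "'k gmod" and f g where "almost_split n X Y (pmod n i j) f g" using ar[OF v] by blast
      then show False using p unfolding almost_split_def right_almost_split_def proj_def by blast
    qed
  qed (rule proj_inj_side(1)[OF n types[OF v] CM[OF v]])
  have 1: "indec n (pmod n i j :: 'k gmod)" if "valid n (i, j)" for i j
    by (rule indec_single[OF n types[OF that] CM[OF that]])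
  have 2: "i = i' \<and> j = j'" if "valid n (i, j)" "valid n (i', j')" "is_iso n (pmod n i j :: 'k gmod) (pmod n i' j')" for i j i' j'
    using iso_types_single[OF n types[OF that(1)] types[OF that(2)] that(3)] by simp
  have 3: "\<exists>i j. valid n (i, j) \<and> types n X [(i, j)]" if X: "indec n X" for X :: "'k gmod"
  proof -
    have "is_CM n X" using X by (simp add: indec_def)
    then obtain L where L: "types n X L" using CM_types[OF n] by blast
    then obtain P where "L = [P]" using indec_types[OF n L X] by blast
    then show ?thesis using L types_valid[OF L, of 0] by (cases P) auto
  qed
  have 4: "proj_inj n (pmod n i j :: 'k gmod) \<longleftrightarrow> j = i + 1 \<or> j = i + int n - 1" if v: "valid n (i, j)" for i j
    using proj[OF v] proj_inj_side(2)[OF n types[OF v] CM[OF v]] by (auto simp: proj_inj_def)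
  have 5: "\<exists>s s' t t'. s < s' \<and> s' < t \<and> t < t' \<and> t' < s + int n \<and>
         is_iso n X (pmod n s t) \<and> is_iso n Z (pmod n s' t') \<and> is_iso n Y (dsum (pmod n s t') (pmod n s' t))"
    if ses: "ses n X Y Z f g" and ns: "\<not> split_epi n Y Z g" and ind: "indec n X" "indec n Z" for X Y Z :: "'k gmod" and f g
  proof -
    obtain s t where X: "valid n (s, t)" "types n X [(s, t)]" using 3[OF ind(1)] by blast
    obtain s' t' where Z: "valid n (s', t')" "types n Z [(s', t')]" using 3[OF ind(2)] by blast
    have "is_CM n Y" using ses by (simp add: ses_def)
    then obtain L where Y: "types n Y L" using CM_types[OF n] by blast
    have e: "s < s' \<and> s' < t \<and> t < t' \<and> t' < s + int n \<and> (L = [(s', t), (s, t')] \<or> L = [(s, t'), (s', t)])"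
      using nonsplit_ses[OF n X(2) Y Z(2) ses ns] by simp
    have "is_iso n Y (dsum (pmod n s t') (pmod n s' t))"
      by (rule iso_dsum[OF _ _ Y]) (use e in \<open>auto simp: valid_def\<close>)
    then show ?thesis using e types_iso[OF n X(2) types[OF X(1)]] types_iso[OF n Z(2) types[OF Z(1)]] by blast
  qed
  have 6: "is_iso n X (pmod n (i - 1) (j - 1)) \<and> is_iso n Y (dsum (pmod n (i - 1) j) (pmod n i (j - 1)))"
    if v: "valid n (i, j)" and np: "\<not> proj n (pmod n i j :: 'k gmod)" and as: "almost_split n X Y (pmod n i j) f g"
    for i j and X Y :: "'k gmod" and f g
  proof -
    have ij: "2 \<le> j - i" "j - i \<le> int n - 2" using v np proj[OF v] by (auto simp: valid_def)
    then have v': "valid n (i - 1, j - 1)" "valid n (i - 1, j)" "valid n (i, j - 1)" by (auto simp: valid_def)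
    have "is_CM n X" "is_CM n Y" using as by (simp_all add: almost_split_def ses_def)
    then obtain L L' where L: "types n X L" "types n Y L'" using CM_types[OF n] by meson
    note e = almost_split_types[OF n types[OF v] ij L as]
    have "types n X [(i - 1, j - 1)]" using L(1) e by simp
    then show ?thesis using types_iso[OF n _ types[OF v'(1)]] iso_dsum[OF v'(2,3) L(2)] e by blast
  qed
  have 7: "num_arrows n (pmod n i j :: 'k gmod) (pmod n i' j')
        (if (i' = i + 1 \<and> j' = j) \<or> (i' = i \<and> j' = j + 1) then 1 else 0)"
    if v: "valid n (i, j)" "valid n (i', j')" for i j i' j'
  proof (cases "(i' = i + 1 \<and> j' = j) \<or> (i' = i \<and> j' = j + 1)")
    case True
    then have "num_arrows n (pmod n i j :: 'k gmod) (pmod n i' j') 1"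
      by (intro num_arrows_cover[OF n types[OF v(1)] types[OF v(2)]]) (auto simp: ple_def prod_eq_iff)
    then show ?thesis by (simp only: True if_True)
  next
    case False
    then have "num_arrows n (pmod n i j :: 'k gmod) (pmod n i' j') 0"
      by (intro num_arrows_no_cover[OF n types[OF v(1)] types[OF v(2)]] ple_between[OF n v]) auto
    then show ?thesis by (simp only: False if_False)
  qed
  show ?thesis
  proof (intro conjI allI impI)
    fix i j assume a: "0 < j - i \<and> j - i < int n"
    then have v: "valid n (i, j)" by (simp add: valid)
    show "indec n (pmod n i j :: 'k gmod)" by (rule 1[OF v])
    show "proj_inj n (pmod n i j :: 'k gmod) \<longleftrightarrow> j = i + 1 \<or> j = i + int n - 1" by (rule 4[OF v])
  next
    fix i j i' j'
    assume "0 < j - i \<and> j - i < int n \<and> 0 < j' - i' \<and> j' - i' < int n"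
      and "is_iso n (pmod n i j :: 'k gmod) (pmod n i' j')"
    then show "i = i'" "j = j'" using 2[of i j i' j'] by (auto simp: valid)
  next
    fix X :: "'k gmod" assume "indec n X"
    then obtain i j where "valid n (i, j)" "types n X [(i, j)]" using 3 by blast
    then show "\<exists>i j. 0 < j - i \<and> j - i < int n \<and> is_iso n X (pmod n i j)"
      using types_iso[OF n _ types] valid by blast
  next
    fix X Y Z :: "'k gmod" and f g
    assume "ses n X Y Z f g \<and> \<not> split_epi n Y Z g \<and> indec n X \<and> indec n Z"
    then show "\<exists>s s' t t'. s < s' \<and> s' < t \<and> t < t' \<and> t' < s + int n \<and>
         is_iso n X (pmod n s t) \<and> is_iso n Z (pmod n s' t') \<and> is_iso n Y (dsum (pmod n s t') (pmod n s' t))"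
      using 5 by blast
  next
    fix i j assume "0 < j - i \<and> j - i < int n \<and> \<not> proj n (pmod n i j :: 'k gmod)"
    then have v: "valid n (i, j)" and np: "\<not> proj n (pmod n i j :: 'k gmod)" by (simp_all add: valid)
    show "\<exists>(X :: 'k gmod) Y f g. almost_split n X Y (pmod n i j) f g"
      by (rule ar[OF v]) (use np proj[OF v] in auto)
    fix X Y :: "'k gmod" and f g assume as: "almost_split n X Y (pmod n i j) f g"
    show "is_iso n X (pmod n (i - 1) (j - 1))" "is_iso n Y (dsum (pmod n (i - 1) j) (pmod n i (j - 1)))"
      using 6[OF v np as] by auto
  next
    fix i j i' j' assume "0 < j - i \<and> j - i < int n \<and> 0 < j' - i' \<and> j' - i' < int n"
    then show "num_arrows n (pmod n i j :: 'k gmod) (pmod n i' j')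
        (if (i' = i + 1 \<and> j' = j) \<or> (i' = i \<and> j' = j + 1) then 1 else 0)"
      using 7 by (simp only: valid)
  qed
qed

end
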